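(* Let $\mathbb{F}$ be a field, $G$ an abelian group, $H_1,H_2\subseteq G$ finite subgroups, $H_{12}=H_1\cap H_2$, and let $M$ be a $G$-graded $(\mathbb{F}H_1,\mathbb{F}H_2)$-bimodule with $M\cong_G\mathcal{V}\!\uparrow$ for some $\mathcal{V}\in{}_{\mathbb{F}H_{12}}\mathcal{YD}^{\mathbb{F}G}$. Then the graded triangular algebra $$\begin{pmatrix}\mathbb{F}H_1&M\\ &\mathbb{F}H_2\end{pmatrix}$$ is realized as an incidence algebra endowed with a $G$-grading (i.e. it is $G$-graded isomorphic to $I(X)$ for some finite poset $X$ and some $G$-grading on $I(X)$) if, and only if, $\mathcal{V}$ is (isomorphic to) an $\mathbb{F}H_{12}$-submodule of the regular module $\mathbb{F}H_{12}$ and $\mathbb{F}$ is a splitting field for $H_1$ and $H_2$.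
   Context: A $G$-grading on an algebra $\mathcal{A}$ is a decomposition $\mathcal{A}=\bigoplus_{g\in G}\mathcal{A}_g$ with $\mathcal{A}_g\mathcal{A}_h\subseteq\mathcal{A}_{gh}$; $\cong_G$ denotes isomorphism preserving homogeneous components. A $G$-graded $(\mathcal{A},\mathcal{B})$-bimodule is a bimodule $M=\bigoplus_{g}M_g$ with $\mathcal{A}_hM_g\mathcal{B}_k\subseteq M_{hgk}$. The group algebra $\mathbb{F}H$ of $H\subseteq G$ is graded with $\deg h=h$. A triangular algebra has the usual matrix multiplication and the direct sum grading. The incidence algebra $I(X)$ of a finite poset $X$ over $\mathbb{F}$ has basis $\{e_{xy}:x\le y\}$ and product $e_{xy}e_{wz}=\delta_{yw}e_{xz}$. ${}_{\mathbb{F}H_{12}}\mathcal{YD}^{\mathbb{F}G}$: its objects are vector spaces $\mathcal{V}$ with a representation of $H_{12}$ and a $G$-grading $\mathcal{V}=\bigoplus_g\mathcal{V}_g$ with $h\cdot\mathcal{V}_g\subseteq\mathcal{V}_{hgh^{-1}}$ for $h\in H_{12}$, $g\in G$. For such $\mathcal{V}$, $\mathcal{V}\!\uparrow=\mathbb{F}(H_1\times H_2)\otimes_{\mathbb{F}H_{12}}\mathcal{V}$, where $\mathbb{F}(H_1\times H_2)$ is a right $\mathbb{F}H_{12}$-module via $(h_1,h_2)\cdot h=(h_1h,h^{-1}h_2)$; it is a $G$-graded $(\mathbb{F}H_1,\mathbb{F}H_2)$-bimodule via $h\cdot((h_1,h_2)\otimes v)\cdot k=(hh_1,h_2k)\otimes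 v$ and $\deg((h_1,h_2)\otimes v)=h_1(\deg v)h_2$ for homogeneous $v$. "$\mathbb{F}$ is a splitting field for $H_i$" means: $\mathrm{char}\,\mathbb{F}$ does not divide $|H_i|$ and $\mathbb{F}$ contains a primitive $\exp(H_i)$-th root of $1$. *)

theory Defs
  imports Complex_Main "HOL-Algebra.Free_Abelian_Groups" "HOL-Algebra.Generated_Groups"
    "HOL-Library.Product_Plus"
begin

text \<open>
  The abelian group \<open>G\<close> is the type \<open>'g :: ab_group_add\<close>, written additively, and the field is the
  type \<open>'f :: field\<close>. The group algebra of \<open>G\<close> is the type \<open>'g \<Rightarrow>\<^sub>0 'f\<close>, whose ring multiplication
  is the convolution product; the group element \<open>g\<close> is \<open>single g 1\<close>.
\<close>

definition is_subgroup :: "'g::ab_group_add set \<Rightarrow> bool" where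
  "is_subgroup H \<longleftrightarrow> 0 \<in> H \<and> (\<forall>x\<in>H. \<forall>y\<in>H. x + y \<in> H) \<and> (\<forall>x\<in>H. - x \<in> H)"

definition group_alg :: "'g set \<Rightarrow> ('g \<Rightarrow>\<^sub>0 'f::zero) set" where
  "group_alg H = {a. Poly_Mapping.keys a \<subseteq> H}"

definition group_alg_comp :: "'g set \<Rightarrow> 'g \<Rightarrow> ('g \<Rightarrow>\<^sub>0 'f::zero) set" where
  "group_alg_comp H g = {a \<in> group_alg H. Poly_Mapping.keys a \<subseteq> {g}}"

definition pm_scale :: "'f \<Rightarrow> ('x \<Rightarrow>\<^sub>0 'f) \<Rightarrow> ('x \<Rightarrow>\<^sub>0 'f::field)" where
  "pm_scale c a = Poly_Mapping.map (\<lambda>t. c * t) a"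


section \<open>Graded vector spaces and graded algebras on a carrier\<close>

text \<open>
  The families \<open>p\<close> of homogeneous components are finitely supported, so the unique existence of \<open>p\<close>
  says that \<open>A\<close> is the direct sum of the subspaces \<open>\<Gamma> g\<close>.
\<close>

definition graded_space ::
  "('f::field \<Rightarrow> 'a::ab_group_add \<Rightarrow> 'a) \<Rightarrow> 'a set \<Rightarrow> ('g \<Rightarrow> 'a set) \<Rightarrow> bool" where
  "graded_space s A \<Gamma> \<longleftrightarrow>
     (\<forall>g. Modules.module.subspace s (\<Gamma> g) \<and> \<Gamma> g \<subseteq> A) \<and>
     (\<forall>x\<in>A. \<exists>!p :: 'g \<Rightarrow>\<^sub>0 'a. (\<forall>g. Poly_Mapping.lookup p g \<in> \<Gamma> g) \<and>
        x = (\<Sum>g\<in>Poly_Mapping.keys p. Poly_Mapping.lookup p g))"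

definition graded_algebra ::
  "('f::field \<Rightarrow> 'a::ab_group_add \<Rightarrow> 'a) \<Rightarrow> 'a set \<Rightarrow> ('a \<Rightarrow> 'a \<Rightarrow> 'a) \<Rightarrow>
   ('g::ab_group_add \<Rightarrow> 'a set) \<Rightarrow> bool" where
  "graded_algebra s A mul \<Gamma> \<longleftrightarrow> graded_space s A \<Gamma> \<and>
     (\<forall>g h. \<forall>x\<in>\<Gamma> g. \<forall>y\<in>\<Gamma> h. mul x y \<in> \<Gamma> (g + h))"

definition graded_algebra_iso ::
  "('f::field \<Rightarrow> 'a::ab_group_add \<Rightarrow> 'a) \<Rightarrow> 'a set \<Rightarrow> ('a \<Rightarrow> 'a \<Rightarrow> 'a) \<Rightarrow> ('g \<Rightarrow> 'a set) \<Rightarrow>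
   ('f \<Rightarrow> 'b::ab_group_add \<Rightarrow> 'b) \<Rightarrow> 'b set \<Rightarrow> ('b \<Rightarrow> 'b \<Rightarrow> 'b) \<Rightarrow> ('g \<Rightarrow> 'b set) \<Rightarrow> ('a \<Rightarrow> 'b) \<Rightarrow>
   bool" where
  "graded_algebra_iso s A mul \<Gamma> s' B mul' \<Gamma>' \<phi> \<longleftrightarrow>
     bij_betw \<phi> A B \<and>
     (\<forall>x\<in>A. \<forall>y\<in>A. \<phi> (x + y) = \<phi> x + \<phi> y) \<and>
     (\<forall>c. \<forall>x\<in>A. \<phi> (s c x) = s' c (\<phi> x)) \<and>
     (\<forall>x\<in>A. \<forall>y\<in>A. \<phi> (mul x y) = mul' (\<phi> x) (\<phi> y)) \<and>
     (\<forall>g. \<phi> ` \<Gamma> g = \<Gamma>' g)"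


section \<open>Graded bimodules and triangular algebras\<close>

text \<open>
  The actions of \<open>c\<cdot>1\<close> on both sides agree with the scalar \<open>c\<close>; for \<open>c = 1\<close> this gives unitality.
\<close>

locale graded_bimodule =
  fixes H1 H2 :: "'g::ab_group_add set"
    and s :: "'f::field \<Rightarrow> 'm::ab_group_add \<Rightarrow> 'm"
    and lact :: "('g \<Rightarrow>\<^sub>0 'f) \<Rightarrow> 'm \<Rightarrow> 'm"
    and ract :: "'m \<Rightarrow> ('g \<Rightarrow>\<^sub>0 'f) \<Rightarrow> 'm"
    and M :: "'g \<Rightarrow> 'm set"
  assumes vector_space: "vector_space s"
    and lact_add_left: "a \<in> group_alg H1 \<Longrightarrow> b \<in> group_alg H1 \<Longrightarrow>
          lact (a + b) m = lact a m + lact b m"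
    and lact_add_right: "a \<in> group_alg H1 \<Longrightarrow> lact a (m + n) = lact a m + lact a n"
    and lact_mult: "a \<in> group_alg H1 \<Longrightarrow> b \<in> group_alg H1 \<Longrightarrow>
          lact (a * b) m = lact a (lact b m)"
    and lact_scalar: "lact (Poly_Mapping.single 0 c) m = s c m"
    and ract_add_right: "a \<in> group_alg H2 \<Longrightarrow> b \<in> group_alg H2 \<Longrightarrow>
          ract m (a + b) = ract m a + ract m b"
    and ract_add_left: "a \<in> group_alg H2 \<Longrightarrow> ract (m + n) a = ract m a + ract n a"
    and ract_mult: "a \<in> group_alg H2 \<Longrightarrow> b \<in> group_alg H2 \<Longrightarrow>
          ract m (a * b) = ract (ract m a) b"
    and ract_scalar: "ract m (Poly_Mapping.single 0 c) = s c m"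
    and lact_ract: "a \<in> group_alg H1 \<Longrightarrow> b \<in> group_alg H2 \<Longrightarrow>
          ract (lact a m) b = lact a (ract m b)"
    and graded: "graded_space s UNIV M"
    and graded_act: "a \<in> group_alg_comp H1 h \<Longrightarrow> m \<in> M g \<Longrightarrow> b \<in> group_alg_comp H2 k \<Longrightarrow>
          ract (lact a m) b \<in> M (h + g + k)"

text \<open>The triple \<open>(a, m, b)\<close> is the matrix with rows \<open>a m\<close> and \<open>0 b\<close>.\<close>

definition tri_carrier ::
  "'g set \<Rightarrow> 'g set \<Rightarrow> (('g \<Rightarrow>\<^sub>0 'f::field) \<times> 'm \<times> ('g \<Rightarrow>\<^sub>0 'f)) set" where
  "tri_carrier H1 H2 = group_alg H1 \<times> UNIV \<times> group_alg H2"

fun tri_mult ::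
  "(('g::ab_group_add \<Rightarrow>\<^sub>0 'f::field) \<Rightarrow> 'm::ab_group_add \<Rightarrow> 'm) \<Rightarrow> ('m \<Rightarrow> ('g \<Rightarrow>\<^sub>0 'f) \<Rightarrow> 'm) \<Rightarrow>
   ('g \<Rightarrow>\<^sub>0 'f) \<times> 'm \<times> ('g \<Rightarrow>\<^sub>0 'f) \<Rightarrow> ('g \<Rightarrow>\<^sub>0 'f) \<times> 'm \<times> ('g \<Rightarrow>\<^sub>0 'f) \<Rightarrow>
   ('g \<Rightarrow>\<^sub>0 'f) \<times> 'm \<times> ('g \<Rightarrow>\<^sub>0 'f)" where
  "tri_mult lact ract (a, m, b) (a', m', b') = (a * a', lact a m' + ract m b', b * b')"

fun tri_scale ::
  "('f::field \<Rightarrow> 'm \<Rightarrow> 'm) \<Rightarrow> 'f \<Rightarrow> ('g \<Rightarrow>\<^sub>0 'f) \<times> 'm \<times> ('g \<Rightarrow>\<^sub>0 'f) \<Rightarrow>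
   ('g \<Rightarrow>\<^sub>0 'f) \<times> 'm \<times> ('g \<Rightarrow>\<^sub>0 'f)" where
  "tri_scale s c (a, m, b) = (pm_scale c a, s c m, pm_scale c b)"

definition tri_comp ::
  "'g set \<Rightarrow> 'g set \<Rightarrow> ('g \<Rightarrow> 'm set) \<Rightarrow> 'g \<Rightarrow> (('g \<Rightarrow>\<^sub>0 'f::field) \<times> 'm \<times> ('g \<Rightarrow>\<^sub>0 'f)) set" where
  "tri_comp H1 H2 M g = group_alg_comp H1 g \<times> M g \<times> group_alg_comp H2 g"


section \<open>Incidence algebras\<close>

text \<open>
  A poset is given by its order relation \<open>r\<close>, and the basis element \<open>e\<^sub>x\<^sub>y\<close> is \<open>single (x, y) 1\<close>. The
  multiplication is the bilinear extension of the product of basis elements (it is not the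
  convolution product of the type \<open>'x \<times> 'x \<Rightarrow>\<^sub>0 'f\<close>).
\<close>

definition inc_carrier :: "('x \<times> 'x) set \<Rightarrow> ('x \<times> 'x \<Rightarrow>\<^sub>0 'f::field) set" where
  "inc_carrier r = {p. Poly_Mapping.keys p \<subseteq> r}"

definition inc_mult ::
  "('x \<times> 'x \<Rightarrow>\<^sub>0 'f::field) \<Rightarrow> ('x \<times> 'x \<Rightarrow>\<^sub>0 'f) \<Rightarrow> ('x \<times> 'x \<Rightarrow>\<^sub>0 'f)" where
  "inc_mult p q =
     (\<Sum>(x, y)\<in>Poly_Mapping.keys p. \<Sum>(w, z)\<in>Poly_Mapping.keys q.
        if y = w
        then Poly_Mapping.single (x, z) (Poly_Mapping.lookup p (x, y) * Poly_Mapping.lookup q (w, z))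
        else 0)"


section \<open>Yetter--Drinfeld modules and the induced bimodule\<close>

locale yetter_drinfeld =
  fixes H :: "'g::ab_group_add set"
    and s :: "'f::field \<Rightarrow> 'v::ab_group_add \<Rightarrow> 'v"
    and \<rho> :: "'g \<Rightarrow> 'v \<Rightarrow> 'v"
    and V :: "'g \<Rightarrow> 'v set"
  assumes vector_space: "vector_space s"
    and rep_linear: "h \<in> H \<Longrightarrow> Vector_Spaces.linear s s (\<rho> h)"
    and rep_zero: "\<rho> 0 v = v"
    and rep_add: "h \<in> H \<Longrightarrow> k \<in> H \<Longrightarrow> \<rho> (h + k) v = \<rho> h (\<rho> k v)"
    and graded: "graded_space s UNIV V"
    and graded_rep: "h \<in> H \<Longrightarrow> v \<in> V g \<Longrightarrow> \<rho> h v \<in> V (h + g - h)"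

text \<open>The module structure over the group algebra determined by a representation.\<close>

definition rep_act ::
  "('f::field \<Rightarrow> 'v::ab_group_add \<Rightarrow> 'v) \<Rightarrow> ('g \<Rightarrow> 'v \<Rightarrow> 'v) \<Rightarrow> ('g \<Rightarrow>\<^sub>0 'f) \<Rightarrow> 'v \<Rightarrow> 'v" where
  "rep_act s \<rho> a v = (\<Sum>h\<in>Poly_Mapping.keys a. s (Poly_Mapping.lookup a h) (\<rho> h v))"

text \<open>
  The right action \<open>(h\<^sub>1, h\<^sub>2) \<cdot> h = (h\<^sub>1 h, h\<inverse> h\<^sub>2)\<close> and the bimodule action
  \<open>h \<cdot> (h\<^sub>1, h\<^sub>2) \<cdot> k = (h h\<^sub>1, h\<^sub>2 k)\<close>, extended linearly to the group algebras.
\<close>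

definition prod_ract ::
  "('g::ab_group_add \<times> 'g \<Rightarrow>\<^sub>0 'f::field) \<Rightarrow> ('g \<Rightarrow>\<^sub>0 'f) \<Rightarrow> ('g \<times> 'g \<Rightarrow>\<^sub>0 'f)" where
  "prod_ract x a =
     (\<Sum>(h1, h2)\<in>Poly_Mapping.keys x. \<Sum>h\<in>Poly_Mapping.keys a.
        Poly_Mapping.single (h1 + h, - h + h2)
          (Poly_Mapping.lookup x (h1, h2) * Poly_Mapping.lookup a h))"

definition prod_biact ::
  "('g::ab_group_add \<Rightarrow>\<^sub>0 'f::field) \<Rightarrow> ('g \<times> 'g \<Rightarrow>\<^sub>0 'f) \<Rightarrow> ('g \<Rightarrow>\<^sub>0 'f) \<Rightarrow> ('g \<times> 'g \<Rightarrow>\<^sub>0 'f)" where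
  "prod_biact a x b =
     (\<Sum>h\<in>Poly_Mapping.keys a. \<Sum>(h1, h2)\<in>Poly_Mapping.keys x. \<Sum>k\<in>Poly_Mapping.keys b.
        Poly_Mapping.single (h + h1, h2 + k)
          (Poly_Mapping.lookup a h * Poly_Mapping.lookup x (h1, h2) * Poly_Mapping.lookup b k))"

text \<open>
  The tensor product over the group algebra of \<open>H1 \<inter> H2\<close> of the group algebra of \<open>H1 \<times> H2\<close> and \<open>V\<close>:
  the free abelian group on pairs \<open>(x, v)\<close> modulo biadditivity and balancedness. It is multiplicatively
  written as an abelian group, following \<^const>\<open>free_Abelian_group\<close>. Its vector space structure is the
  action of the multiples \<open>c\<cdot>1\<close> of the unit, so it is part of the bimodule structure below.
\<close>

definition tensor_free :: "'g set \<Rightarrow> 'g set \<Rightarrow> (('g \<times> 'g \<Rightarrow>\<^sub>0 'f::field) \<times> 'v \<Rightarrow>\<^sub>0 int) monoid" where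
  "tensor_free H1 H2 = free_Abelian_group (group_alg (H1 \<times> H2) \<times> UNIV)"

definition tensor_rels ::
  "'g::ab_group_add set \<Rightarrow> 'g set \<Rightarrow> ('f::field \<Rightarrow> 'v::ab_group_add \<Rightarrow> 'v) \<Rightarrow> ('g \<Rightarrow> 'v \<Rightarrow> 'v) \<Rightarrow>
   (('g \<times> 'g \<Rightarrow>\<^sub>0 'f) \<times> 'v \<Rightarrow>\<^sub>0 int) set" where
  "tensor_rels H1 H2 s \<rho> =
     {frag_of (x + y, v) - frag_of (x, v) - frag_of (y, v) | x y v.
        x \<in> group_alg (H1 \<times> H2) \<and> y \<in> group_alg (H1 \<times> H2)} \<union>
     {frag_of (x, v + w) - frag_of (x, v) - frag_of (x, w) | x v w. x \<in> group_alg (H1 \<times> H2)} \<union>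
     {frag_of (prod_ract x a, v) - frag_of (x, rep_act s \<rho> a v) | x a v.
        x \<in> group_alg (H1 \<times> H2) \<and> a \<in> group_alg (H1 \<inter> H2)}"

definition tensor_ker ::
  "'g::ab_group_add set \<Rightarrow> 'g set \<Rightarrow> ('f::field \<Rightarrow> 'v::ab_group_add \<Rightarrow> 'v) \<Rightarrow> ('g \<Rightarrow> 'v \<Rightarrow> 'v) \<Rightarrow>
   (('g \<times> 'g \<Rightarrow>\<^sub>0 'f) \<times> 'v \<Rightarrow>\<^sub>0 int) set" where
  "tensor_ker H1 H2 s \<rho> = generate (tensor_free H1 H2) (tensor_rels H1 H2 s \<rho>)"

definition ind ::
  "'g::ab_group_add set \<Rightarrow> 'g set \<Rightarrow> ('f::field \<Rightarrow> 'v::ab_group_add \<Rightarrow> 'v) \<Rightarrow> ('g \<Rightarrow> 'v \<Rightarrow> 'v) \<Rightarrow>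
   (('g \<times> 'g \<Rightarrow>\<^sub>0 'f) \<times> 'v \<Rightarrow>\<^sub>0 int) set monoid" where
  "ind H1 H2 s \<rho> = tensor_free H1 H2 Mod tensor_ker H1 H2 s \<rho>"

definition ind_tensor ::
  "'g::ab_group_add set \<Rightarrow> 'g set \<Rightarrow> ('f::field \<Rightarrow> 'v::ab_group_add \<Rightarrow> 'v) \<Rightarrow> ('g \<Rightarrow> 'v \<Rightarrow> 'v) \<Rightarrow>
   ('g \<times> 'g \<Rightarrow>\<^sub>0 'f) \<Rightarrow> 'v \<Rightarrow> (('g \<times> 'g \<Rightarrow>\<^sub>0 'f) \<times> 'v \<Rightarrow>\<^sub>0 int) set" where
  "ind_tensor H1 H2 s \<rho> x v = tensor_ker H1 H2 s \<rho> #>\<^bsub>tensor_free H1 H2\<^esub> frag_of (x, v)"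

text \<open>
  The bimodule action \<open>a \<cdot> (x \<otimes> v) \<cdot> b = (a \<cdot> x \<cdot> b) \<otimes> v\<close>, applied to a coset \<open>C\<close> by acting on its
  representatives.
\<close>

definition ind_biact ::
  "'g::ab_group_add set \<Rightarrow> 'g set \<Rightarrow> ('f::field \<Rightarrow> 'v::ab_group_add \<Rightarrow> 'v) \<Rightarrow> ('g \<Rightarrow> 'v \<Rightarrow> 'v) \<Rightarrow>
   ('g \<Rightarrow>\<^sub>0 'f) \<Rightarrow> (('g \<times> 'g \<Rightarrow>\<^sub>0 'f) \<times> 'v \<Rightarrow>\<^sub>0 int) set \<Rightarrow> ('g \<Rightarrow>\<^sub>0 'f) \<Rightarrow>
   (('g \<times> 'g \<Rightarrow>\<^sub>0 'f) \<times> 'v \<Rightarrow>\<^sub>0 int) set" where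
  "ind_biact H1 H2 s \<rho> a C b =
     tensor_ker H1 H2 s \<rho> <#>\<^bsub>tensor_free H1 H2\<^esub>
       (frag_extend (\<lambda>(x, v). frag_of (prod_biact a x b, v)) ` C)"

definition ind_comp ::
  "'g::ab_group_add set \<Rightarrow> 'g set \<Rightarrow> ('f::field \<Rightarrow> 'v::ab_group_add \<Rightarrow> 'v) \<Rightarrow> ('g \<Rightarrow> 'v \<Rightarrow> 'v) \<Rightarrow>
   ('g \<Rightarrow> 'v set) \<Rightarrow> 'g \<Rightarrow> (('g \<times> 'g \<Rightarrow>\<^sub>0 'f) \<times> 'v \<Rightarrow>\<^sub>0 int) set set" where
  "ind_comp H1 H2 s \<rho> V g =
     generate (ind H1 H2 s \<rho>)
       {ind_tensor H1 H2 s \<rho> (Poly_Mapping.single (h1, h2) 1) v | h1 h2 v d.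
          h1 \<in> H1 \<and> h2 \<in> H2 \<and> v \<in> V d \<and> h1 + d + h2 = g}"

definition graded_iso_ind ::
  "'g::ab_group_add set \<Rightarrow> 'g set \<Rightarrow>
   (('g \<Rightarrow>\<^sub>0 'f::field) \<Rightarrow> 'm::ab_group_add \<Rightarrow> 'm) \<Rightarrow> ('m \<Rightarrow> ('g \<Rightarrow>\<^sub>0 'f) \<Rightarrow> 'm) \<Rightarrow> ('g \<Rightarrow> 'm set) \<Rightarrow>
   ('f \<Rightarrow> 'v::ab_group_add \<Rightarrow> 'v) \<Rightarrow> ('g \<Rightarrow> 'v \<Rightarrow> 'v) \<Rightarrow> ('g \<Rightarrow> 'v set) \<Rightarrow>
   ('m \<Rightarrow> (('g \<times> 'g \<Rightarrow>\<^sub>0 'f) \<times> 'v \<Rightarrow>\<^sub>0 int) set) \<Rightarrow> bool" where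
  "graded_iso_ind H1 H2 lact ract M s \<rho> V \<phi> \<longleftrightarrow>
     bij_betw \<phi> UNIV (carrier (ind H1 H2 s \<rho>)) \<and>
     (\<forall>m n. \<phi> (m + n) = \<phi> m \<otimes>\<^bsub>ind H1 H2 s \<rho>\<^esub> \<phi> n) \<and>
     (\<forall>a\<in>group_alg H1. \<forall>b\<in>group_alg H2. \<forall>m.
        \<phi> (ract (lact a m) b) = ind_biact H1 H2 s \<rho> a (\<phi> m) b) \<and>
     (\<forall>g. \<phi> ` M g = ind_comp H1 H2 s \<rho> V g)"


section \<open>Submodules of the regular module, splitting fields\<close>

definition regular_submodule :: "'g::ab_group_add set \<Rightarrow> ('g \<Rightarrow>\<^sub>0 'f::field) set \<Rightarrow> bool" where
  "regular_submodule H N \<longleftrightarrow> N \<subseteq> group_alg H \<and> 0 \<in> N \<and>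
     (\<forall>x\<in>N. \<forall>y\<in>N. x + y \<in> N) \<and> (\<forall>a\<in>group_alg H. \<forall>x\<in>N. a * x \<in> N)"

definition module_iso_regular ::
  "'g::ab_group_add set \<Rightarrow> ('f::field \<Rightarrow> 'v::ab_group_add \<Rightarrow> 'v) \<Rightarrow> ('g \<Rightarrow> 'v \<Rightarrow> 'v) \<Rightarrow>
   ('g \<Rightarrow>\<^sub>0 'f) set \<Rightarrow> ('v \<Rightarrow> ('g \<Rightarrow>\<^sub>0 'f)) \<Rightarrow> bool" where
  "module_iso_regular H s \<rho> N \<psi> \<longleftrightarrow>
     bij_betw \<psi> UNIV N \<and>
     (\<forall>v w. \<psi> (v + w) = \<psi> v + \<psi> w) \<and>
     (\<forall>a\<in>group_alg H. \<forall>v. \<psi> (rep_act s \<rho> a v) = a * \<psi> v)"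

definition group_exponent :: "'g::ab_group_add set \<Rightarrow> nat" where
  "group_exponent H = (LEAST n. 0 < n \<and> (\<forall>h\<in>H. (\<Sum>i<n. h) = 0))"

definition primitive_root_of_unity :: "nat \<Rightarrow> 'f::field \<Rightarrow> bool" where
  "primitive_root_of_unity n z \<longleftrightarrow> z ^ n = 1 \<and> (\<forall>k. 0 < k \<and> k < n \<longrightarrow> z ^ k \<noteq> 1)"

text \<open>Fields of characteristic \<open>0\<close> satisfy the first condition, as \<open>0\<close> does not divide \<open>card H > 0\<close>.\<close>

definition splitting_field :: "'f::field itself \<Rightarrow> 'g::ab_group_add set \<Rightarrow> bool" where
  "splitting_field F H \<longleftrightarrow> \<not> CHAR('f) dvd card H \<and>
     (\<exists>z::'f. primitive_root_of_unity (group_exponent H) z)"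

end

theory Submission
  imports Defs "HOL-Computational_Algebra.Polynomial" "HOL-Computational_Algebra.Primes"
begin

text \<open>
  Write \<open>e\<^sub>\<chi>\<close> for the idempotent of a character \<open>\<chi>\<close>. Over a splitting field the \<open>e\<^sub>\<chi>\<close> with \<open>\<chi>\<close>
  running through the characters of \<open>H\<^sub>i\<close> are orthogonal with sum \<open>1\<close>, and \<open>e\<^sub>\<chi> M e\<^sub>\<eta>\<close> is isomorphic
  to \<open>e\<^sub>\<mu> \<V>\<close>, where \<open>\<mu>\<close> is the restriction of \<open>\<chi>\<eta>\<inverse>\<close> to \<open>H\<^sub>1\<^sub>2\<close>. The module \<open>\<V>\<close> embeds into the regular
  module iff every \<open>e\<^sub>\<mu> \<V>\<close> is at most one-dimensional, that is, iff every \<open>e\<^sub>\<chi> M e\<^sub>\<eta>\<close> is. In that case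
  the idempotents and spanning vectors of the nonzero \<open>e\<^sub>\<chi> M e\<^sub>\<eta>\<close> multiply like the matrix units of
  the poset on the disjoint union of the two character groups in which \<open>\<chi> < \<eta>\<close> iff
  \<open>e\<^sub>\<chi> M e\<^sub>\<eta> \<noteq> 0\<close>. Conversely, in an incidence algebra a commutative corner is separated by the
  diagonal maps, which forces splitting fields, and a component \<open>f I g\<close> is at most one-dimensional
  as soon as the corners of \<open>f\<close> and \<open>g\<close> are. The grading plays no role: it is transported along
  the isomorphism.
\<close>

section \<open>Group algebras\<close>

text \<open>Splitting is handled in two forms: the arithmetic \<open>splitting_field\<close> and the
  structural \<open>splits\<close>, where the character idempotents sum to \<open>1\<close>. The
  first yields the second by simultaneous diagonalisation. An incidence algebra only supplies a
  separating family of multiplicative functions on the group, and from these the root of unity has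
  to be built prime by prime. \<open>M\<close> and \<open>\<V>\<close> carry no finiteness
  assumption, so "at most one-dimensional" is expressed by a single vector of which every element is
  a multiple; this replaces dimension counts throughout. The obstacle on the module side is that the
  induced bimodule is a quotient of a free abelian group, where it is hard to see that a tensor is
  nonzero. An explicit balanced map back into \<open>\<V>\<close> detects this. Every character of
  \<open>H1 \<inter> H2\<close> has to occur as a quotient of a character of \<open>H1\<close> by
  one of \<open>H2\<close>; this holds because it extends to \<open>H1\<close>, with the trivial
  character taken on \<open>H2\<close>. The relation on the two character groups is a partial order
  at once: strict relations lead from the first group to the second, so no two of them
  compose.\<close>

lemma poly_mapping_sum_single:
  assumes "finite S" "Poly_Mapping.keys a \<subseteq> S"
  shows "(\<Sum>h\<in>S. Poly_Mapping.single h (Poly_Mapping.lookup a h)) = a"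
proof (rule poly_mapping_eqI)
  fix k
  have "(\<Sum>h\<in>S. Poly_Mapping.lookup (Poly_Mapping.single h (Poly_Mapping.lookup a h)) k)
      = (\<Sum>h\<in>S. if h = k then Poly_Mapping.lookup a k else 0)"
    by (rule sum.cong) (auto simp: lookup_single when_def)
  then show "Poly_Mapping.lookup (\<Sum>h\<in>S. Poly_Mapping.single h (Poly_Mapping.lookup a h)) k
      = Poly_Mapping.lookup a k"
    using assms by (auto simp: lookup_sum in_keys_iff)
qed

lemma sum_keys_superset:
  assumes "finite S" "Poly_Mapping.keys a \<subseteq> S" "\<And>h. f h 0 = 0"
  shows "(\<Sum>h\<in>Poly_Mapping.keys a. f h (Poly_Mapping.lookup a h))
       = (\<Sum>h\<in>S. f h (Poly_Mapping.lookup a h))"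
  by (rule sum.mono_neutral_left) (use assms in \<open>auto simp: in_keys_iff\<close>)

text \<open>Cancellation may shrink the support of \<open>a + b\<close>, so all three sums are moved
  to the union of the supports. Additivity of \<open>ev\<close>, \<open>lin_ext\<close>,
  \<open>rep_act\<close> and of the extension to the free abelian group comes from here.\<close>

lemma sum_keys_add:
  fixes f :: "'k \<Rightarrow> 'a::monoid_add \<Rightarrow> 'b::comm_monoid_add"
  assumes "\<And>h. f h 0 = 0" "\<And>h x y. f h (x + y) = f h x + f h y"
  shows "(\<Sum>h\<in>Poly_Mapping.keys (a + b). f h (Poly_Mapping.lookup (a + b) h))
     = (\<Sum>h\<in>Poly_Mapping.keys a. f h (Poly_Mapping.lookup a h))
       + (\<Sum>h\<in>Poly_Mapping.keys b. f h (Poly_Mapping.lookup b h))"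
proof -
  let ?S = "Poly_Mapping.keys a \<union> Poly_Mapping.keys b"
  have s: "finite ?S" "Poly_Mapping.keys (a + b) \<subseteq> ?S" by (auto simp: keys_add)
  show ?thesis
    using s by (subst (1 2 3) sum_keys_superset[of ?S])
      (auto simp: assms lookup_add sum.distrib)
qed

text \<open>Every element is the finite sum of its monomials. Restricting the monomial case to the
  keys of \<open>a\<close> makes the rule usable inside \<open>group_alg H\<close>.\<close>

lemma poly_mapping_induct_single [case_names zero single add]:
  assumes "P 0" "\<And>h c. h \<in> Poly_Mapping.keys a \<Longrightarrow> P (Poly_Mapping.single h c)"
    "\<And>a b. P a \<Longrightarrow> P b \<Longrightarrow> P (a + b)"
  shows "P (a :: 'g \<Rightarrow>\<^sub>0 'f::comm_monoid_add)"
proof -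
  have "P (\<Sum>h\<in>S. Poly_Mapping.single h (Poly_Mapping.lookup a h))"
    if "S \<subseteq> Poly_Mapping.keys a" "finite S" for S
    using that(2,1) by (induction S) (auto intro: assms)
  then show ?thesis
    using poly_mapping_sum_single[of "Poly_Mapping.keys a" a] by (metis finite_keys order_refl)
qed

lemma group_alg_simps [simp, intro]:
  "0 \<in> group_alg H" "a \<in> group_alg H \<Longrightarrow> b \<in> group_alg H \<Longrightarrow> a + b \<in> group_alg H"
  by (auto simp: group_alg_def dest: subsetD[OF keys_add])

lemma group_alg_uminus [simp, intro]: "a \<in> group_alg H \<Longrightarrow> - a \<in> group_alg H"
  for a :: "'g \<Rightarrow>\<^sub>0 'f::ab_group_add"
  by (auto simp: group_alg_def in_keys_iff)

lemma group_alg_diff [simp, intro]: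
  "a \<in> group_alg H \<Longrightarrow> b \<in> group_alg H \<Longrightarrow> a - b \<in> group_alg H"
  for a :: "'g \<Rightarrow>\<^sub>0 'f::ab_group_add"
  using group_alg_simps(2)[OF _ group_alg_uminus, of a H b] by simp

lemma group_alg_sum [intro]: "(\<And>i. i \<in> I \<Longrightarrow> f i \<in> group_alg H) \<Longrightarrow> sum f I \<in> group_alg H"
  by (induction I rule: infinite_finite_induct) auto

lemma group_alg_single [simp, intro]: "h \<in> H \<Longrightarrow> Poly_Mapping.single h c \<in> group_alg H"
  by (auto simp: group_alg_def)

lemma is_subgroupD:
  assumes "is_subgroup H"
  shows "0 \<in> H" "x \<in> H \<Longrightarrow> y \<in> H \<Longrightarrow> x + y \<in> H" "x \<in> H \<Longrightarrow> - x \<in> H"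
    "x \<in> H \<Longrightarrow> y \<in> H \<Longrightarrow> x - y \<in> H"
proof -
  show *: "0 \<in> H" "x \<in> H \<Longrightarrow> y \<in> H \<Longrightarrow> x + y \<in> H" "x \<in> H \<Longrightarrow> - x \<in> H" for x y
    using assms by (auto simp: is_subgroup_def)
  show "x \<in> H \<Longrightarrow> y \<in> H \<Longrightarrow> x - y \<in> H"
    using *(2)[of x "- y"] *(3)[of y] by simp
qed

lemma is_subgroup_Int: "is_subgroup H \<Longrightarrow> is_subgroup K \<Longrightarrow> is_subgroup (H \<inter> K)"
  by (auto simp: is_subgroup_def)

lemma is_subgroup_Times: "is_subgroup H \<Longrightarrow> is_subgroup K \<Longrightarrow> is_subgroup (H \<times> K)"
  by (auto simp: is_subgroup_def zero_prod_def)

lemma group_alg_mult: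
  assumes "is_subgroup H" "a \<in> group_alg H" "b \<in> group_alg H"
  shows "a * b \<in> group_alg H"
  using keys_mult[of a b] assms is_subgroupD(2)[OF assms(1)] by (fastforce simp: group_alg_def)

lemma group_alg_one: "is_subgroup H \<Longrightarrow> 1 \<in> group_alg H"
  by (auto simp: group_alg_def is_subgroup_def)

lemma group_alg_induct [consumes 1, case_names zero single add]:
  assumes "a \<in> group_alg H" "P 0" "\<And>h c. h \<in> H \<Longrightarrow> P (Poly_Mapping.single h c)"
    "\<And>a b. P a \<Longrightarrow> P b \<Longrightarrow> P (a + b)"
  shows "P (a :: 'g \<Rightarrow>\<^sub>0 'f::comm_monoid_add)"
  by (rule poly_mapping_induct_single) (use assms in \<open>auto simp: group_alg_def\<close>)

lemma pm_scale_conv: "pm_scale c a = Poly_Mapping.single 0 c * a"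
  for a :: "'g::monoid_add \<Rightarrow>\<^sub>0 'f::field"
  unfolding pm_scale_def by (rule mult_map_scale_conv_mult)

lemma lookup_pm_scale [simp]:
  "Poly_Mapping.lookup (pm_scale c a) k = c * Poly_Mapping.lookup a k"
  unfolding pm_scale_def by transfer (auto simp: when_def)

lemma single_0_cancel:
  fixes e :: "'g::ab_group_add \<Rightarrow>\<^sub>0 'f::field"
  assumes "Poly_Mapping.single 0 c * e = Poly_Mapping.single 0 d * e" "e \<noteq> 0"
  shows "c = d"
proof -
  obtain k where k: "Poly_Mapping.lookup e k \<noteq> 0" using assms(2) by (metis lookup_zero poly_mapping_eqI)
  have "Poly_Mapping.lookup (pm_scale c e) k = Poly_Mapping.lookup (pm_scale d e) k"
    using assms(1) by (simp add: pm_scale_conv)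
  then show ?thesis using k by simp
qed


section \<open>Characters and their idempotents\<close>

text \<open>The value \<open>0\<close> outside \<open>H\<close> makes a character a function on the
  whole type that is determined by its restriction to \<open>H\<close>, so characters can be
  compared for equality and summed over. The condition at \<open>0\<close> excludes the zero
  function.\<close>

definition chars :: "'g::ab_group_add set \<Rightarrow> ('g \<Rightarrow> 'f::field) set" where
  "chars H = {\<chi>. \<chi> 0 = 1 \<and> (\<forall>x\<in>H. \<forall>y\<in>H. \<chi> (x + y) = \<chi> x * \<chi> y) \<and> (\<forall>x. x \<notin> H \<longrightarrow> \<chi> x = 0)}"

text \<open>Linear extension to the group algebra. It is also applied to functions not yet known to
  be characters, such as the diagonal entries in an incidence algebra.\<close>

definition ev :: "('g \<Rightarrow> 'f::field) \<Rightarrow> ('g \<Rightarrow>\<^sub>0 'f) \<Rightarrow> 'f" where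
  "ev \<chi> a = (\<Sum>h\<in>Poly_Mapping.keys a. Poly_Mapping.lookup a h * \<chi> h)"

text \<open>The classical idempotent of a character. If \<open>card H\<close> vanishes in the field,
  division by zero makes it \<open>0\<close>.\<close>

definition char_idem :: "'g::ab_group_add set \<Rightarrow> ('g \<Rightarrow> 'f::field) \<Rightarrow> ('g \<Rightarrow>\<^sub>0 'f)" where
  "char_idem H \<chi> = (\<Sum>h\<in>H. Poly_Mapping.single h (\<chi> (- h) / of_nat (card H)))"

text \<open>For a finite subgroup this says that the group algebra is a product of copies of the
  field. Invertibility of \<open>card H\<close> is implicit, because \<open>char_idem\<close>
  degenerates to \<open>0\<close> otherwise.\<close>

definition splits :: "'f::field itself \<Rightarrow> 'g::ab_group_add set \<Rightarrow> bool" where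
  "splits F H \<longleftrightarrow> (\<Sum>\<chi>\<in>chars H. char_idem H \<chi>) = (1 :: 'g \<Rightarrow>\<^sub>0 'f)"

lemma charsD:
  assumes "\<chi> \<in> chars H"
  shows "\<chi> 0 = 1" "x \<in> H \<Longrightarrow> y \<in> H \<Longrightarrow> \<chi> (x + y) = \<chi> x * \<chi> y" "x \<notin> H \<Longrightarrow> \<chi> x = 0"
  using assms by (auto simp: chars_def)

lemma ev_0 [simp]: "ev \<chi> 0 = 0"
  by (simp add: ev_def)

lemma ev_add: "ev \<chi> (a + b) = ev \<chi> a + ev \<chi> b"
  unfolding ev_def by (rule sum_keys_add) (auto simp: algebra_simps)

lemma ev_single [simp]: "ev \<chi> (Poly_Mapping.single h c) = c * \<chi> h"
  by (cases "c = 0") (auto simp: ev_def)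

lemma ev_sum: "ev \<chi> (sum f I) = (\<Sum>i\<in>I. ev \<chi> (f i))"
  by (induction I rule: infinite_finite_induct) (auto simp: ev_add)

lemma ev_single_mult:
  fixes a :: "'g::ab_group_add \<Rightarrow>\<^sub>0 'f::field"
  assumes "a \<in> group_alg H" "\<And>x y. x \<in> H \<Longrightarrow> y \<in> H \<Longrightarrow> \<chi> (x + y) = \<chi> x * \<chi> y" "h \<in> H"
  shows "ev \<chi> (Poly_Mapping.single h c * a) = c * \<chi> h * ev \<chi> a"
  using assms(1) by (induction rule: group_alg_induct)
    (auto simp: ev_add distrib_left mult_single assms algebra_simps)

lemma ev_mult:
  fixes a :: "'g::ab_group_add \<Rightarrow>\<^sub>0 'f::field"
  assumes "a \<in> group_alg H" "b \<in> group_alg H"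
    "\<And>x y. x \<in> H \<Longrightarrow> y \<in> H \<Longrightarrow> \<chi> (x + y) = \<chi> x * \<chi> y"
  shows "ev \<chi> (a * b) = ev \<chi> a * ev \<chi> b"
  using assms(1) by (induction rule: group_alg_induct)
    (auto simp: ev_add distrib_right ev_single_mult[OF assms(2,3)])

lemma char_idem_in [simp, intro]: "char_idem H \<chi> \<in> group_alg H"
  by (auto simp: char_idem_def)

lemma lookup_char_idem:
  assumes "finite H"
  shows "Poly_Mapping.lookup (char_idem H \<chi>) h = (if h \<in> H then \<chi> (- h) / of_nat (card H) else 0)"
proof -
  have "Poly_Mapping.lookup (char_idem H \<chi>) h
      = (\<Sum>k\<in>H. if k = h then \<chi> (- h) / of_nat (card H) else 0)"
    unfolding char_idem_def lookup_sum by (rule sum.cong) (auto simp: lookup_single when_def)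
  then show ?thesis using assms by auto
qed

context
  fixes H :: "'g::ab_group_add set"
  assumes sub: "is_subgroup H" and fin: "finite H"
begin

lemma card_subgroup_pos: "card H > 0"
  using sub fin by (auto simp: is_subgroup_def card_gt_0_iff)

text \<open>Translation by \<open>h\<close> permutes \<open>H\<close> and turns the coefficient
  \<open>\<chi> (- k)\<close> into \<open>\<chi> (h - k) = \<chi> h * \<chi> (- k)\<close>.\<close>

lemma char_idem_single:
  fixes \<chi> :: "'g \<Rightarrow> 'f::field"
  assumes "\<chi> \<in> chars H" "h \<in> H"
  shows "Poly_Mapping.single h c * char_idem H \<chi> = Poly_Mapping.single 0 (c * \<chi> h) * char_idem H \<chi>"
proof -
  have "Poly_Mapping.single h c * char_idem H \<chi>
      = (\<Sum>k\<in>H. Poly_Mapping.single (h + k) (c * (\<chi> (- k) / of_nat (card H))))"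
    by (simp add: char_idem_def sum_distrib_left mult_single)
  also have "\<dots> = (\<Sum>k\<in>H. Poly_Mapping.single k (c * (\<chi> (h - k) / of_nat (card H))))"
    by (rule sum.reindex_bij_witness[of _ "\<lambda>k. k - h" "\<lambda>k. h + k"])
      (use is_subgroupD[OF sub] assms in auto)
  also have "\<dots> = (\<Sum>k\<in>H. Poly_Mapping.single k (c * \<chi> h * (\<chi> (- k) / of_nat (card H))))"
    using charsD(2)[OF assms(1,2) is_subgroupD(3)[OF sub]] by (intro sum.cong) (auto simp: mult.assoc)
  also have "\<dots> = Poly_Mapping.single 0 (c * \<chi> h) * char_idem H \<chi>"
    by (simp add: char_idem_def sum_distrib_left mult_single)
  finally show ?thesis .
qed

text \<open>Linear extension of \<open>char_idem_single\<close>. It makes the ideal generated by the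
  idempotent a line, the source of all later one-dimensional corners.\<close>

lemma char_idem_mult:
  fixes \<chi> :: "'g \<Rightarrow> 'f::field"
  assumes "\<chi> \<in> chars H" "a \<in> group_alg H"
  shows "a * char_idem H \<chi> = Poly_Mapping.single 0 (ev \<chi> a) * char_idem H \<chi>"
  using assms(2) by (induction rule: group_alg_induct)
    (auto simp: char_idem_single[OF assms(1)] ev_add distrib_right single_add)

lemma char_inverse:
  assumes "\<chi> \<in> chars H" "h \<in> H"
  shows "\<chi> (- h) * \<chi> h = (1 :: 'f::field)" "\<chi> h * \<chi> (- h) = 1" "\<chi> h \<noteq> 0"
proof -
  show "\<chi> (- h) * \<chi> h = 1"
    using charsD(2)[OF assms(1), of "- h" h] charsD(1)[OF assms(1)] is_subgroupD(3)[OF sub assms(2)]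
      assms(2) by simp
  then show "\<chi> h * \<chi> (- h) = 1" "\<chi> h \<noteq> 0" by (auto simp: mult.commute)
qed

lemma ev_char_idem_self:
  fixes \<chi> :: "'g \<Rightarrow> 'f::field"
  assumes "\<chi> \<in> chars H" "of_nat (card H) \<noteq> (0::'f)"
  shows "ev \<chi> (char_idem H \<chi>) = 1"
proof -
  have "ev \<chi> (char_idem H \<chi>) = (\<Sum>h\<in>H. \<chi> (- h) * \<chi> h / of_nat (card H))"
    by (simp add: char_idem_def ev_sum)
  also have "\<dots> = (\<Sum>h\<in>H. 1 / of_nat (card H))"
    using char_inverse[OF assms(1)] by (intro sum.cong) auto
  also have "\<dots> = 1" using assms(2) by simp
  finally show ?thesis .
qed

lemma char_idem_idem:
  fixes \<chi> :: "'g \<Rightarrow> 'f::field"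
  assumes "\<chi> \<in> chars H" "of_nat (card H) \<noteq> (0::'f)"
  shows "char_idem H \<chi> * char_idem H \<chi> = char_idem H \<chi>"
  using char_idem_mult[OF assms(1) char_idem_in] ev_char_idem_self[OF assms] by simp

lemma char_idem_nonzero:
  fixes \<chi> :: "'g \<Rightarrow> 'f::field"
  assumes "\<chi> \<in> chars H" "of_nat (card H) \<noteq> (0::'f)"
  shows "char_idem H \<chi> \<noteq> 0"
  using ev_char_idem_self[OF assms] by auto

lemma char_eqI:
  assumes "\<chi> \<in> chars H" "\<psi> \<in> chars H" "\<And>h. h \<in> H \<Longrightarrow> \<chi> h = \<psi> h"
  shows "\<chi> = \<psi>"
  using assms by (metis charsD(3) ext)

text \<open>A nonzero product would be an eigenvector of some \<open>h\<close> with
  \<open>\<chi> h \<noteq> \<psi> h\<close> for both eigenvalues.\<close>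

lemma char_idem_orthogonal:
  fixes \<chi> \<psi> :: "'g \<Rightarrow> 'f::field"
  assumes "\<chi> \<in> chars H" "\<psi> \<in> chars H" "\<chi> \<noteq> \<psi>"
  shows "char_idem H \<chi> * char_idem H \<psi> = 0"
proof (rule ccontr)
  assume nz: "char_idem H \<chi> * char_idem H \<psi> \<noteq> 0"
  obtain h where h: "h \<in> H" "\<chi> h \<noteq> \<psi> h" using char_eqI assms by metis
  have "Poly_Mapping.single 0 (\<chi> h) * (char_idem H \<chi> * char_idem H \<psi>)
      = Poly_Mapping.single h 1 * char_idem H \<chi> * char_idem H \<psi>"
    using char_idem_single[OF assms(1) h(1), of 1] by (simp add: mult.assoc)
  also have "\<dots> = char_idem H \<chi> * (Poly_Mapping.single h 1 * char_idem H \<psi>)"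
    by (simp add: ac_simps)
  also have "\<dots> = Poly_Mapping.single 0 (\<psi> h) * (char_idem H \<chi> * char_idem H \<psi>)"
    using char_idem_single[OF assms(2) h(1), of 1] by (simp add: ac_simps)
  finally show False using single_0_cancel[OF _ nz] h(2) by blast
qed

text \<open>The product \<open>char_idem H \<chi> * b\<close> is computed twice: by the eigenvector
  property it is \<open>ev \<chi> (char_idem H \<chi>) = 1\<close> times \<open>b\<close>, and by
  \<open>char_idem_mult\<close> it is a multiple of the idempotent.\<close>

lemma eigenvector_conv_char_idem:
  fixes b :: "'g \<Rightarrow>\<^sub>0 'f::field"
  assumes "\<chi> \<in> chars H" "of_nat (card H) \<noteq> (0::'f)" "b \<in> group_alg H"
    "\<And>h. h \<in> H \<Longrightarrow> Poly_Mapping.single h 1 * b = Poly_Mapping.single 0 (\<chi> h) * b"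
  shows "b = Poly_Mapping.single 0 (ev \<chi> b) * char_idem H \<chi>"
proof -
  have *: "Poly_Mapping.single h c * b = Poly_Mapping.single 0 (c * \<chi> h) * b" if "h \<in> H" for h c
  proof -
    have "Poly_Mapping.single h c * b = Poly_Mapping.single 0 c * (Poly_Mapping.single h 1 * b)"
      by (simp add: mult.assoc[symmetric] mult_single)
    then show ?thesis using assms(4)[OF that] by (simp add: mult.assoc[symmetric] mult_single)
  qed
  have "a * b = Poly_Mapping.single 0 (ev \<chi> a) * b" if "a \<in> group_alg H" for a
    using that by (induction rule: group_alg_induct) (auto simp: * ev_add distrib_right single_add)
  from this[OF char_idem_in, of \<chi>] have "char_idem H \<chi> * b = b"
    by (simp add: ev_char_idem_self[OF assms(1,2)])
  then show ?thesis using char_idem_mult[OF assms(1,3)] by (simp add: mult.commute)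
qed

text \<open>Lagrange for elements of an abelian group: translating by \<open>h\<close> fixes the sum
  of all elements of \<open>H\<close>, but also adds \<open>card H\<close> copies of
  \<open>h\<close>.\<close>

lemma card_times_subgroup:
  assumes "h \<in> H"
  shows "(\<Sum>i<card H. h) = 0"
proof -
  have "(\<Sum>x\<in>H. x) = (\<Sum>x\<in>H. h + x)"
    by (rule sum.reindex_bij_witness[of _ "\<lambda>k. h + k" "\<lambda>k. k - h"])
      (use is_subgroupD[OF sub] assms in auto)
  then have "(\<Sum>x\<in>H. h) = 0" by (simp add: sum.distrib)
  moreover have "sum (\<lambda>_. h) A = (\<Sum>i<card A. h)" if "finite A" for A :: "'g set"
    using that by induction (auto simp: add.commute)
  ultimately show ?thesis using fin by simp
qed

end

lemma mult_of_char:
  fixes \<chi> :: "'g::ab_group_add \<Rightarrow> 'f::field"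
  assumes "is_subgroup H" "h \<in> H"
    "\<And>x y. x \<in> H \<Longrightarrow> y \<in> H \<Longrightarrow> \<chi> (x + y) = \<chi> x * \<chi> y" "\<chi> 0 = 1"
  shows "(\<Sum>i<(n::nat). h) \<in> H \<and> \<chi> (\<Sum>i<n. h) = \<chi> h ^ n"
  by (induction n) (use assms is_subgroupD[OF assms(1)] in \<open>auto simp: mult.commute\<close>)

lemma single_power:
  "Poly_Mapping.single h c ^ n = Poly_Mapping.single (\<Sum>i<n. h) (c ^ n)"
  for h :: "'g::ab_group_add" and c :: "'f::field"
  by (induction n) (auto simp: mult_single single_one add.commute)

text \<open>By \<open>card_times_subgroup\<close> the number \<open>card H\<close> is admissible, so
  the \<open>LEAST\<close> in the definition is attained.\<close>

lemma group_exponent_works: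
  assumes "is_subgroup H" "finite H"
  shows "group_exponent H > 0" "h \<in> H \<Longrightarrow> (\<Sum>i<group_exponent H. h) = 0"
    "0 < n \<Longrightarrow> (\<And>h. h \<in> H \<Longrightarrow> (\<Sum>i<n. h) = 0) \<Longrightarrow> group_exponent H \<le> n"
proof -
  let ?P = "\<lambda>n. 0 < n \<and> (\<forall>h\<in>H. (\<Sum>i<n. h) = 0)"
  have "?P (card H)"
    using card_subgroup_pos[OF assms] card_times_subgroup[OF assms] by blast
  from LeastI[of ?P, OF this] have "?P (group_exponent H)" unfolding group_exponent_def .
  then show "group_exponent H > 0" "h \<in> H \<Longrightarrow> (\<Sum>i<group_exponent H. h) = 0" by auto
  show "0 < n \<Longrightarrow> (\<And>h. h \<in> H \<Longrightarrow> (\<Sum>i<n. h) = 0) \<Longrightarrow> group_exponent H \<le> n"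
    unfolding group_exponent_def by (rule Least_le) auto
qed

lemma finite_roots_of_unity_field:
  assumes "n > 0"
  shows "finite {z::'f::field. z ^ n = 1}"
proof -
  have "[:- 1:] + monom (1::'f) n \<noteq> 0"
  proof
    assume "[:- 1:] + monom (1::'f) n = 0"
    then have "coeff ([:- 1:] + monom (1::'f) n) 0 = 0" by simp
    then show False using assms by simp
  qed
  from poly_roots_finite[OF this] show ?thesis
    by (rule rev_finite_subset) (auto simp: poly_monom)
qed

text \<open>The values on \<open>H\<close> are roots of unity of order dividing
  \<open>card H\<close>, and a polynomial over a field has only finitely many roots.\<close>

lemma finite_chars:
  assumes "is_subgroup H" "finite H"
  shows "finite (chars H :: ('g::ab_group_add \<Rightarrow> 'f::field) set)"
proof (rule finite_subset)
  let ?R = "{z::'f. z ^ card H = 1}"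
  show "finite {\<chi>. \<forall>x. (x \<in> H \<longrightarrow> \<chi> x \<in> ?R) \<and> (x \<notin> H \<longrightarrow> \<chi> x = 0)}"
    by (rule finite_set_of_finite_funs)
      (auto intro: assms finite_roots_of_unity_field card_subgroup_pos)
  have "\<chi> x ^ card H = 1" if "x \<in> H" "\<chi> \<in> chars H" for x and \<chi> :: "'g \<Rightarrow> 'f"
    using mult_of_char[OF assms(1) that(1) charsD(2,1)[OF that(2)], of "card H"]
      card_times_subgroup[OF assms that(1)] charsD(1)[OF that(2)] by auto
  then show "(chars H :: ('g \<Rightarrow> 'f) set)
      \<subseteq> {\<chi>. \<forall>x. (x \<in> H \<longrightarrow> \<chi> x \<in> ?R) \<and> (x \<notin> H \<longrightarrow> \<chi> x = 0)}"
    using charsD(3) by auto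
qed

section \<open>Splitting fields\<close>

text \<open>With \<open>card H\<close> zero in the field every \<open>char_idem\<close> would be
  \<open>0\<close>, and so would their sum \<open>1\<close>.\<close>

lemma splits_card:
  assumes "splits TYPE('f::field) H"
  shows "of_nat (card H) \<noteq> (0::'f)"
proof
  assume "of_nat (card H) = (0::'f)"
  then have "char_idem H \<chi> = 0" for \<chi> :: "_ \<Rightarrow> 'f" by (simp add: char_idem_def)
  then show False using assms by (simp add: splits_def)
qed

lemma sum_powers_root_of_unity:
  fixes y :: "'a::comm_ring_1"
  assumes "y ^ n = 1"
  shows "y * (\<Sum>j<n. y ^ j) = (\<Sum>j<n. y ^ j)"
proof -
  have "(y - 1) * (\<Sum>j<n. y ^ j) = 0"
    using power_diff_1_eq[of y n] assms by simp
  then show ?thesis by (simp add: algebra_simps)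
qed

text \<open>Discrete Fourier analysis of the multiplication by \<open>h\<close>. Splitting off the eigenvectors of one
  element of \<open>H\<close> after the other leads to common eigenvectors.\<close>

lemma root_of_unity_decomposition:
  fixes z :: "'f::field" and h :: "'g::ab_group_add"
  assumes "n > 0" "of_nat n \<noteq> (0::'f)" "primitive_root_of_unity n z" "(\<Sum>i<n. h) = 0"
  defines "E \<equiv> (\<lambda>i. Poly_Mapping.single 0 (1 / of_nat n) *
     (\<Sum>j<n. (Poly_Mapping.single 0 (inverse z ^ i) * Poly_Mapping.single h 1) ^ j)
     :: 'g \<Rightarrow>\<^sub>0 'f)"
  shows "(\<Sum>i<n. E i) = 1"
    and "Poly_Mapping.single h 1 * E i = Poly_Mapping.single 0 (z ^ i) * E i"
proof -
  have zn: "z ^ n = 1" and zk: "\<And>k. 0 < k \<Longrightarrow> k < n \<Longrightarrow> z ^ k \<noteq> 1"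
    using assms(3) by (auto simp: primitive_root_of_unity_def)
  have z0: "z \<noteq> 0" using zn assms(1) by (metis power_0_left not_gr_zero zero_neq_one)
  let ?X = "Poly_Mapping.single h (1::'f)"
  let ?s = "Poly_Mapping.single (0::'g) :: 'f \<Rightarrow> _"
  let ?Y = "?s (inverse z ^ i) * ?X"
  have Xn: "?X ^ n = 1" by (simp add: single_power assms(4))
  have s_pow: "?s c ^ j = ?s (c ^ j)" for c j by (simp add: single_power)
  have "?Y ^ n = 1"
  proof -
    have "(inverse z ^ i) ^ n = (inverse z ^ n) ^ i" by (simp add: power_mult[symmetric] mult.commute)
    then show ?thesis using Xn zn by (simp add: power_mult_distrib s_pow power_inverse)
  qed
  \<comment> \<open>\<open>E i\<close> is the average of the powers of \<open>?Y\<close>, that is,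
    of \<open>h\<close> divided by \<open>z ^ i\<close>. Being fixed by \<open>?Y\<close> means that
    \<open>h\<close> acts on it as \<open>z ^ i\<close>.\<close>
  from sum_powers_root_of_unity[OF this] have "?Y * E i = E i"
    unfolding E_def by (simp add: ac_simps)
  then have "?s (z ^ i) * E i = ?s (z ^ i) * (?Y * E i)" by simp
  also have "\<dots> = (?s (z ^ i) * ?s (inverse z ^ i)) * (?X * E i)" by (simp add: ac_simps)
  also have "?s (z ^ i) * ?s (inverse z ^ i) = 1"
    using z0 by (simp add: mult_single power_mult_distrib[symmetric])
  finally show "?X * E i = ?s (z ^ i) * E i" by simp
  have "(\<Sum>i<n. E i) = ?s (1 / of_nat n) * (\<Sum>i<n. \<Sum>j<n. (?s (inverse z ^ i) * ?X) ^ j)"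
    unfolding E_def by (simp add: sum_distrib_left)
  also have "(\<Sum>i<n. \<Sum>j<n. (?s (inverse z ^ i) * ?X) ^ j)
      = (\<Sum>j<n. \<Sum>i<n. ?s ((inverse z ^ j) ^ i) * ?X ^ j)"
    by (subst sum.swap) (simp add: power_mult_distrib s_pow power_mult[symmetric] mult.commute)
  also have "\<dots> = (\<Sum>j<n. ?s (\<Sum>i<n. (inverse z ^ j) ^ i) * ?X ^ j)"
  proof -
    have "?s (sum f A) = (\<Sum>i\<in>A. ?s (f i))" for f and A :: "nat set"
      by (induction A rule: infinite_finite_induct) (auto simp: single_add)
    then show ?thesis by (simp add: sum_distrib_right)
  qed
  \<comment> \<open>Primitivity of \<open>z\<close> enters here: for \<open>0 < j < n\<close> the
    element \<open>inverse z ^ j\<close> is an \<open>n\<close>-th root of unity other than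
    \<open>1\<close>, so its geometric sum vanishes.\<close>
  also have "\<dots> = (\<Sum>j<n. if j = 0 then ?s (of_nat n) else 0)"
  proof (rule sum.cong)
    fix j assume j: "j \<in> {..<n}"
    show "?s (\<Sum>i<n. (inverse z ^ j) ^ i) * ?X ^ j = (if j = 0 then ?s (of_nat n) else 0)"
    proof (cases "j = 0")
      case False
      let ?w = "inverse z ^ j"
      have "?w ^ n = 1" using zn by (metis mult.commute power_inverse power_mult power_one inverse_1)
      moreover have "?w \<noteq> 1"
        using zk[of j] False j by (auto simp: power_inverse inverse_eq_1_iff)
      ultimately have "(\<Sum>i<n. ?w ^ i) = 0"
        using power_diff_1_eq[of ?w n] by simp
      then show ?thesis using False by simp
    qed simp
  qed simp
  also have "\<dots> = ?s (of_nat n)" using assms(1) by simp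
  also have "?s (1 / of_nat n) * ?s (of_nat n) = 1"
    using assms(2) by (simp add: mult_single del: single_of_nat)
  finally show "(\<Sum>i<n. E i) = 1" .
qed

lemma group_alg_power: "is_subgroup H \<Longrightarrow> a \<in> group_alg H \<Longrightarrow> a ^ n \<in> group_alg H"
  for a :: "'g::ab_group_add \<Rightarrow>\<^sub>0 'f::field"
  by (induction n) (auto simp: group_alg_one group_alg_mult)

text \<open>Induction over the elements still to be diagonalised. A common eigenvector
  \<open>a\<close> of \<open>S\<close> is the sum of the \<open>E i * a\<close>; these remain
  eigenvectors of \<open>S\<close> by commutativity and become eigenvectors of the new
  \<open>h\<close>. The set \<open>Q\<close> stands for the span that is to be shown everything, and
  only its closure under sums matters.\<close>

lemma common_eigenvectors_span:
  fixes H :: "'g::ab_group_add set" and z :: "'f::field" and Q :: "('g \<Rightarrow>\<^sub>0 'f) set"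
  assumes sub: "is_subgroup H" and "n > 0" "of_nat n \<noteq> (0::'f)" "primitive_root_of_unity n z"
    and exp: "\<And>h. h \<in> H \<Longrightarrow> (\<Sum>i<n. h) = 0"
    and Q: "0 \<in> Q" "\<And>a b. a \<in> Q \<Longrightarrow> b \<in> Q \<Longrightarrow> a + b \<in> Q"
    and "finite S" "S \<subseteq> H"
    and eig: "\<And>a. a \<in> group_alg H \<Longrightarrow>
        (\<And>h. h \<in> S \<Longrightarrow> \<exists>c. Poly_Mapping.single h 1 * a = Poly_Mapping.single 0 c * a) \<Longrightarrow> a \<in> Q"
  shows "group_alg H \<subseteq> Q"
  using assms(8-)
proof (induction S)
  case empty
  then show ?case by blast
next
  case (insert h S)
  show ?case
  proof (rule insert.IH)
    fix a :: "'g \<Rightarrow>\<^sub>0 'f"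
    assume a: "a \<in> group_alg H"
      and ev: "\<And>h. h \<in> S \<Longrightarrow> \<exists>c. Poly_Mapping.single h 1 * a = Poly_Mapping.single 0 c * a"
    define E :: "nat \<Rightarrow> 'g \<Rightarrow>\<^sub>0 'f" where "E = (\<lambda>i. Poly_Mapping.single 0 (1 / of_nat n) *
     (\<Sum>j<n. (Poly_Mapping.single 0 (inverse z ^ i) * Poly_Mapping.single h 1) ^ j))"
    have h: "h \<in> H" using insert.prems by auto
    have E: "(\<Sum>i<n. E i) = 1" "Poly_Mapping.single h 1 * E i = Poly_Mapping.single 0 (z ^ i) * E i" for i
      unfolding E_def by (rule root_of_unity_decomposition[OF assms(2-4) exp[OF h]])+
    have "E i * a \<in> Q" for i
    proof (rule insert.prems)
      show "E i * a \<in> group_alg H"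
        using h a is_subgroupD(1)[OF sub] unfolding E_def
        by (intro group_alg_mult[OF sub] group_alg_sum group_alg_power[OF sub] group_alg_single) auto
      fix k assume "k \<in> insert h S"
      then show "\<exists>c. Poly_Mapping.single k 1 * (E i * a) = Poly_Mapping.single 0 c * (E i * a)"
      proof
        assume "k = h"
        then show ?thesis
          using E(2)[of i] by (auto simp: mult.assoc[symmetric])
      next
        assume "k \<in> S"
        then obtain c where "Poly_Mapping.single k 1 * a = Poly_Mapping.single 0 c * a" using ev by blast
        then show ?thesis by (auto simp: mult.left_commute[of _ "E i"])
      qed
    qed
    then have "(\<Sum>i<m. E i * a) \<in> Q" for m by (induction m) (auto simp: Q add.commute)
    moreover have "(\<Sum>i<n. E i * a) = a" using E(1) by (simp add: sum_distrib_right[symmetric])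
    ultimately show "a \<in> Q" by metis
  qed (use insert.prems in auto)
qed

text \<open>Scalars cancel on a nonzero \<open>b\<close>, so its eigenvalues are unique and hence
  multiplicative in \<open>h\<close>. Cutting them off outside \<open>H\<close> gives an element of
  \<open>chars H\<close>.\<close>

lemma eigenvector_char:
  fixes b :: "'g::ab_group_add \<Rightarrow>\<^sub>0 'f::field"
  assumes sub: "is_subgroup H" and "b \<noteq> 0"
    and eig: "\<And>h. h \<in> H \<Longrightarrow> \<exists>c. Poly_Mapping.single h 1 * b = Poly_Mapping.single 0 c * b"
  obtains \<chi> where "\<chi> \<in> chars H"
    "\<And>h. h \<in> H \<Longrightarrow> Poly_Mapping.single h 1 * b = Poly_Mapping.single 0 (\<chi> h) * b"
proof -
  obtain \<chi> where \<chi>: "\<And>h. h \<in> H \<Longrightarrow> Poly_Mapping.single h 1 * b = Poly_Mapping.single 0 (\<chi> h) * b"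
    using eig by metis
  define \<psi> where "\<psi> = (\<lambda>h. if h \<in> H then \<chi> h else 0)"
  have "\<psi> (x + y) = \<psi> x * \<psi> y" if "x \<in> H" "y \<in> H" for x y
  proof -
    have "Poly_Mapping.single 0 (\<psi> (x + y)) * b = Poly_Mapping.single (x + y) 1 * b"
      using that is_subgroupD(2)[OF sub] \<chi> by (simp add: \<psi>_def)
    also have "\<dots> = Poly_Mapping.single x 1 * (Poly_Mapping.single y 1 * b)"
      by (simp add: mult.assoc[symmetric] mult_single)
    also have "\<dots> = Poly_Mapping.single 0 (\<psi> y) * (Poly_Mapping.single x 1 * b)"
      using \<chi>[OF that(2)] that by (simp add: \<psi>_def mult.left_commute)
    also have "\<dots> = Poly_Mapping.single 0 (\<psi> x * \<psi> y) * b"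
      using \<chi>[OF that(1)] that
      by (simp add: \<psi>_def mult.assoc[symmetric] mult_single mult.commute[of "\<chi> x"])
    finally show ?thesis using single_0_cancel[OF _ assms(2)] by blast
  qed
  moreover have "\<psi> 0 = 1"
    using \<chi>[of 0] is_subgroupD(1)[OF sub] single_0_cancel[OF _ assms(2), of 1 "\<psi> 0"]
    by (simp add: \<psi>_def)
  ultimately have "\<psi> \<in> chars H" by (auto simp: chars_def \<psi>_def)
  then show thesis by (rule that) (use \<chi> in \<open>auto simp: \<psi>_def\<close>)
qed

text \<open>Otherwise the remainder of \<open>card H\<close> modulo the exponent would be a smaller
  positive number annihilating \<open>H\<close>.\<close>

lemma group_exponent_dvd_card:
  assumes "is_subgroup H" "finite H"
  shows "group_exponent H dvd card H"
proof (rule ccontr)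
  let ?n = "group_exponent H"
  assume "\<not> ?n dvd card H"
  then have r: "0 < card H mod ?n" "card H mod ?n < ?n"
    using group_exponent_works(1)[OF assms] by (auto simp: mod_greater_zero_iff_not_dvd)
  have "(\<Sum>i<card H mod ?n. h) = 0" if "h \<in> H" for h
  proof -
    have add: "(\<Sum>i<a + b. h) = (\<Sum>i<a. h) + (\<Sum>i<b. h)" for a b :: nat
      by (induction b) (auto simp: ac_simps)
    have "(\<Sum>i<a * b. h) = (\<Sum>i<a. \<Sum>j<b. h)" for a b :: nat
      by (induction a) (auto simp: add add.commute)
    with add have "(\<Sum>i<card H div ?n * ?n + card H mod ?n. h) = (\<Sum>i<card H mod ?n. h)"
      using group_exponent_works(2)[OF assms that] by (simp only: sum.neutral_const add_0)
    then show ?thesis using card_times_subgroup[OF assms that] by simp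
  qed
  then show False using group_exponent_works(3)[OF assms r(1)] r(2) by force
qed

text \<open>Common eigenvectors span the group algebra and are multiples of character idempotents,
  so \<open>1\<close> is a linear combination of these. It remains to identify the
  coefficients.\<close>

lemma splitting_field_imp_splits:
  fixes H :: "'g::ab_group_add set"
  assumes sub: "is_subgroup H" and fin: "finite H" and split: "splitting_field TYPE('f::field) H"
  shows "splits TYPE('f) H"
proof -
  let ?n = "group_exponent H"
  let ?e = "char_idem H :: ('g \<Rightarrow> 'f) \<Rightarrow> _"
  obtain z :: 'f where z: "primitive_root_of_unity ?n z"
    using split by (auto simp: splitting_field_def)
  have card0: "of_nat (card H) \<noteq> (0::'f)"
    using split by (simp add: splitting_field_def of_nat_eq_0_iff_char_dvd)
  then have n0: "of_nat ?n \<noteq> (0::'f)"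
    using group_exponent_dvd_card[OF sub fin] by (metis dvd_def mult_zero_left of_nat_mult)
  have fin_chars: "finite (chars H :: ('g \<Rightarrow> 'f) set)" by (rule finite_chars[OF sub fin])
  define Q where "Q = range (\<lambda>c. \<Sum>\<chi>\<in>chars H. Poly_Mapping.single 0 (c \<chi>) * ?e \<chi>)"
  have "group_alg H \<subseteq> Q"
  proof (rule common_eigenvectors_span[OF sub _ n0 z _ _ _ fin order_refl])
    show "?n > 0" "\<And>h. h \<in> H \<Longrightarrow> (\<Sum>i<?n. h) = 0" using group_exponent_works[OF sub fin] by auto
    have "(\<Sum>\<chi>\<in>chars H. Poly_Mapping.single 0 ((\<lambda>_. 0) \<chi>) * ?e \<chi>) \<in> Q"
      unfolding Q_def by (rule rangeI)
    then show z: "0 \<in> Q" by simp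
    show "a + b \<in> Q" if ab: "a \<in> Q" "b \<in> Q" for a b
    proof -
      obtain c d where "a = (\<Sum>\<chi>\<in>chars H. Poly_Mapping.single 0 (c \<chi>) * ?e \<chi>)"
        "b = (\<Sum>\<chi>\<in>chars H. Poly_Mapping.single 0 (d \<chi>) * ?e \<chi>)" using ab by (auto simp: Q_def)
      then have "a + b = (\<Sum>\<chi>\<in>chars H. Poly_Mapping.single 0 ((\<lambda>\<chi>. c \<chi> + d \<chi>) \<chi>) * ?e \<chi>)"
        by (simp add: sum.distrib single_add distrib_right)
      then show ?thesis unfolding Q_def by (intro image_eqI[of _ _ "\<lambda>\<chi>. c \<chi> + d \<chi>"]) auto
    qed
    fix b :: "'g \<Rightarrow>\<^sub>0 'f"
    assume b: "b \<in> group_alg H"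
      and "\<And>h. h \<in> H \<Longrightarrow> \<exists>c. Poly_Mapping.single h 1 * b = Poly_Mapping.single 0 c * b"
    show "b \<in> Q"
    proof (cases "b = 0")
      case False
      then obtain \<chi> where \<chi>: "\<chi> \<in> chars H"
        "\<And>h. h \<in> H \<Longrightarrow> Poly_Mapping.single h 1 * b = Poly_Mapping.single 0 (\<chi> h) * b"
        using eigenvector_char[OF sub] \<open>\<And>h. h \<in> H \<Longrightarrow> \<exists>c. _ h c\<close> by blast
      have "(\<Sum>\<psi>\<in>chars H. Poly_Mapping.single 0 (if \<psi> = \<chi> then ev \<chi> b else 0) * ?e \<psi>)
          = (\<Sum>\<psi>\<in>chars H. if \<psi> = \<chi> then b else 0)"
        using eigenvector_conv_char_idem[OF sub fin \<chi>(1) card0 b \<chi>(2)]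
        by (intro sum.cong) auto
      also have "\<dots> = b" using \<chi>(1) fin_chars by simp
      finally show ?thesis
        unfolding Q_def by (intro image_eqI[of _ _ "\<lambda>\<psi>. if \<psi> = \<chi> then ev \<chi> b else 0"]) auto
    qed (simp add: z)
  qed
  then obtain c where c: "1 = (\<Sum>\<chi>\<in>chars H. Poly_Mapping.single 0 (c \<chi>) * ?e \<chi>)"
    using group_alg_one[OF sub] by (auto simp: Q_def)
  \<comment> \<open>Multiplying the expansion of \<open>1\<close> by \<open>?e \<psi>\<close>
    leaves, by orthogonality, only the term at \<open>\<psi>\<close>.\<close>
  have "Poly_Mapping.single 0 (c \<psi>) * ?e \<psi> = ?e \<psi>" if \<psi>: "\<psi> \<in> chars H" for \<psi>
  proof -
    have "?e \<psi> = (\<Sum>\<chi>\<in>chars H. Poly_Mapping.single 0 (c \<chi>) * ?e \<chi>) * ?e \<psi>"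
      using c by simp
    also have "\<dots> = (\<Sum>\<chi>\<in>chars H. if \<chi> = \<psi> then Poly_Mapping.single 0 (c \<psi>) * ?e \<psi> else 0)"
      unfolding sum_distrib_right
      by (intro sum.cong) (auto simp: mult.assoc char_idem_idem[OF sub fin _ card0] \<psi>
          char_idem_orthogonal[OF sub fin])
    also have "\<dots> = Poly_Mapping.single 0 (c \<psi>) * ?e \<psi>"
      using \<psi> fin_chars by simp
    finally show ?thesis by simp
  qed
  then show ?thesis using c by (simp add: splits_def)
qed

lemma card_subgroup_dvd:
  assumes "is_subgroup H" "is_subgroup K" "K \<subseteq> H"
  shows "card K dvd card H"
proof -
  let ?G = "\<lparr>carrier = H, monoid.mult = (+), one = 0\<rparr>"
  interpret group ?G
    by (rule groupI)
      (use is_subgroupD[OF assms(1)] in \<open>auto simp: add.assoc intro: left_minus\<close>)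
  have "inv\<^bsub>?G\<^esub> x = - x" if "x \<in> H" for x
    using that is_subgroupD[OF assms(1)] by (intro inv_equality) auto
  then have "subgroup K ?G"
    by unfold_locales (use is_subgroupD[OF assms(2)] assms(3) in auto)
  from lagrange[OF this] show ?thesis 
    by (simp add: Coset.order_def) (metis dvd_triv_right)
qed

text \<open>The idempotents of the restrictions to \<open>K\<close> of all characters of
  \<open>H\<close>, suitably scaled, sum to \<open>1\<close>. A character of \<open>K\<close> that
  is no restriction would be orthogonal to this sum, which gives the extension property. The sum of
  all idempotents of \<open>K\<close> acts as identity on each restricted one, hence equals
  \<open>1\<close>.\<close>

lemma splits_subgroup:
  fixes H K :: "'g::ab_group_add set"
  assumes H: "is_subgroup H" "finite H" and K: "is_subgroup K" "K \<subseteq> H"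
    and split: "splits TYPE('f::field) H"
  shows "splits TYPE('f) K"
    and "\<And>\<mu> :: 'g \<Rightarrow> 'f. \<mu> \<in> chars K \<Longrightarrow> \<exists>\<chi>\<in>chars H. \<forall>h\<in>K. \<chi> h = \<mu> h"
proof -
  have finK: "finite K" using K(2) H(2) finite_subset by blast
  have card0: "of_nat (card H) \<noteq> (0::'f)" by (rule splits_card[OF split])
  define \<alpha> :: "('g \<Rightarrow> 'f) \<Rightarrow> 'g \<Rightarrow> 'f" where "\<alpha> = (\<lambda>\<chi> h. if h \<in> K then \<chi> h else 0)"
  have \<alpha>: "\<alpha> \<chi> \<in> chars K" if "\<chi> \<in> chars H" for \<chi>
    unfolding chars_def \<alpha>_def
    using charsD[OF that] K(2) is_subgroupD(1,2)[OF K(1)] by (auto simp: subset_iff)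
  \<comment> \<open>This factor exchanges the denominator \<open>card K\<close> of the idempotents
    of \<open>K\<close> for \<open>card H\<close>, so that summing over the characters of
    \<open>H\<close> reproduces the coefficients in the expansion of \<open>1\<close> over
    \<open>H\<close>.\<close>
  let ?d = "of_nat (card K) / of_nat (card H) :: 'f"
  \<comment> \<open>Column orthogonality of characters, read off from the coefficient of
    \<open>h\<close> in the sum of the idempotents.\<close>
  have delta: "(\<Sum>\<chi>\<in>chars H. \<chi> (- h)) = (if h = 0 then of_nat (card H) else (0::'f))" if "h \<in> H" for h
  proof -
    have "Poly_Mapping.lookup (\<Sum>\<chi>\<in>chars H. char_idem H \<chi> :: 'g \<Rightarrow>\<^sub>0 'f) h = (if h = 0 then 1 else 0)"
      using split by (auto simp: splits_def lookup_one when_def)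
    then have "(\<Sum>\<chi>\<in>chars H. \<chi> (- h)) / of_nat (card H) = (if h = 0 then 1 else (0::'f))"
      using that by (simp add: lookup_sum lookup_char_idem[OF H(2)] sum_divide_distrib)
    then show ?thesis using card0 by (auto simp: field_simps split: if_splits)
  qed
  have cardK: "of_nat (card K) \<noteq> (0::'f)"
    using card0 card_subgroup_dvd[OF H(1) K] by (metis dvd_def mult_zero_left of_nat_mult)
  have one': "(\<Sum>\<chi>\<in>chars H. Poly_Mapping.single 0 ?d * char_idem K (\<alpha> \<chi>)) = 1"
  proof (rule poly_mapping_eqI)
    fix k
    have "Poly_Mapping.lookup (\<Sum>\<chi>\<in>chars H. Poly_Mapping.single 0 ?d * char_idem K (\<alpha> \<chi>)) k
        = (\<Sum>\<chi>\<in>chars H. (if k \<in> K then \<chi> (- k) else 0) / of_nat (card H))"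
      using cardK is_subgroupD[OF K(1)]
      by (auto simp: lookup_sum pm_scale_conv[symmetric] lookup_char_idem[OF finK] \<alpha>_def intro!: sum.cong)
    also have "\<dots> = (if k = 0 then 1 else 0)"
    proof (cases "k \<in> K")
      case True
      then show ?thesis
        using delta[of k] K card0 by (auto simp: sum_divide_distrib[symmetric])
    qed (use is_subgroupD(1)[OF K(1)] in auto)
    finally show "Poly_Mapping.lookup (\<Sum>\<chi>\<in>chars H. Poly_Mapping.single 0 ?d
        * char_idem K (\<alpha> \<chi>)) k = Poly_Mapping.lookup 1 k"
      by (simp add: lookup_one when_def)
  qed
  show ext: "\<exists>\<chi>\<in>chars H. \<forall>h\<in>K. \<chi> h = \<mu> h" if \<mu>: "\<mu> \<in> chars K" for \<mu> :: "'g \<Rightarrow> 'f"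
  proof (rule ccontr)
    assume no: "\<not> ?thesis"
    then have "\<alpha> \<chi> \<noteq> \<mu>" if "\<chi> \<in> chars H" for \<chi> using that by (auto simp: \<alpha>_def)
    then have "(\<Sum>\<chi>\<in>chars H. Poly_Mapping.single 0 ?d * char_idem K (\<alpha> \<chi>)) * char_idem K \<mu> = 0"
      unfolding sum_distrib_right
      by (intro sum.neutral) (auto simp: mult.assoc char_idem_orthogonal[OF K(1) finK] \<alpha> \<mu>)
    then show False using one' char_idem_nonzero[OF K(1) finK \<mu> cardK] by simp
  qed
  have "(\<Sum>\<mu>\<in>chars K. char_idem K \<mu>) * char_idem K (\<alpha> \<chi>) = char_idem K (\<alpha> \<chi>)"
    if "\<chi> \<in> chars H" for \<chi>
  proof -
    have "(\<Sum>\<mu>\<in>chars K. char_idem K \<mu> * char_idem K (\<alpha> \<chi>))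
        = (\<Sum>\<mu>\<in>chars K. if \<mu> = \<alpha> \<chi> then char_idem K (\<alpha> \<chi>) else 0)"
      by (intro sum.cong) (auto simp: char_idem_idem[OF K(1) finK _ cardK] \<alpha> that
          char_idem_orthogonal[OF K(1) finK])
    also have "\<dots> = char_idem K (\<alpha> \<chi>)"
      using \<alpha>[OF that] by (subst sum.delta[OF finite_chars[OF K(1) finK]]) simp
    finally show ?thesis by (simp add: sum_distrib_right)
  qed
  then have "(\<Sum>\<mu>\<in>chars K. char_idem K \<mu>)
      * (\<Sum>\<chi>\<in>chars H. Poly_Mapping.single 0 ?d * char_idem K (\<alpha> \<chi>))
      = (\<Sum>\<chi>\<in>chars H. Poly_Mapping.single 0 ?d * char_idem K (\<alpha> \<chi>))"
    by (simp add: sum_distrib_left mult.left_commute[of "sum _ _"])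
  then show "splits TYPE('f) K" unfolding one' by (simp add: splits_def)
qed

section \<open>Primitive roots of unity and separating families of multiplicative functions\<close>

lemma power_gcd_eq_1:
  fixes z :: "'f::field"
  assumes "z ^ a = 1" "z ^ b = 1"
  shows "z ^ gcd a b = 1"
proof (cases "a = 0")
  case False
  then obtain x y where "a * x = b * y + gcd a b" using bezout_nat by blast
  then have "(z ^ a) ^ x = (z ^ b) ^ y * z ^ gcd a b"
    by (simp add: power_mult[symmetric] power_add[symmetric])
  then show ?thesis using assms by simp
qed (use assms in simp)

text \<open>If \<open>z ^ k = 1\<close> with \<open>0 < k < n\<close>, then also
  \<open>z ^ g = 1\<close> for \<open>g = gcd k n\<close>, a proper divisor of \<open>n\<close>. A
  prime \<open>p\<close> dividing the cofactor of \<open>g\<close> makes \<open>n div p\<close> a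
  multiple of \<open>g\<close>.\<close>

lemma primitive_root_of_unityI:
  fixes z :: "'f::field"
  assumes "n > 0" "z ^ n = 1" "\<And>p. prime p \<Longrightarrow> p dvd n \<Longrightarrow> z ^ (n div p) \<noteq> 1"
  shows "primitive_root_of_unity n z"
  unfolding primitive_root_of_unity_def
proof (intro conjI allI impI notI)
  fix k assume k: "0 < k \<and> k < n" and zk: "z ^ k = 1"
  define g where "g = gcd k n"
  have g: "z ^ g = 1" "g dvd n" "g < n" "g > 0"
    using power_gcd_eq_1[OF zk assms(2)] k gcd_le1_nat[of k n]
      le_less_trans[of "gcd k n" k n] by (auto simp: g_def)
  then obtain m where m: "n = g * m" by (auto simp: dvd_def)
  then have "m \<noteq> 1" using g by auto
  then obtain p where p: "prime p" "p dvd m" using prime_factor_nat by blast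
  then have "n div p = g * (m div p)" using m by (simp add: div_mult_swap)
  then have "z ^ (n div p) = 1" using g by (simp add: power_mult)
  then show False using assms(3)[OF p(1)] p(2) m by simp
qed (fact assms)

text \<open>The root is the product, over the primes \<open>p\<close> dividing \<open>n\<close>, of elements whose order is the
  exact power of \<open>p\<close> in \<open>n\<close>.\<close>

lemma primitive_root_of_unity_exists:
  assumes "n > 0"
    and w: "\<And>p. prime p \<Longrightarrow> p dvd n \<Longrightarrow> \<exists>w::'f::field. w ^ n = 1 \<and> w ^ (n div p) \<noteq> 1"
  shows "\<exists>z::'f. primitive_root_of_unity n z"
proof -
  obtain w :: "nat \<Rightarrow> 'f" where
    w: "\<And>p. prime p \<Longrightarrow> p dvd n \<Longrightarrow> w p ^ n = 1 \<and> w p ^ (n div p) \<noteq> 1"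
    using w by metis
  let ?q = "\<lambda>p. p ^ multiplicity p n"
  \<comment> \<open>This power removes the part of the order of \<open>w p\<close> that is prime to
    \<open>p\<close>: the result has order dividing the exact power \<open>?q p\<close>.\<close>
  define z where "z p = w p ^ (n div ?q p)" for p
  define P where "P = prime_factors n"
  have P: "finite P" "\<And>p. p \<in> P \<longleftrightarrow> prime p \<and> p dvd n"
    using assms(1) by (auto simp: P_def prime_factors_dvd)
  have zq: "z p ^ ?q p = 1" if "p \<in> P" for p
    using w[of p] that P(2) by (simp add: z_def power_mult[symmetric] multiplicity_dvd)
  \<comment> \<open>Both \<open>n div p\<close> and \<open>?q p\<close> would annihilate
    \<open>z p\<close>, hence so would their gcd, a power of \<open>p\<close> strictly below
    \<open>?q p\<close>. Then \<open>z p ^ (p ^ e) = 1\<close>, which is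
    \<open>w p ^ (n div p) = 1\<close>, contrary to the choice of \<open>w\<close>.\<close>
  have own: "z p ^ (n div p) \<noteq> 1" if p: "p \<in> P" for p
  proof
    assume 1: "z p ^ (n div p) = 1"
    have pp: "prime p" "p dvd n" using p P(2) by auto
    then obtain j where j: "j \<le> multiplicity p n" "gcd (n div p) (?q p) = p ^ j"
      using divides_primepow_nat[OF pp(1), of "gcd (n div p) (?q p)" "multiplicity p n"] by blast
    obtain e where e: "multiplicity p n = Suc e"
      using pp assms(1) by (cases "multiplicity p n") (auto simp: prime_elem_multiplicity_eq_zero_iff)
    have "p ^ j dvd n div p" using j(2) by (metis gcd_dvd1)
    then have "p ^ Suc j dvd n" 
      using pp by (auto simp: dvd_def mult.assoc)
    then have "Suc j \<le> multiplicity p n"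
      using pp assms(1) by (intro multiplicity_geI) auto
    then have "p ^ j dvd p ^ e" using e by (simp add: le_imp_power_dvd)
    moreover have "z p ^ (p ^ j) = 1" using power_gcd_eq_1[OF 1 zq[OF p]] j(2) by simp
    ultimately have "z p ^ (p ^ e) = 1" by (auto simp: dvd_def power_mult)
    moreover have "n div ?q p * p ^ e = n div p"
    proof -
      obtain m where "n = ?q p * m" using multiplicity_dvd[of p n] by (auto simp: dvd_def)
      then have "n = p * (p ^ e * m)" using e by (simp add: mult.assoc)
      moreover have "p > 0" using pp prime_gt_0_nat by blast
      moreover have "n div ?q p = m"
        using \<open>n = ?q p * m\<close> \<open>p > 0\<close> by (metis nonzero_mult_div_cancel_left not_gr_zero power_not_zero)
      ultimately show ?thesis by (metis mult.commute nonzero_mult_div_cancel_left not_gr_zero)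
    qed
    ultimately show False using w[OF pp] by (simp add: z_def power_mult[symmetric])
  qed
  \<comment> \<open>Since \<open>?q r\<close> is coprime to \<open>p\<close>, it still divides
    \<open>n div p\<close>.\<close>
  have other: "z r ^ (n div p) = 1" if "p \<in> P" "r \<in> P" "r \<noteq> p" for p r
  proof -
    have pr: "prime p" "prime r" "p dvd n" using that P(2) by auto
    have "coprime (?q r) p" using pr that(3) by (simp add: primes_coprime)
    moreover have "?q r dvd p * (n div p)" using pr multiplicity_dvd by simp
    ultimately have "?q r dvd n div p" by (simp add: coprime_dvd_mult_right_iff)
    then show ?thesis using zq[OF that(2)] by (auto simp: dvd_def power_mult)
  qed
  have "primitive_root_of_unity n (\<Prod>p\<in>P. z p)"
  proof (rule primitive_root_of_unityI[OF assms(1)])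
    show "(\<Prod>p\<in>P. z p) ^ n = 1"
      unfolding prod_power_distrib
    proof (rule prod.neutral, rule ballI)
      fix p assume "p \<in> P"
      then show "z p ^ n = 1" 
        using zq[of p] multiplicity_dvd[of p n] by (metis dvdE power_mult power_one)
    qed
    fix p assume "prime p" "p dvd n"
    then have p: "p \<in> P" using P(2) by blast
    have "(\<Prod>r\<in>P. z r) ^ (n div p) = z p ^ (n div p) * (\<Prod>r\<in>P - {p}. z r ^ (n div p))"
      using p P(1) by (simp add: prod_power_distrib prod.remove power_mult_distrib)
    also have "(\<Prod>r\<in>P - {p}. z r ^ (n div p)) = 1" using other[OF p] by (intro prod.neutral) auto
    finally show "(\<Prod>r\<in>P. z r) ^ (n div p) \<noteq> 1" using own[OF p] by simp
  qed
  then show ?thesis by blast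
qed

text \<open>Separation is tested on two kinds of elements. If \<open>card H\<close> vanished in the
  field, the sum of all group elements would be nonzero but invisible to multiplicative functions.
  For a prime \<open>p\<close> dividing the exponent, some \<open>h\<close> has a nonzero multiple
  by \<open>?n div p\<close>; a function separating that multiple from \<open>0\<close> takes at
  \<open>h\<close> a value as required by \<open>primitive_root_of_unity_exists\<close>.\<close>

lemma separating_family_imp_splitting_field:
  fixes H :: "'g::ab_group_add set" and \<delta> :: "'x \<Rightarrow> 'g \<Rightarrow> 'f::field"
  assumes sub: "is_subgroup H" and fin: "finite H"
    and mult: "\<And>x h k. x \<in> X \<Longrightarrow> h \<in> H \<Longrightarrow> k \<in> H \<Longrightarrow> \<delta> x (h + k) = \<delta> x h * \<delta> x k"
    and sep: "\<And>a. a \<in> group_alg H \<Longrightarrow> (\<And>x. x \<in> X \<Longrightarrow> ev (\<delta> x) a = 0) \<Longrightarrow> a = 0"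
  shows "splitting_field TYPE('f) H"
  unfolding splitting_field_def
proof
  show "\<not> CHAR('f) dvd card H"
  proof
    assume "CHAR('f) dvd card H"
    then have 0: "of_nat (card H) = (0::'f)" by (simp add: of_nat_eq_0_iff_char_dvd)
    define N :: "'g \<Rightarrow>\<^sub>0 'f" where "N = (\<Sum>h\<in>H. Poly_Mapping.single h 1)"
    have "N = 0"
    proof (rule sep)
      show "N \<in> group_alg H" by (auto simp: N_def)
      fix x assume x: "x \<in> X"
      have ev: "ev (\<delta> x) N = (\<Sum>h\<in>H. \<delta> x h)" by (simp add: N_def ev_sum)
      \<comment> \<open>Translation invariance gives \<open>card H\<close> copies of one sum, hence
        zero; a field has no nonzero element of square zero.\<close>
      have "(\<Sum>h\<in>H. \<delta> x h) * (\<Sum>k\<in>H. \<delta> x k) = (\<Sum>h\<in>H. \<Sum>k\<in>H. \<delta> x (h + k))"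
        using mult[OF x] by (simp add: sum_product)
      also have "\<dots> = (\<Sum>h\<in>H. \<Sum>k\<in>H. \<delta> x k)"
      proof (rule sum.cong)
        fix h assume "h \<in> H"
        then show "(\<Sum>k\<in>H. \<delta> x (h + k)) = (\<Sum>k\<in>H. \<delta> x k)"
          by (intro sum.reindex_bij_witness[of _ "\<lambda>k. k - h" "\<lambda>k. h + k"])
            (use is_subgroupD[OF sub] in auto)
      qed simp
      also have "\<dots> = 0" using 0 by simp
      finally show "ev (\<delta> x) N = 0" using ev by simp
    qed
    moreover have "Poly_Mapping.lookup N 0 = (\<Sum>h\<in>H. if h = 0 then 1 else 0)"
      unfolding N_def lookup_sum by (rule sum.cong) (auto simp: lookup_single when_def)
    ultimately show False using fin is_subgroupD(1)[OF sub] by simp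
  qed
  let ?n = "group_exponent H"
  show "\<exists>z::'f. primitive_root_of_unity ?n z"
  proof (rule primitive_root_of_unity_exists)
    show n0: "?n > 0" by (rule group_exponent_works(1)[OF sub fin])
    fix p :: nat assume p: "prime p" "p dvd ?n"
    let ?k = "?n div p"
    have "0 < ?k" "?k < ?n" using p n0 prime_gt_1_nat[OF p(1)] by (auto simp: dvd_imp_le div_greater_zero_iff prime_gt_0_nat)
    then obtain h where h: "h \<in> H" "(\<Sum>i<?k. h) \<noteq> 0"
      using group_exponent_works(3)[OF sub fin, of ?k] by force
    have kh: "(\<Sum>i<?k. h) \<in> H"
      using mult_of_char[OF sub h(1), of "\<lambda>_. 1::'f"] by simp
    let ?a = "Poly_Mapping.single (\<Sum>i<?k. h) 1 - Poly_Mapping.single 0 (1::'f)"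
    have "?a \<noteq> 0"
    proof
      assume "?a = 0"
      then have "Poly_Mapping.lookup ?a 0 = 0" by simp
      then show False using h(2) by (simp add: lookup_minus lookup_single)
    qed
    moreover have "?a \<in> group_alg H" using kh is_subgroupD(1)[OF sub] by blast
    ultimately obtain x where x: "x \<in> X" "ev (\<delta> x) ?a \<noteq> 0" using sep by blast
    have ne: "\<delta> x (\<Sum>i<?k. h) \<noteq> \<delta> x 0"
      using x(2) ev_add[of "\<delta> x" ?a "Poly_Mapping.single 0 1"] by (auto simp del: single_one)
    \<comment> \<open>Multiplicativity alone allows the values \<open>0\<close> and \<open>1\<close>
      here. The value \<open>0\<close> would make \<open>\<delta> x\<close> vanish on
      \<open>H\<close>, against \<open>ne\<close>.\<close>
    have d0: "\<delta> x 0 = 1"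
    proof (rule ccontr)
      assume "\<delta> x 0 \<noteq> 1"
      moreover have "\<delta> x 0 = \<delta> x 0 * \<delta> x 0"
        using mult[OF x(1), of 0 0] is_subgroupD(1)[OF sub] by simp
      ultimately have 0: "\<delta> x 0 = 0" by simp
      then have "\<delta> x k = 0" if "k \<in> H" for k
        using mult[OF x(1) that, of 0] is_subgroupD(1)[OF sub] by simp
      then show False using ne 0 kh by simp
    qed
    have pow: "\<delta> x (\<Sum>i<m. h) = \<delta> x h ^ m" for m
      using mult_of_char[OF sub h(1) mult[OF x(1)] d0] by blast
    show "\<exists>w::'f. w ^ ?n = 1 \<and> w ^ ?k \<noteq> 1"
      using pow[of ?n] pow[of ?k] ne d0 group_exponent_works(2)[OF sub fin h(1)] by auto
  qed
qed

section \<open>Linear extensions and the induced bimodule\<close>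

text \<open>Push-forward of group algebra elements along a map of indices. It is used for the
  embeddings \<open>h \<mapsto> (h, 0)\<close> and \<open>k \<mapsto> (0, k)\<close> and for the
  antidiagonal \<open>h \<mapsto> (h, - h)\<close>.\<close>

definition lin_ext :: "('k \<Rightarrow> 'l) \<Rightarrow> ('k \<Rightarrow>\<^sub>0 'f::field) \<Rightarrow> ('l \<Rightarrow>\<^sub>0 'f)" where
  "lin_ext f a = (\<Sum>h\<in>Poly_Mapping.keys a. Poly_Mapping.single (f h) (Poly_Mapping.lookup a h))"

lemma lin_ext_0 [simp]: "lin_ext f 0 = 0"
  by (simp add: lin_ext_def)

lemma lin_ext_single [simp]: "lin_ext f (Poly_Mapping.single h c) = Poly_Mapping.single (f h) c"
  by (cases "c = 0") (auto simp: lin_ext_def)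

lemma lin_ext_add: "lin_ext f (a + b) = lin_ext f a + lin_ext f b"
  unfolding lin_ext_def by (rule sum_keys_add) (auto simp: single_add)

lemma lin_ext_sum: "lin_ext f (sum g I) = (\<Sum>i\<in>I. lin_ext f (g i))"
  by (induction I rule: infinite_finite_induct) (auto simp: lin_ext_add)

lemma lin_ext_in:
  assumes "a \<in> group_alg H" "\<And>h. h \<in> H \<Longrightarrow> f h \<in> K"
  shows "lin_ext f a \<in> group_alg K"
  using assms(1) by (induction rule: group_alg_induct) (auto simp: lin_ext_add assms(2))

lemma ev_lin_ext: "ev \<chi> (lin_ext f a) = ev (\<chi> \<circ> f) a"
  by (simp add: lin_ext_def ev_sum) (simp add: ev_def)

lemma ev_cong:
  assumes "a \<in> group_alg H" "\<And>h. h \<in> H \<Longrightarrow> \<chi> h = \<psi> h"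
  shows "ev \<chi> a = ev \<psi> a"
  using assms unfolding ev_def group_alg_def by (intro sum.cong) auto

text \<open>Together with \<open>prod_biact_conv\<close> this turns all actions on the group algebra
  of the product group into multiplication in one commutative ring, where the idempotent calculus
  applies.\<close>

lemma prod_ract_conv: "prod_ract x a = x * lin_ext (\<lambda>h. (h, - h)) a"
proof -
  have "x * lin_ext (\<lambda>h. (h, - h)) a
      = (\<Sum>k\<in>Poly_Mapping.keys x. Poly_Mapping.single k (Poly_Mapping.lookup x k))
        * lin_ext (\<lambda>h. (h, - h)) a"
    by (simp add: poly_mapping_sum_single)
  then show ?thesis
    by (simp add: prod_ract_def lin_ext_def sum_product mult_single case_prod_unfold plus_prod_def)
qed

lemma prod_biact_conv:
  "prod_biact a x b = lin_ext (\<lambda>h. (h, 0)) a * x * lin_ext (\<lambda>k. (0, k)) b"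
proof -
  have "lin_ext (\<lambda>h. (h, 0)) a * (x * lin_ext (\<lambda>k. (0, k)) b)
      = lin_ext (\<lambda>h. (h, 0)) a
        * ((\<Sum>k\<in>Poly_Mapping.keys x. Poly_Mapping.single k (Poly_Mapping.lookup x k))
        * lin_ext (\<lambda>k. (0, k)) b)"
    by (simp add: poly_mapping_sum_single)
  also have "\<dots> = prod_biact a x b"
    unfolding prod_biact_def lin_ext_def sum_product
    by (simp add: sum_distrib_left mult_single case_prod_unfold plus_prod_def mult.assoc)
  finally show ?thesis by (simp add: mult.assoc)
qed

lemma tensor_rels_subset:
  fixes s :: "'f::field \<Rightarrow> 'v::ab_group_add \<Rightarrow> 'v"
  assumes "is_subgroup H1" "is_subgroup H2"
  shows "tensor_rels H1 H2 s \<rho> \<subseteq> carrier (tensor_free H1 H2)"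
proof -
  let ?S = "group_alg (H1 \<times> H2) \<times> UNIV"
  have car: "frag_of p - frag_of q - frag_of r \<in> carrier (free_Abelian_group ?S)"
    "frag_of p - frag_of q \<in> carrier (free_Abelian_group ?S)"
    if "p \<in> ?S" "q \<in> ?S" "r \<in> ?S" for p q r :: "_ \<times> 'v"
    unfolding carrier_free_Abelian_group_iff
    using that keys_diff[of "frag_of p - frag_of q" "frag_of r"] keys_diff[of "frag_of p" "frag_of q"]
    unfolding keys_frag_of by blast+
  have "prod_ract x a \<in> group_alg (H1 \<times> H2)"
    if "x \<in> group_alg (H1 \<times> H2)" "a \<in> group_alg (H1 \<inter> H2)" for x a
    unfolding prod_ract_conv
    by (rule group_alg_mult[OF is_subgroup_Times[OF assms] that(1) lin_ext_in[OF that(2)]])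
      (use is_subgroupD(3) assms in auto)
  then show ?thesis
    unfolding tensor_rels_def tensor_free_def
    by (auto intro!: car simp del: carrier_free_Abelian_group_iff)
qed

text \<open>The universal property of the tensor product in the form needed to detect nonzero
  tensors: the additive extension of a balanced map \<open>f\<close> vanishes on the defining
  relations, hence on the subgroup they generate.\<close>

lemma frag_hom_vanishes_on_tensor_ker:
  fixes sV :: "'f::field \<Rightarrow> 'v::ab_group_add \<Rightarrow> 'v" and f :: "('g::ab_group_add \<times> 'g \<Rightarrow>\<^sub>0 'f) \<times> 'v \<Rightarrow> 'v"
  assumes "vector_space sV" "is_subgroup H1" "is_subgroup H2"
    and add_left: "\<And>x y v. x \<in> group_alg (H1 \<times> H2) \<Longrightarrow> y \<in> group_alg (H1 \<times> H2) \<Longrightarrow>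
      f (x + y, v) = f (x, v) + f (y, v)"
    and add_right: "\<And>x v w. x \<in> group_alg (H1 \<times> H2) \<Longrightarrow> f (x, v + w) = f (x, v) + f (x, w)"
    and balanced: "\<And>x a v. x \<in> group_alg (H1 \<times> H2) \<Longrightarrow> a \<in> group_alg (H1 \<inter> H2) \<Longrightarrow>
      f (prod_ract x a, v) = f (x, rep_act sV \<rho> a v)"
    and "frag_of (x, v) \<in> tensor_ker H1 H2 sV \<rho>"
  shows "f (x, v) = 0"
proof -
  interpret vector_space sV by fact
  \<comment> \<open>Integer multiples are written as scalar multiples by \<open>of_int\<close>, so
    that additivity follows from the vector space laws.\<close>
  define F where "F u = (\<Sum>p\<in>Poly_Mapping.keys u. sV (of_int (Poly_Mapping.lookup u p)) (f p))" for u
  have F_add: "F (u + w) = F u + F w" for u w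
    unfolding F_def by (rule sum_keys_add) (auto simp: scale_left_distrib)
  have F_diff: "F (u - w) = F u - F w" for u w
    using F_add[of "u - w" w] by simp
  have F_of: "F (frag_of p) = f p" for p by (simp add: F_def)
  have "u \<in> carrier (tensor_free H1 H2) \<and> F u = 0" if "u \<in> tensor_ker H1 H2 sV \<rho>" for u
    using that unfolding tensor_ker_def
  proof (induction rule: generate.induct)
    case one
    then show ?case by (simp add: tensor_free_def F_def)
  next
    case (incl u)
    then have "F u = 0"
      unfolding tensor_rels_def
      by (auto simp: F_diff F_of add_left add_right balanced)
    then show ?case using incl tensor_rels_subset[OF assms(2,3)] by blast
  next
    case (inv u)
    then have "F u = 0"
      unfolding tensor_rels_def
      by (auto simp: F_diff F_of add_left add_right balanced)
    moreover have u: "u \<in> carrier (tensor_free H1 H2)"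
      using inv tensor_rels_subset[OF assms(2,3)] by blast
    then have "inv\<^bsub>tensor_free H1 H2\<^esub> u = - u" unfolding tensor_free_def by simp
    moreover have "F (- u) = - F u" using F_diff[of 0 u] by (simp add: F_def)
    ultimately show ?case using u by (simp add: tensor_free_def)
  next
    case (eng u w)
    then show ?case
      using keys_add[of u w] by (auto simp: tensor_free_def F_add)
  qed
  then show ?thesis using assms(7) F_of by force
qed

text \<open>Leaves the coset model: \<open>t\<close> is the projection onto the quotient followed by
  the inverse of \<open>\<phi>\<close>. From here on only an additive surjection onto the bimodule
  with known kernel is used.\<close>

lemma ind_presentation:
  fixes sV :: "'f::field \<Rightarrow> 'v::ab_group_add \<Rightarrow> 'v" and \<phi> :: "'m::ab_group_add \<Rightarrow> _"
  assumes sub: "is_subgroup H1" "is_subgroup H2"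
    and iso: "graded_iso_ind H1 H2 lact ract M sV \<rho> V \<phi>"
  obtains t :: "(('g::ab_group_add \<times> 'g \<Rightarrow>\<^sub>0 'f) \<times> 'v \<Rightarrow>\<^sub>0 int) \<Rightarrow> 'm" where
    "\<And>u w. u \<in> carrier (tensor_free H1 H2) \<Longrightarrow> w \<in> carrier (tensor_free H1 H2) \<Longrightarrow> t (u + w) = t u + t w"
    "\<And>u. u \<in> carrier (tensor_free H1 H2) \<Longrightarrow> t u = 0 \<longleftrightarrow> u \<in> tensor_ker H1 H2 sV \<rho>"
    "\<And>m. \<exists>u\<in>carrier (tensor_free H1 H2). m = t u"
    "\<And>a x b v. a \<in> group_alg H1 \<Longrightarrow> x \<in> group_alg (H1 \<times> H2) \<Longrightarrow> b \<in> group_alg H2 \<Longrightarrow>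
      ract (lact a (t (frag_of (x, v)))) b = t (frag_of (prod_biact a x b, v))"
proof -
  let ?T = "tensor_free H1 H2 :: (('g \<times> 'g \<Rightarrow>\<^sub>0 'f) \<times> 'v \<Rightarrow>\<^sub>0 int) monoid"
  let ?K = "tensor_ker H1 H2 sV \<rho>"
  interpret T: comm_group ?T unfolding tensor_free_def by (rule abelian_free_Abelian_group)
  have K: "subgroup ?K ?T"
    unfolding tensor_ker_def by (rule T.generate_is_subgroup[OF tensor_rels_subset[OF sub]])
  interpret N: normal ?K ?T by (rule T.subgroup_imp_normal[OF K])
  have T_simps [simp]: "u \<otimes>\<^bsub>?T\<^esub> w = u + w" "\<one>\<^bsub>?T\<^esub> = 0" for u w by (auto simp: tensor_free_def)
  have bij: "bij_betw \<phi> UNIV (rcosets\<^bsub>?T\<^esub> ?K)"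
    and hom: "\<phi> (m + n) = \<phi> m <#>\<^bsub>?T\<^esub> \<phi> n" for m n
    using iso by (auto simp: graded_iso_ind_def ind_def FactGroup_def)
  define t where "t u = inv_into UNIV \<phi> (?K #>\<^bsub>?T\<^esub> u)" for u
  have \<phi>t: "\<phi> (t u) = ?K #>\<^bsub>?T\<^esub> u" if "u \<in> carrier ?T" for u
    using bij that T.rcosetsI[OF N.subset that]
    unfolding t_def by (metis bij_betw_imp_surj_on f_inv_into_f)
  have inj: "\<phi> m = \<phi> n \<Longrightarrow> m = n" for m n using bij by (auto simp: bij_betw_def inj_on_def)
  have add: "t (u + w) = t u + t w" if "u \<in> carrier ?T" "w \<in> carrier ?T" for u w
  proof (rule inj)
    have "u + w \<in> carrier ?T" using T.m_closed[OF that] by simp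
    then show "\<phi> (t (u + w)) = \<phi> (t u + t w)"
      using N.rcos_sum[OF that] that by (simp add: hom \<phi>t)
  qed
  have t0: "t 0 = 0" using add[of 0 0] T.one_closed by simp
  have ker: "t u = 0 \<longleftrightarrow> u \<in> ?K" if u: "u \<in> carrier ?T" for u
  proof -
    have z: "0 \<in> carrier ?T" using T.one_closed by simp
    have "t u = 0 \<longleftrightarrow> \<phi> (t u) = \<phi> (t 0)" using t0 inj by auto
    also have "\<dots> \<longleftrightarrow> ?K #>\<^bsub>?T\<^esub> u = ?K"
      using T.coset_mult_one[OF N.subset] by (simp add: \<phi>t u z)
    also have "\<dots> \<longleftrightarrow> u \<in> ?K" using T.coset_join1[OF _ u K] T.coset_join2[OF u K] by blast
    finally show ?thesis .
  qed
  have surj: "\<exists>u\<in>carrier ?T. m = t u" for m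
  proof -
    have "\<phi> m \<in> rcosets\<^bsub>?T\<^esub> ?K" using bij by (auto simp: bij_betw_def)
    then obtain u where "u \<in> carrier ?T" "\<phi> m = ?K #>\<^bsub>?T\<^esub> u" by (auto simp: RCOSETS_def)
    then show ?thesis using \<phi>t inj by metis
  qed
  have act: "ract (lact a (t (frag_of (x, v)))) b = t (frag_of (prod_biact a x b, v))"
    if a: "a \<in> group_alg H1" and x: "x \<in> group_alg (H1 \<times> H2)" and b: "b \<in> group_alg H2" for a x b v
  proof -
    let ?m = "ract (lact a (t (frag_of (x, v)))) b" and ?w = "frag_of (prod_biact a x b, v)"
    let ?f = "frag_extend (\<lambda>(x, v). frag_of (prod_biact a x b, v))"
    have car: "frag_of (x, v) \<in> carrier ?T" using x by (simp add: tensor_free_def)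
    have "\<phi> ?m = ind_biact H1 H2 sV \<rho> a (\<phi> (t (frag_of (x, v)))) b"
      using iso a b by (auto simp: graded_iso_ind_def)
    also have "\<dots> = ?K <#>\<^bsub>?T\<^esub> (?f ` (?K #>\<^bsub>?T\<^esub> frag_of (x, v)))"
      unfolding ind_biact_def \<phi>t[OF car] ..
    finally have eq: "\<phi> ?m = \<dots>" .
    \<comment> \<open>\<open>\<phi> ?m\<close> is known to be a coset of \<open>?K\<close>, so
      exhibiting the single element \<open>?w\<close> in it identifies it.\<close>
    have "?f (frag_of (x, v)) \<in> ?f ` (?K #>\<^bsub>?T\<^esub> frag_of (x, v))"
      using T.rcos_self[OF car K] by (rule imageI)
    then have "?w \<in> ?f ` (?K #>\<^bsub>?T\<^esub> frag_of (x, v))" by simp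
    then have "0 + ?w \<in> \<phi> ?m"
      unfolding eq set_mult_def using N.one_closed by force
    then have w: "?w \<in> \<phi> ?m" by simp
    obtain u where u: "u \<in> carrier ?T" "?m = t u" using surj by blast
    then have "?w \<in> ?K #>\<^bsub>?T\<^esub> u" using w \<phi>t by simp
    from T.repr_independence[OF this u(1) K] have "\<phi> ?m = ?K #>\<^bsub>?T\<^esub> ?w" using u \<phi>t by simp
    moreover have "?w \<in> carrier ?T"
      using \<open>?w \<in> ?K #>\<^bsub>?T\<^esub> u\<close> T.r_coset_subset_G[OF N.subset u(1)] by blast
    ultimately show ?thesis using inj \<phi>t by simp
  qed
  show thesis by (rule that[OF add ker surj act])
qed

section \<open>The group algebra action on a Yetter-Drinfeld module\<close>

context yetter_drinfeld
begin

sublocale VS: vector_space s by (rule vector_space)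

lemma rep_act_add_left: "rep_act s \<rho> (a + b) v = rep_act s \<rho> a v + rep_act s \<rho> b v"
  unfolding rep_act_def by (rule sum_keys_add) (auto simp: VS.scale_left_distrib)

lemma rep_act_0_left [simp]: "rep_act s \<rho> 0 v = 0"
  by (simp add: rep_act_def)

lemma rep_act_single [simp]: "rep_act s \<rho> (Poly_Mapping.single h c) v = s c (\<rho> h v)"
  by (cases "c = 0") (auto simp: rep_act_def)

lemma rep_act_sum_left: "rep_act s \<rho> (sum f I) v = (\<Sum>i\<in>I. rep_act s \<rho> (f i) v)"
  by (induction I rule: infinite_finite_induct) (auto simp: rep_act_add_left)

lemma rep_act_one [simp]: "rep_act s \<rho> 1 v = v"
  by (simp add: rep_zero flip: single_one)

lemma rep_scale: "h \<in> H \<Longrightarrow> \<rho> h (s c v) = s c (\<rho> h v)"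
  and rep_add_right: "h \<in> H \<Longrightarrow> \<rho> h (v + w) = \<rho> h v + \<rho> h w"
  using rep_linear[of h] by (simp_all add: Vector_Spaces.linear_iff_module_hom module_hom_iff)

lemma rep_zero_right [simp]: "h \<in> H \<Longrightarrow> \<rho> h 0 = 0"
  using rep_add_right[of h 0 0] by simp

lemma rep_act_add_right:
  "a \<in> group_alg H \<Longrightarrow> rep_act s \<rho> a (v + w) = rep_act s \<rho> a v + rep_act s \<rho> a w"
  by (induction rule: group_alg_induct)
    (auto simp: rep_act_add_left rep_add_right VS.scale_right_distrib)

lemma rep_act_scale_right: "a \<in> group_alg H \<Longrightarrow> rep_act s \<rho> a (s c v) = s c (rep_act s \<rho> a v)"
  by (induction rule: group_alg_induct)
    (auto simp: rep_act_add_left rep_scale VS.scale_right_distrib mult.commute)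

lemma rep_act_diff_right:
  "a \<in> group_alg H \<Longrightarrow> rep_act s \<rho> a (v - w) = rep_act s \<rho> a v - rep_act s \<rho> a w"
  using rep_act_add_right[of a "v - w" w] by simp

lemma rep_act_scale_left: "rep_act s \<rho> (Poly_Mapping.single 0 c * a) v = s c (rep_act s \<rho> a v)"
proof (induction a rule: poly_mapping_induct_single)
  case (add a b)
  then show ?case by (simp add: distrib_left rep_act_add_left VS.scale_right_distrib)
qed (auto simp: mult_single)

lemma rep_act_mult:
  assumes "a \<in> group_alg H" "b \<in> group_alg H"
  shows "rep_act s \<rho> (a * b) v = rep_act s \<rho> a (rep_act s \<rho> b v)"
  using assms(1)
proof (induction rule: group_alg_induct)
  case zero
  show ?case by simp
next
  case (single h c)
  show ?case using assms(2)
    by (induction rule: group_alg_induct)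
      (auto simp: distrib_left mult_single rep_act_add_left rep_add_right rep_scale rep_add single
        VS.scale_right_distrib)
qed (auto simp: distrib_right rep_act_add_left)

lemma rep_act_char_idem:
  assumes "is_subgroup H" "finite H" "\<mu> \<in> chars H" "a \<in> group_alg H"
  shows "rep_act s \<rho> (char_idem H \<mu>) (rep_act s \<rho> a v) = s (ev \<mu> a) (rep_act s \<rho> (char_idem H \<mu>) v)"
proof -
  have "rep_act s \<rho> (char_idem H \<mu>) (rep_act s \<rho> a v) = rep_act s \<rho> (a * char_idem H \<mu>) v"
    using assms(4) by (simp add: rep_act_mult[symmetric] mult.commute)
  also have "\<dots> = s (ev \<mu> a) (rep_act s \<rho> (char_idem H \<mu>) v)"
    by (simp only: char_idem_mult[OF assms] rep_act_scale_left)
  finally show ?thesis .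
qed

end

context graded_bimodule
begin

sublocale MS: vector_space s by (rule vector_space)

lemma lact_0_left [simp]: "lact 0 m = 0"
  using lact_add_left[of 0 0 m] by simp

lemma lact_0_right [simp]: "a \<in> group_alg H1 \<Longrightarrow> lact a 0 = 0"
  using lact_add_right[of a 0 0] by simp

lemma ract_0_right [simp]: "ract m 0 = 0"
  using ract_add_right[of 0 0 m] by simp

lemma ract_0_left [simp]: "a \<in> group_alg H2 \<Longrightarrow> ract 0 a = 0"
  using ract_add_left[of a 0 0] by simp

lemma lact_diff_right: "a \<in> group_alg H1 \<Longrightarrow> lact a (m - n) = lact a m - lact a n"
  using lact_add_right[of a "m - n" n] by simp

lemma ract_diff_left: "a \<in> group_alg H2 \<Longrightarrow> ract (m - n) a = ract m a - ract n a"
  using ract_add_left[of a "m - n" n] by simp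

lemma lact_one [simp]: "lact 1 m = m"
  using lact_scalar[of 1 m] by simp

lemma ract_one [simp]: "ract m 1 = m"
  using ract_scalar[of m 1] by simp

end

lemma tensor_rels_intros:
  "x \<in> group_alg (H1 \<times> H2) \<Longrightarrow> y \<in> group_alg (H1 \<times> H2) \<Longrightarrow>
    frag_of (x + y, v) - frag_of (x, v) - frag_of (y, v) \<in> tensor_rels H1 H2 s \<rho>"
  "x \<in> group_alg (H1 \<times> H2) \<Longrightarrow>
    frag_of (x, v + w) - frag_of (x, v) - frag_of (x, w) \<in> tensor_rels H1 H2 s \<rho>"
  "x \<in> group_alg (H1 \<times> H2) \<Longrightarrow> a \<in> group_alg (H1 \<inter> H2) \<Longrightarrow>
    frag_of (prod_ract x a, v) - frag_of (x, rep_act s \<rho> a v) \<in> tensor_rels H1 H2 s \<rho>"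
  unfolding tensor_rels_def
  subgoal by (rule UnI1, rule UnI1, rule CollectI, rule exI[of _ x], rule exI[of _ y], rule exI[of _ v]) simp
  subgoal by (rule UnI1, rule UnI2, rule CollectI, rule exI[of _ x], rule exI[of _ v], rule exI[of _ w]) simp
  subgoal by (rule UnI2, rule CollectI, rule exI[of _ x], rule exI[of _ a], rule exI[of _ v]) simp
  done

section \<open>Peirce components of the induced bimodule\<close>

locale induced_bimodule =
  B: graded_bimodule H1 H2 sM lact ract M + Y: yetter_drinfeld "H1 \<inter> H2" sV \<rho> V
  for H1 H2 :: "'g::ab_group_add set"
    and sM :: "'f::field \<Rightarrow> 'm::ab_group_add \<Rightarrow> 'm"
    and lact ract M
    and sV :: "'f \<Rightarrow> 'v::ab_group_add \<Rightarrow> 'v"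
    and \<rho> V +
  fixes \<phi>
  assumes sub1: "is_subgroup H1" and fin1: "finite H1"
    and sub2: "is_subgroup H2" and fin2: "finite H2"
    and iso: "graded_iso_ind H1 H2 lact ract M sV \<rho> V \<phi>"
begin

lemma sub12: "is_subgroup (H1 \<inter> H2)" and fin12: "finite (H1 \<inter> H2)"
  using sub1 sub2 fin1 is_subgroup_Int by auto

lemma sub_prod: "is_subgroup (H1 \<times> H2)" and fin_prod: "finite (H1 \<times> H2)"
  using sub1 sub2 fin1 fin2 is_subgroup_Times by auto

lemma antidiagonal_in: "a \<in> group_alg (H1 \<inter> H2) \<Longrightarrow> lin_ext (\<lambda>h. (h, - h)) a \<in> group_alg (H1 \<times> H2)"
  by (rule lin_ext_in) (auto intro: is_subgroupD(3)[OF sub2])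

text \<open>\<open>tau x v\<close> is the tensor of \<open>x\<close> and \<open>v\<close> seen
  inside the bimodule. The listed properties are biadditivity, balancedness, the bimodule action,
  generation by tensors, and the universal property for maps into \<open>'v\<close>. The generation
  rule uses differences because elements of the free abelian group are integer combinations of
  generators.\<close>

lemma tau_exists:
  obtains tau :: "('g \<times> 'g \<Rightarrow>\<^sub>0 'f) \<Rightarrow> 'v \<Rightarrow> 'm" where
    "\<And>x y v. x \<in> group_alg (H1 \<times> H2) \<Longrightarrow> y \<in> group_alg (H1 \<times> H2) \<Longrightarrow>
       tau (x + y) v = tau x v + tau y v"
    "\<And>x v w. x \<in> group_alg (H1 \<times> H2) \<Longrightarrow> tau x (v + w) = tau x v + tau x w"
    "\<And>x a v. x \<in> group_alg (H1 \<times> H2) \<Longrightarrow> a \<in> group_alg (H1 \<inter> H2) \<Longrightarrow>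
       tau (prod_ract x a) v = tau x (rep_act sV \<rho> a v)"
    "\<And>a x b v. a \<in> group_alg H1 \<Longrightarrow> x \<in> group_alg (H1 \<times> H2) \<Longrightarrow> b \<in> group_alg H2 \<Longrightarrow>
      ract (lact a (tau x v)) b = tau (prod_biact a x b) v"
    "\<And>P m. P 0 \<Longrightarrow> (\<And>m n. P m \<Longrightarrow> P n \<Longrightarrow> P (m - n)) \<Longrightarrow>
      (\<And>x v. x \<in> group_alg (H1 \<times> H2) \<Longrightarrow> P (tau x v)) \<Longrightarrow> P m"
    "\<And>(f :: _ \<Rightarrow> 'v \<Rightarrow> 'v) x v.
       (\<And>x y v. x \<in> group_alg (H1 \<times> H2) \<Longrightarrow> y \<in> group_alg (H1 \<times> H2) \<Longrightarrow> f (x + y) v = f x v + f y v) \<Longrightarrow>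
       (\<And>x v w. x \<in> group_alg (H1 \<times> H2) \<Longrightarrow> f x (v + w) = f x v + f x w) \<Longrightarrow>
       (\<And>x a v. x \<in> group_alg (H1 \<times> H2) \<Longrightarrow> a \<in> group_alg (H1 \<inter> H2) \<Longrightarrow>
          f (prod_ract x a) v = f x (rep_act sV \<rho> a v)) \<Longrightarrow>
       x \<in> group_alg (H1 \<times> H2) \<Longrightarrow> tau x v = 0 \<Longrightarrow> f x v = 0"
proof -
  let ?A = "group_alg (H1 \<times> H2) :: ('g \<times> 'g \<Rightarrow>\<^sub>0 'f) set"
  let ?T = "tensor_free H1 H2 :: (('g \<times> 'g \<Rightarrow>\<^sub>0 'f) \<times> 'v \<Rightarrow>\<^sub>0 int) monoid"
  let ?K = "tensor_ker H1 H2 sV \<rho>"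
  obtain t :: "(('g \<times> 'g \<Rightarrow>\<^sub>0 'f) \<times> 'v \<Rightarrow>\<^sub>0 int) \<Rightarrow> 'm" where
    t_add: "\<And>u w. u \<in> carrier ?T \<Longrightarrow> w \<in> carrier ?T \<Longrightarrow> t (u + w) = t u + t w" and
    t_ker: "\<And>u. u \<in> carrier ?T \<Longrightarrow> t u = 0 \<longleftrightarrow> u \<in> ?K" and
    t_surj: "\<And>m. \<exists>u\<in>carrier ?T. m = t u" and
    t_act: "\<And>a x b v. a \<in> group_alg H1 \<Longrightarrow> x \<in> ?A \<Longrightarrow> b \<in> group_alg H2 \<Longrightarrow>
      ract (lact a (t (frag_of (x, v)))) b = t (frag_of (prod_biact a x b, v))"
    by (rule ind_presentation[OF sub1 sub2 iso]) (rule that; assumption)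
  define tau where "tau x v = t (frag_of (x, v))" for x v
  have car_diff: "u - w \<in> carrier ?T" if "u \<in> carrier ?T" "w \<in> carrier ?T" for u w
    using that keys_diff[of u w] unfolding tensor_free_def by auto
  have t_diff: "t (u - w) = t u - t w" if "u \<in> carrier ?T" "w \<in> carrier ?T" for u w
    using t_add[OF car_diff[OF that] that(2)] by simp
  have car: "frag_of (x, v) \<in> carrier ?T" if "x \<in> ?A" for x v
    using that by (simp add: tensor_free_def)
  have rel: "t u = 0" if "u \<in> tensor_rels H1 H2 sV \<rho>" for u
    using that t_ker[of u] tensor_rels_subset[OF sub1 sub2, of sV \<rho>]
    by (auto simp: tensor_ker_def intro: generate.incl)
  show thesis
  proof (rule that)
    fix x y :: "'g \<times> 'g \<Rightarrow>\<^sub>0 'f" and v assume xy: "x \<in> ?A" "y \<in> ?A"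
    have "t (frag_of (x + y, v) - frag_of (x, v) - frag_of (y, v)) = 0"
      by (rule rel[OF tensor_rels_intros(1)[OF xy]])
    then show "tau (x + y) v = tau x v + tau y v"
      using xy by (simp add: tau_def t_diff car_diff car diff_eq_eq add.commute)
  next
    fix x v w assume x: "x \<in> ?A"
    have "t (frag_of (x, v + w) - frag_of (x, v) - frag_of (x, w)) = 0"
      by (rule rel[OF tensor_rels_intros(2)[OF x]])
    then show "tau x (v + w) = tau x v + tau x w"
      using x by (simp add: tau_def t_diff car_diff car diff_eq_eq add.commute)
  next
    fix x v and a :: "'g \<Rightarrow>\<^sub>0 'f" assume x: "x \<in> ?A" and a: "a \<in> group_alg (H1 \<inter> H2)"
    have "t (frag_of (prod_ract x a, v) - frag_of (x, rep_act sV \<rho> a v)) = 0"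
      by (rule rel[OF tensor_rels_intros(3)[OF x a]])
    moreover have "prod_ract x a \<in> ?A"
      unfolding prod_ract_conv by (rule group_alg_mult[OF sub_prod x antidiagonal_in[OF a]])
    ultimately show "tau (prod_ract x a) v = tau x (rep_act sV \<rho> a v)"
      using x by (simp add: tau_def t_diff car)
  next
    fix a b :: "'g \<Rightarrow>\<^sub>0 'f" and x v assume "a \<in> group_alg H1" "x \<in> ?A" "b \<in> group_alg H2"
    then show "ract (lact a (tau x v)) b = tau (prod_biact a x b) v"
      unfolding tau_def by (rule t_act)
  next
    fix P m assume P: "P 0" "\<And>m n. P m \<Longrightarrow> P n \<Longrightarrow> P (m - n)" "\<And>x v. x \<in> ?A \<Longrightarrow> P (tau x v)"
    obtain u where u: "u \<in> carrier ?T" "m = t u" using t_surj by blast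
    from u(1) have "Poly_Mapping.keys u \<subseteq> ?A \<times> UNIV" by (simp add: tensor_free_def)
    then have "P (t u)"
    proof (rule free_Abelian_group_induct, goal_cases)
      case 1
      have z: "0 \<in> carrier ?T" by (simp add: tensor_free_def)
      show ?case using t_diff[OF z z] P(1) by simp
    next
      case (2 u w)
      then have "u \<in> carrier ?T" "w \<in> carrier ?T" by (simp_all add: tensor_free_def)
      then show ?case using P(2) 2 t_diff by simp
    next
      case (3 p)
      then show ?case using P(3)[of "fst p" "snd p"] by (auto simp: tau_def)
    qed
    then show "P m" using u by simp
  next
    fix f :: "_ \<Rightarrow> 'v \<Rightarrow> 'v" and x v
    assume f: "\<And>x y v. x \<in> ?A \<Longrightarrow> y \<in> ?A \<Longrightarrow> f (x + y) v = f x v + f y v"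
      "\<And>x v w. x \<in> ?A \<Longrightarrow> f x (v + w) = f x v + f x w"
      "\<And>x a v. x \<in> ?A \<Longrightarrow> a \<in> group_alg (H1 \<inter> H2) \<Longrightarrow>
          f (prod_ract x a) v = f x (rep_act sV \<rho> a v)"
      and x: "x \<in> ?A" "tau x v = 0"
    have "frag_of (x, v) \<in> ?K" using x t_ker car unfolding tau_def by blast
    with frag_hom_vanishes_on_tensor_ker[OF Y.vector_space sub1 sub2, of "\<lambda>(x, v). f x v" \<rho> x v] f
    show "f x v = 0" by simp
  qed
qed

definition char_prod :: "('g \<Rightarrow> 'f) \<Rightarrow> ('g \<Rightarrow> 'f) \<Rightarrow> 'g \<times> 'g \<Rightarrow> 'f" where
  "char_prod \<chi> \<eta> = (\<lambda>(h, k). \<chi> h * \<eta> k)"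

text \<open>The pull-back of \<open>char_prod \<chi> \<eta>\<close> along the antidiagonal, which is
  how \<open>H1 \<inter> H2\<close> acts in the tensor product. The cut-off matches the convention
  of \<open>chars\<close>.\<close>

definition char_quot :: "('g \<Rightarrow> 'f) \<Rightarrow> ('g \<Rightarrow> 'f) \<Rightarrow> 'g \<Rightarrow> 'f" where
  "char_quot \<chi> \<eta> h = (if h \<in> H1 \<inter> H2 then \<chi> h * \<eta> (- h) else 0)"

lemma char_prod_chars: "\<chi> \<in> chars H1 \<Longrightarrow> \<eta> \<in> chars H2 \<Longrightarrow> char_prod \<chi> \<eta> \<in> chars (H1 \<times> H2)"
  by (auto simp: chars_def char_prod_def zero_prod_def)

lemma char_quot_chars: 
  assumes "\<chi> \<in> chars H1" "\<eta> \<in> chars H2" shows "char_quot \<chi> \<eta> \<in> chars (H1 \<inter> H2)"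
proof -
  have "\<eta> (- (x + y)) = \<eta> (- x) * \<eta> (- y)" if "x \<in> H2" "y \<in> H2" for x y
    using charsD(2)[OF assms(2) is_subgroupD(3)[OF sub2 that(1)] is_subgroupD(3)[OF sub2 that(2)]]
    by (simp add: add.commute)
  then show ?thesis
    using charsD[OF assms(1)] charsD(1)[OF assms(2)] is_subgroupD(1,2)[OF sub1] is_subgroupD(1,2)[OF sub2]
    by (auto simp: chars_def char_quot_def)
qed

text \<open>Lets a single idempotent of the product group replace the left and the right one, so
  that a two-sided component is cut out by one multiplication.\<close>

lemma char_idem_prod:
  "lin_ext (\<lambda>h. (h, 0)) (char_idem H1 \<chi>) * lin_ext (\<lambda>k. (0, k)) (char_idem H2 \<eta>)
    = char_idem (H1 \<times> H2) (char_prod \<chi> \<eta>)"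
  unfolding char_idem_def lin_ext_sum sum_product
  by (simp add: mult_single char_prod_def sum.cartesian_product card_cartesian_product case_prod_unfold)

lemma ev_char_prod_antidiagonal:
  assumes "a \<in> group_alg (H1 \<inter> H2)"
  shows "ev (char_prod \<chi> \<eta>) (lin_ext (\<lambda>h. (h, - h)) a) = ev (char_quot \<chi> \<eta>) a"
  unfolding ev_lin_ext by (rule ev_cong[OF assms]) (auto simp: char_prod_def char_quot_def)

text \<open>The map \<open>x \<otimes> v \<mapsto> (\<chi> \<times> \<eta>)(x) e\<^sub>\<mu> v\<close> with \<open>\<mu> = \<chi> \<eta>\<inverse>\<close> on \<open>H1 \<inter> H2\<close> is
  balanced, and identifies \<open>e\<^sub>\<chi> M e\<^sub>\<eta>\<close> with \<open>e\<^sub>\<mu> V\<close>.\<close>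

lemma components:
  assumes card: "of_nat (card H1) \<noteq> (0::'f)" "of_nat (card H2) \<noteq> (0::'f)" "of_nat (card (H1 \<inter> H2)) \<noteq> (0::'f)"
    and \<chi>: "\<chi> \<in> chars H1" and \<eta>: "\<eta> \<in> chars H2"
  defines "e \<equiv> rep_act sV \<rho> (char_idem (H1 \<inter> H2) (char_quot \<chi> \<eta>))"
  obtains g where
    "\<And>v w. g (v + w) = g v + g w" "\<And>c v. g (sV c v) = sM c (g v)"
    "\<And>m. \<exists>v. ract (lact (char_idem H1 \<chi>) m) (char_idem H2 \<eta>) = g v"
    "\<And>v. \<exists>m. g v = ract (lact (char_idem H1 \<chi>) m) (char_idem H2 \<eta>)"
    "\<And>v. g (e v) = g v" "\<And>v. g v = 0 \<Longrightarrow> e v = 0"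
proof (rule tau_exists)
  let ?A = "group_alg (H1 \<times> H2) :: ('g \<times> 'g \<Rightarrow>\<^sub>0 'f) set"
  fix tau :: "('g \<times> 'g \<Rightarrow>\<^sub>0 'f) \<Rightarrow> 'v \<Rightarrow> 'm"
  assume tau: "\<And>x y v. x \<in> ?A \<Longrightarrow> y \<in> ?A \<Longrightarrow> tau (x + y) v = tau x v + tau y v"
    "\<And>x v w. x \<in> ?A \<Longrightarrow> tau x (v + w) = tau x v + tau x w"
    and bal: "\<And>x a v. x \<in> ?A \<Longrightarrow> a \<in> group_alg (H1 \<inter> H2) \<Longrightarrow>
       tau (prod_ract x a) v = tau x (rep_act sV \<rho> a v)"
    and act: "\<And>a x b v. a \<in> group_alg H1 \<Longrightarrow> x \<in> ?A \<Longrightarrow> b \<in> group_alg H2 \<Longrightarrow>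
      ract (lact a (tau x v)) b = tau (prod_biact a x b) v"
    and span: "\<And>P m. P 0 \<Longrightarrow> (\<And>m n. P m \<Longrightarrow> P n \<Longrightarrow> P (m - n)) \<Longrightarrow>
      (\<And>x v. x \<in> ?A \<Longrightarrow> P (tau x v)) \<Longrightarrow> P m"
    and univ: "\<And>(f :: _ \<Rightarrow> 'v \<Rightarrow> 'v) x v.
       (\<And>x y v. x \<in> ?A \<Longrightarrow> y \<in> ?A \<Longrightarrow> f (x + y) v = f x v + f y v) \<Longrightarrow>
       (\<And>x v w. x \<in> ?A \<Longrightarrow> f x (v + w) = f x v + f x w) \<Longrightarrow>
       (\<And>x a v. x \<in> ?A \<Longrightarrow> a \<in> group_alg (H1 \<inter> H2) \<Longrightarrow>
          f (prod_ract x a) v = f x (rep_act sV \<rho> a v)) \<Longrightarrow>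
       x \<in> ?A \<Longrightarrow> tau x v = 0 \<Longrightarrow> f x v = 0"
  define \<omega> where "\<omega> = char_prod \<chi> \<eta>"
  define \<mu> where "\<mu> = char_quot \<chi> \<eta>"
  define E where "E = char_idem (H1 \<times> H2) \<omega>"
  let ?e = "char_idem (H1 \<inter> H2) \<mu>"
  have e: "e = rep_act sV \<rho> ?e" by (simp add: e_def \<mu>_def)
  have \<omega>: "\<omega> \<in> chars (H1 \<times> H2)" and \<mu>: "\<mu> \<in> chars (H1 \<inter> H2)"
    unfolding \<omega>_def \<mu>_def by (rule char_prod_chars char_quot_chars \<chi> \<eta>)+
  have E: "E \<in> ?A" by (simp add: E_def)
  have card_prod: "of_nat (card (H1 \<times> H2)) \<noteq> (0::'f)" using card by (simp add: card_cartesian_product)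
  have one: "lin_ext (\<lambda>k. (0 :: 'g, k :: 'g)) 1 = (1 :: _ \<Rightarrow>\<^sub>0 'f)"
    using lin_ext_single[of "\<lambda>k. (0 :: 'g, k :: 'g)" 0 "1 :: 'f"] by (simp flip: zero_prod_def)
  \<comment> \<open>Scalars enter the bimodule as multiples of the unit. The action moves them to
    the first tensor factor, and balancedness over multiples of the unit then moves them to the
    second in \<open>scale'\<close>.\<close>
  have scale: "tau (Poly_Mapping.single 0 c * x) v = sM c (tau x v)" if "x \<in> ?A" for c x v
    using act[OF group_alg_single[OF is_subgroupD(1)[OF sub1]] that group_alg_one[OF sub2], of c v]
    by (simp add: prod_biact_conv B.lact_scalar one flip: zero_prod_def)
  have scale': "tau x (sV c v) = sM c (tau x v)" if "x \<in> ?A" for c x v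
    using bal[OF that, of "Poly_Mapping.single 0 c" v] is_subgroupD(1)[OF sub12] scale[OF that]
    by (simp add: prod_ract_conv Y.rep_zero mult.commute flip: zero_prod_def)
  \<comment> \<open>Acting from both sides multiplies \<open>x\<close> by \<open>E\<close>, and
    \<open>E\<close> absorbs \<open>x\<close> into the scalar \<open>ev \<omega> x\<close>. Hence
    only tensors with first factor \<open>E\<close> remain.\<close>
  have comp: "ract (lact (char_idem H1 \<chi>) (tau x v)) (char_idem H2 \<eta>) = tau E (sV (ev \<omega> x) v)"
    if x: "x \<in> ?A" for x v
  proof -
    have "prod_biact (char_idem H1 \<chi>) x (char_idem H2 \<eta>) = x * E"
      unfolding prod_biact_conv E_def \<omega>_def char_idem_prod[symmetric] by (simp only: ac_simps)
    also have "\<dots> = Poly_Mapping.single 0 (ev \<omega> x) * E"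
      unfolding E_def by (rule char_idem_mult[OF sub_prod fin_prod \<omega> x])
    finally show ?thesis using act[OF char_idem_in x char_idem_in] scale[OF E] scale'[OF E] by simp
  qed
  have tau_e: "tau E (rep_act sV \<rho> a v) = tau E (sV (ev \<mu> a) v)" if a: "a \<in> group_alg (H1 \<inter> H2)" for a v
  proof -
    have "tau E (rep_act sV \<rho> a v) = tau (lin_ext (\<lambda>h. (h, - h)) a * E) v"
      using bal[OF E a, of v] by (simp add: prod_ract_conv mult.commute)
    also have "lin_ext (\<lambda>h. (h, - h)) a * E = Poly_Mapping.single 0 (ev \<mu> a) * E"
      using char_idem_mult[OF sub_prod fin_prod \<omega> antidiagonal_in[OF a]]
      by (simp add: E_def \<omega>_def \<mu>_def ev_char_prod_antidiagonal[OF a])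
    finally show ?thesis using scale[OF E] scale'[OF E] by simp
  qed
  have ev_E: "ev \<omega> E = 1" unfolding E_def by (rule ev_char_idem_self[OF sub_prod fin_prod \<omega> card_prod])
  show thesis
  \<comment> \<open>The map \<open>v \<mapsto> E \<otimes> v\<close> has its values in the component
    because \<open>E\<close> is fixed by both idempotents, and by \<open>comp\<close> it reaches all
    of it.\<close>
  proof (rule that[of "tau E"])
    show "tau E (v + w) = tau E v + tau E w" for v w by (rule tau(2)[OF E])
    show "tau E (sV c v) = sM c (tau E v)" for c v by (rule scale'[OF E])
    show "tau E (e v) = tau E v" for v
      using tau_e[OF char_idem_in, of \<mu> v] ev_char_idem_self[OF sub12 fin12 \<mu> card(3)] by (simp add: e)
    show "\<exists>m. tau E v = ract (lact (char_idem H1 \<chi>) m) (char_idem H2 \<eta>)" for v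
      using comp[OF E, of v] ev_E by (intro exI[of _ "tau E v"]) simp
    have diff: "tau E (v - w) = tau E v - tau E w" for v w
      using tau(2)[OF E, of "v - w" w] by simp
    show "\<exists>v. ract (lact (char_idem H1 \<chi>) m) (char_idem H2 \<eta>) = tau E v" for m
    proof (rule span[of "\<lambda>m. \<exists>v. ract (lact (char_idem H1 \<chi>) m) (char_idem H2 \<eta>) = tau E v" m])
      show "\<exists>v. ract (lact (char_idem H1 \<chi>) 0) (char_idem H2 \<eta>) = tau E v"
        using diff[of 0 0] by (intro exI[of _ 0]) simp
    next
      fix m n
      assume "\<exists>v. ract (lact (char_idem H1 \<chi>) m) (char_idem H2 \<eta>) = tau E v"
        "\<exists>v. ract (lact (char_idem H1 \<chi>) n) (char_idem H2 \<eta>) = tau E v"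
      then obtain v w where
        "ract (lact (char_idem H1 \<chi>) m) (char_idem H2 \<eta>) = tau E v"
        "ract (lact (char_idem H1 \<chi>) n) (char_idem H2 \<eta>) = tau E w" by blast
      then show "\<exists>v. ract (lact (char_idem H1 \<chi>) (m - n)) (char_idem H2 \<eta>) = tau E v"
        by (intro exI[of _ "v - w"]) (simp add: B.lact_diff_right B.ract_diff_left diff)
    qed (use comp in blast)
    show "e v = 0" if "tau E v = 0" for v
    proof -
      \<comment> \<open>Since \<open>ev \<omega> E = 1\<close>, the balanced map sends
        \<open>E \<otimes> v\<close> to \<open>e v\<close>, so a vanishing tensor forces
        \<open>e v = 0\<close>.\<close>
      have "sV (ev \<omega> E) (e v) = 0"
      proof (rule univ[of "\<lambda>x v. sV (ev \<omega> x) (e v)", OF _ _ _ E that])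
        show "sV (ev \<omega> (x + y)) (e v) = sV (ev \<omega> x) (e v) + sV (ev \<omega> y) (e v)" for x y v
          by (simp add: ev_add Y.VS.scale_left_distrib)
        show "sV (ev \<omega> x) (e (v + w)) = sV (ev \<omega> x) (e v) + sV (ev \<omega> x) (e w)" for x v w
          by (simp add: e Y.rep_act_add_right Y.VS.scale_right_distrib)
        fix x v and a :: "'g \<Rightarrow>\<^sub>0 'f" assume x: "x \<in> ?A" and a: "a \<in> group_alg (H1 \<inter> H2)"
        have "ev \<omega> (prod_ract x a) = ev \<omega> x * ev \<omega> (lin_ext (\<lambda>h. (h, - h)) a)"
          unfolding prod_ract_conv by (rule ev_mult[OF x antidiagonal_in[OF a] charsD(2)[OF \<omega>]])
        also have "ev \<omega> (lin_ext (\<lambda>h. (h, - h)) a) = ev \<mu> a"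
          unfolding \<omega>_def \<mu>_def by (rule ev_char_prod_antidiagonal[OF a])
        finally show "sV (ev \<omega> (prod_ract x a)) (e v) = sV (ev \<omega> x) (e (rep_act sV \<rho> a v))"
          using Y.rep_act_char_idem[OF sub12 fin12 \<mu> a] by (simp add: e)
      qed
      then show ?thesis using ev_E by simp
    qed
  qed
qed

text \<open>The map from \<open>components\<close> carries a spanning vector of the part of the
  module to one of the bimodule component. Back from the bimodule, each character of
  \<open>H1 \<inter> H2\<close> must first be realised as a quotient, by extending it to
  \<open>H1\<close>; this is where splitting of \<open>H1\<close> passes to the
  intersection.\<close>

lemma components_rank_iff:
  assumes s1: "splits TYPE('f) H1" and s2: "splits TYPE('f) H2"
  shows "(\<forall>\<chi>\<in>chars H1. \<forall>\<eta>\<in>chars H2. \<exists>u. \<forall>m. \<exists>c.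
            ract (lact (char_idem H1 \<chi>) m) (char_idem H2 \<eta>) = sM c u)
     \<longleftrightarrow> (\<forall>\<mu>\<in>chars (H1 \<inter> H2). \<exists>u. \<forall>v. \<exists>c. rep_act sV \<rho> (char_idem (H1 \<inter> H2) \<mu>) v = sV c u)"
    (is "?M \<longleftrightarrow> ?V")
proof -
  note s12 = splits_subgroup[OF sub1 fin1 sub12 _ s1, simplified]
  note card = splits_card[OF s1] splits_card[OF s2] splits_card[OF s12(1)]
  show ?thesis
  proof
    assume V: ?V
    show ?M
    proof (intro ballI)
      fix \<chi> \<eta> :: "'g \<Rightarrow> 'f" assume \<chi>: "\<chi> \<in> chars H1" and \<eta>: "\<eta> \<in> chars H2"
      obtain u where u: "\<And>v. \<exists>c. rep_act sV \<rho> (char_idem (H1 \<inter> H2) (char_quot \<chi> \<eta>)) v = sV c u"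
        using V char_quot_chars[OF \<chi> \<eta>] by blast
      obtain g where g: "\<And>c v. g (sV c v) = sM c (g v)"
        "\<And>m. \<exists>v. ract (lact (char_idem H1 \<chi>) m) (char_idem H2 \<eta>) = g v"
        "\<And>v. g (rep_act sV \<rho> (char_idem (H1 \<inter> H2) (char_quot \<chi> \<eta>)) v) = g v"
        by (rule components[OF card \<chi> \<eta>]) (rule that; assumption)
      have "\<exists>c. ract (lact (char_idem H1 \<chi>) m) (char_idem H2 \<eta>) = sM c (g u)" for m
        using g u by metis
      then show "\<exists>u. \<forall>m. \<exists>c. ract (lact (char_idem H1 \<chi>) m) (char_idem H2 \<eta>) = sM c u" by blast
    qed
  next
    assume M: ?M
    show ?V
    proof
      fix \<mu> :: "'g \<Rightarrow> 'f" assume \<mu>: "\<mu> \<in> chars (H1 \<inter> H2)"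
      obtain \<chi> where \<chi>: "\<chi> \<in> chars H1" "\<And>h. h \<in> H1 \<inter> H2 \<Longrightarrow> \<chi> h = \<mu> h"
        using s12(2)[OF \<mu>] by blast
      \<comment> \<open>The trivial character of \<open>H2\<close>, so that the quotient is just the
        restriction of \<open>\<chi>\<close>.\<close>
      define \<eta> :: "'g \<Rightarrow> 'f" where "\<eta> = (\<lambda>h. if h \<in> H2 then 1 else 0)"
      have \<eta>: "\<eta> \<in> chars H2" using is_subgroupD[OF sub2] by (auto simp: chars_def \<eta>_def)
      have q: "char_quot \<chi> \<eta> = \<mu>"
        by (rule char_eqI[OF sub12 fin12 char_quot_chars[OF \<chi>(1) \<eta>] \<mu>])
          (use \<chi>(2) is_subgroupD(3)[OF sub2] in \<open>auto simp: char_quot_def \<eta>_def\<close>)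
      let ?e = "rep_act sV \<rho> (char_idem (H1 \<inter> H2) \<mu>)"
      obtain g where g: "\<And>v w. g (v + w) = g v + g w" "\<And>c v. g (sV c v) = sM c (g v)"
        "\<And>v. \<exists>m. g v = ract (lact (char_idem H1 \<chi>) m) (char_idem H2 \<eta>)"
        "\<And>v. g (?e v) = g v" "\<And>v. g v = 0 \<Longrightarrow> ?e v = 0"
        by (rule components[OF card \<chi>(1) \<eta>, unfolded q]) (rule that; assumption)
      obtain u where u: "\<And>v. \<exists>c. g v = sM c u" using M \<chi>(1) \<eta> g(3) by metis
      show "\<exists>u. \<forall>v. \<exists>c. ?e v = sV c u"
      proof (cases "\<exists>v. ?e v \<noteq> 0")
        case True
        then obtain v0 where v0: "?e v0 \<noteq> 0" by blast
        obtain c0 where c0: "g v0 = sM c0 u" using u by blast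
        have "g v0 \<noteq> 0" using g(5) v0 by blast
        then have "c0 \<noteq> 0" using c0 by auto
        have "\<exists>c. ?e v = sV c (?e v0)" for v
        proof -
          obtain c where c: "g v = sM c u" using u by blast
          \<comment> \<open>Chosen to cancel the \<open>u\<close>-coordinate: \<open>g\<close> kills
            \<open>v + sV ?d v0\<close>, and so does the idempotent.\<close>
          let ?d = "- (c / c0)"
          have "g (v + sV ?d v0) = 0"
            unfolding g(1,2) c c0 using \<open>c0 \<noteq> 0\<close> by (simp del: B.MS.scale_minus_left add: B.MS.scale_left_distrib[symmetric])
          then have "?e (v + sV ?d v0) = 0" by (rule g(5))
          then have "?e v = sV (c / c0) (?e v0)"
            by (simp add: Y.rep_act_diff_right Y.rep_act_scale_right)
          then show ?thesis by blast
        qed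
        then show ?thesis by blast
      next
        case False
        then show ?thesis by (intro exI[of _ 0]) simp
      qed
    qed
  qed
qed

end

section \<open>Submodules of the regular module\<close>

text \<open>In the group algebra the idempotent cuts out a line by \<open>char_idem_mult\<close>.
  The injective module map pulls this property back to the module.\<close>

lemma (in yetter_drinfeld) regular_submodule_imp_rank:
  assumes sub: "is_subgroup H" and fin: "finite H"
    and N: "regular_submodule H N" and \<psi>: "module_iso_regular H s \<rho> N \<psi>" and \<mu>: "\<mu> \<in> chars H"
  shows "\<exists>u. \<forall>v. \<exists>c. rep_act s \<rho> (char_idem H \<mu>) v = s c u"
proof -
  let ?e = "char_idem H \<mu>"
  have inj: "\<psi> v = \<psi> w \<Longrightarrow> v = w" for v w
    using \<psi> by (auto simp: module_iso_regular_def bij_betw_def inj_on_def)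
  have act: "\<psi> (rep_act s \<rho> a v) = a * \<psi> v" if "a \<in> group_alg H" for a v
    using \<psi> that by (simp add: module_iso_regular_def)
  have "\<psi> v \<in> group_alg H" for v
    using \<psi> N by (auto simp: module_iso_regular_def bij_betw_def regular_submodule_def)
  then have \<psi>e: "\<psi> (rep_act s \<rho> ?e v) = Poly_Mapping.single 0 (ev \<mu> (\<psi> v)) * ?e" for v
    using act[OF char_idem_in, of \<mu> v] char_idem_mult[OF sub fin \<mu>, of "\<psi> v"] by (simp add: mult.commute)
  have scale: "\<psi> (s c v) = Poly_Mapping.single 0 c * \<psi> v" for c v
    using act[of "Poly_Mapping.single 0 c" v] is_subgroupD(1)[OF sub] by (simp add: rep_zero)
  show ?thesis
  proof (cases "\<exists>v. ev \<mu> (\<psi> v) \<noteq> 0")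
    case True
    then obtain v0 where v0: "ev \<mu> (\<psi> v0) \<noteq> 0" by blast
    have "rep_act s \<rho> ?e v = s (ev \<mu> (\<psi> v) / ev \<mu> (\<psi> v0)) (rep_act s \<rho> ?e v0)" for v
      by (rule inj) (use v0 in \<open>simp add: \<psi>e scale mult.assoc[symmetric] mult_single\<close>)
    then show ?thesis by blast
  next
    case False
    then have "rep_act s \<rho> ?e v = rep_act s \<rho> ?e 0" for v
      by (intro inj) (simp add: \<psi>e)
    then show ?thesis by (metis VS.scale_one)
  qed
qed

text \<open>The coordinate of \<open>v\<close> along each spanning vector becomes the coefficient of
  the corresponding idempotent. Multiplying by that idempotent recovers the coordinate, and since
  the idempotents sum to \<open>1\<close>, the coordinates determine \<open>v\<close>.\<close>

lemma (in yetter_drinfeld) rank_imp_regular_submodule: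
  assumes sub: "is_subgroup H" and fin: "finite H" and split: "splits TYPE('f) H"
    and rank: "\<And>\<mu>. \<mu> \<in> chars H \<Longrightarrow> \<exists>u. \<forall>v. \<exists>c. rep_act s \<rho> (char_idem H \<mu>) v = s c u"
  shows "\<exists>N \<psi>. regular_submodule H N \<and> module_iso_regular H s \<rho> N \<psi>"
proof -
  have card: "of_nat (card H) \<noteq> (0::'f)" by (rule splits_card[OF split])
  have fin_chars: "finite (chars H :: ('g \<Rightarrow> 'f) set)" by (rule finite_chars[OF sub fin])
  let ?e = "char_idem H :: ('g \<Rightarrow> 'f) \<Rightarrow> _"
  obtain u where u: "\<And>\<mu> v. \<mu> \<in> chars H \<Longrightarrow> \<exists>c. rep_act s \<rho> (?e \<mu>) v = s c (u \<mu>)"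
    using rank by metis
  define U where "U = {\<mu> \<in> chars H. u \<mu> \<noteq> 0}"
  \<comment> \<open>Where \<open>u \<mu> = 0\<close> the coordinate would be arbitrary. Normalising
    it to \<open>0\<close> makes it unique, hence additive and compatible with the action.\<close>
  have "\<exists>c. \<forall>\<mu>\<in>chars H. \<forall>v. rep_act s \<rho> (?e \<mu>) v = s (c \<mu> v) (u \<mu>) \<and> (u \<mu> = 0 \<longrightarrow> c \<mu> v = 0)"
  proof -
    have "\<exists>c. rep_act s \<rho> (?e \<mu>) v = s c (u \<mu>) \<and> (u \<mu> = 0 \<longrightarrow> c = 0)" if "\<mu> \<in> chars H" for \<mu> v
      using u[OF that, of v] by (cases "u \<mu> = 0") auto
    then show ?thesis by metis
  qed
  then obtain c where c: "\<And>\<mu> v. \<mu> \<in> chars H \<Longrightarrow> rep_act s \<rho> (?e \<mu>) v = s (c \<mu> v) (u \<mu>)"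
    and c0: "\<And>\<mu> v. \<mu> \<in> chars H \<Longrightarrow> u \<mu> = 0 \<Longrightarrow> c \<mu> v = 0" by blast
  have c_unique: "c \<mu> v = d" if "\<mu> \<in> chars H" "rep_act s \<rho> (?e \<mu>) v = s d (u \<mu>)" "u \<mu> = 0 \<longrightarrow> d = 0" for \<mu> v d
    using c[OF that(1), of v] c0[OF that(1), of v] that by (cases "u \<mu> = 0") auto
  have c_add: "c \<mu> (v + w) = c \<mu> v + c \<mu> w" if "\<mu> \<in> chars H" for \<mu> v w
    by (rule c_unique[OF that], unfold rep_act_add_right[OF char_idem_in], unfold c[OF that])
      (use c0[OF that] in \<open>auto simp: VS.scale_left_distrib\<close>)
  have c_act: "c \<mu> (rep_act s \<rho> a v) = ev \<mu> a * c \<mu> v" if "\<mu> \<in> chars H" "a \<in> group_alg H" for \<mu> a v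
    by (rule c_unique[OF that(1)], unfold rep_act_char_idem[OF sub fin that], unfold c[OF that(1)])
      (use c0[OF that(1)] in auto)
  define \<psi> where "\<psi> v = (\<Sum>\<mu>\<in>chars H. Poly_Mapping.single 0 (c \<mu> v) * ?e \<mu>)" for v
  have \<psi>_add: "\<psi> (v + w) = \<psi> v + \<psi> w" for v w
    by (simp add: \<psi>_def c_add single_add distrib_right sum.distrib)
  have \<psi>_act: "\<psi> (rep_act s \<rho> a v) = a * \<psi> v" if "a \<in> group_alg H" for a v
    unfolding \<psi>_def sum_distrib_left
  proof (rule sum.cong)
    fix \<mu> :: "'g \<Rightarrow> 'f" assume \<mu>: "\<mu> \<in> chars H"
    show "Poly_Mapping.single 0 (c \<mu> (rep_act s \<rho> a v)) * ?e \<mu> = a * (Poly_Mapping.single 0 (c \<mu> v) * ?e \<mu>)"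
      unfolding mult.left_commute[of a] char_idem_mult[OF sub fin \<mu> that]
      by (simp add: c_act[OF \<mu> that] mult.assoc[symmetric] mult_single mult.commute[of "c \<mu> v"])
  qed simp
  have comp: "\<psi> v * ?e \<mu> = Poly_Mapping.single 0 (c \<mu> v) * ?e \<mu>" if \<mu>: "\<mu> \<in> chars H" for \<mu> v
  proof -
    have "\<psi> v * ?e \<mu> = (\<Sum>\<nu>\<in>chars H. if \<nu> = \<mu> then Poly_Mapping.single 0 (c \<mu> v) * ?e \<mu> else 0)"
      unfolding \<psi>_def sum_distrib_right
      by (intro sum.cong) (auto simp: mult.assoc char_idem_idem[OF sub fin _ card] \<mu>
          char_idem_orthogonal[OF sub fin])
    also have "\<dots> = Poly_Mapping.single 0 (c \<mu> v) * ?e \<mu>"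
      using \<mu> by (subst sum.delta[OF fin_chars]) simp
    finally show ?thesis .
  qed
  have inj: "inj \<psi>"
  proof (rule injI)
    fix v w assume eq: "\<psi> v = \<psi> w"
    have "rep_act s \<rho> (?e \<mu>) v = rep_act s \<rho> (?e \<mu>) w" if \<mu>: "\<mu> \<in> chars H" for \<mu>
    proof -
      have "Poly_Mapping.single 0 (c \<mu> v) * ?e \<mu> = Poly_Mapping.single 0 (c \<mu> w) * ?e \<mu>"
        using comp[OF \<mu>] eq by metis
      then have "c \<mu> v = c \<mu> w" using single_0_cancel char_idem_nonzero[OF sub fin \<mu> card] by blast
      then show ?thesis using c[OF \<mu>] by simp
    qed
    then have "rep_act s \<rho> (\<Sum>\<mu>\<in>chars H. ?e \<mu>) v = rep_act s \<rho> (\<Sum>\<mu>\<in>chars H. ?e \<mu>) w"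
      by (simp add: rep_act_sum_left)
    then show "v = w" using split by (simp add: splits_def)
  qed
  have "\<psi> 0 = 0" using \<psi>_add[of 0 0] by simp
  then have "regular_submodule H (range \<psi>)"
    unfolding regular_submodule_def
    using is_subgroupD(1)[OF sub]
    by (auto simp flip: \<psi>_add \<psi>_act intro: range_eqI[of 0 \<psi> 0])
      (auto simp: \<psi>_def intro!: group_alg_sum group_alg_mult[OF sub])
  moreover have "module_iso_regular H s \<rho> (range \<psi>) \<psi>"
    using inj \<psi>_add \<psi>_act by (simp add: module_iso_regular_def bij_betw_def)
  ultimately show ?thesis by blast
qed

section \<open>Incidence algebras\<close>

lemma inc_carrierD: "p \<in> inc_carrier r \<Longrightarrow> k \<notin> r \<Longrightarrow> Poly_Mapping.lookup p k = 0"
  by (auto simp: inc_carrier_def in_keys_iff)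

lemma inc_carrierI: "(\<And>k. k \<notin> r \<Longrightarrow> Poly_Mapping.lookup p k = 0) \<Longrightarrow> p \<in> inc_carrier r"
  by (auto simp: inc_carrier_def in_keys_iff)

lemma inc_carrier_closed:
  "0 \<in> inc_carrier r"
  "p \<in> inc_carrier r \<Longrightarrow> q \<in> inc_carrier r \<Longrightarrow> p + q \<in> inc_carrier r"
  "p \<in> inc_carrier r \<Longrightarrow> q \<in> inc_carrier r \<Longrightarrow> p - q \<in> inc_carrier r"
  "p \<in> inc_carrier r \<Longrightarrow> pm_scale c p \<in> inc_carrier r"
  "k \<in> r \<Longrightarrow> Poly_Mapping.single k c \<in> inc_carrier r"
  by (auto intro!: inc_carrierI simp: inc_carrierD lookup_add lookup_minus lookup_single when_def)

context
  fixes X :: "'x set" and r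
  assumes fin: "finite X" and po: "partial_order_on X r"
begin

lemma r_subset: "r \<subseteq> X \<times> X" and r_refl: "x \<in> X \<Longrightarrow> (x, x) \<in> r"
  and r_trans: "(x, y) \<in> r \<Longrightarrow> (y, z) \<in> r \<Longrightarrow> (x, z) \<in> r"
  and r_antisym: "(x, y) \<in> r \<Longrightarrow> (y, x) \<in> r \<Longrightarrow> x = y"
  using partial_order_onD[OF po] by (auto simp: refl_on_def antisym_def dest: transD)

text \<open>The product is that of matrices indexed by \<open>X\<close>: the sums over supports are
  enlarged to all of \<open>X\<close>, which only adds zero terms.\<close>

lemma lookup_inc_mult:
  fixes p q :: "'x \<times> 'x \<Rightarrow>\<^sub>0 'f::field"
  assumes p: "p \<in> inc_carrier r" and q: "q \<in> inc_carrier r"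
  shows "Poly_Mapping.lookup (inc_mult p q) (x, z)
    = (\<Sum>y\<in>X. Poly_Mapping.lookup p (x, y) * Poly_Mapping.lookup q (y, z))"
proof -
  let ?p = "Poly_Mapping.lookup p" and ?q = "Poly_Mapping.lookup q"
  define t where "t a b = (if snd a = fst b
      then Poly_Mapping.single (fst a, snd b) (?p a * ?q b) else 0)" for a b
  have keys: "Poly_Mapping.keys p \<subseteq> X \<times> X" "Poly_Mapping.keys q \<subseteq> X \<times> X"
    using p q r_subset by (auto simp: inc_carrier_def)
  have "inc_mult p q = (\<Sum>a\<in>Poly_Mapping.keys p. \<Sum>b\<in>Poly_Mapping.keys q. t a b)"
    by (simp only: inc_mult_def t_def case_prod_unfold prod.collapse)
  also have "\<dots> = (\<Sum>a\<in>Poly_Mapping.keys p. \<Sum>b\<in>X \<times> X. t a b)"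
    by (rule sum.cong, simp, rule sum.mono_neutral_left)
      (use fin keys in \<open>auto simp: t_def in_keys_iff\<close>)
  also have "\<dots> = (\<Sum>a\<in>X \<times> X. \<Sum>b\<in>X \<times> X. t a b)"
    by (rule sum.mono_neutral_left)
      (use fin keys in \<open>auto simp: t_def in_keys_iff intro!: sum.neutral\<close>)
  also have "\<dots> = (\<Sum>x'\<in>X. \<Sum>y\<in>X. \<Sum>w\<in>X. \<Sum>z'\<in>X. t (x', y) (w, z'))"
    unfolding sum.cartesian_product' by simp
  finally have "Poly_Mapping.lookup (inc_mult p q) (x, z)
      = (\<Sum>x'\<in>X. \<Sum>y\<in>X. \<Sum>w\<in>X. \<Sum>z'\<in>X. Poly_Mapping.lookup (t (x', y) (w, z')) (x, z))"
    by (simp add: lookup_sum)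
  also have "\<dots> = (\<Sum>x'\<in>X. \<Sum>y\<in>X. \<Sum>w\<in>X. \<Sum>z'\<in>X.
      if z' = z then if w = y then if x' = x then ?p (x, y) * ?q (y, z) else 0 else 0 else 0)"
    by (intro sum.cong) (auto simp: t_def lookup_single when_def)
  also have "\<dots> = (\<Sum>x'\<in>X. \<Sum>y\<in>X. if x' = x \<and> z \<in> X then ?p (x, y) * ?q (y, z) else 0)"
    using fin by (intro sum.cong refl) (auto intro!: sum.neutral)
  also have "\<dots> = (\<Sum>x'\<in>X. if x' = x then \<Sum>y\<in>X. if z \<in> X then ?p (x, y) * ?q (y, z) else 0 else 0)"
    by (intro sum.cong) auto
  also have "\<dots> = (\<Sum>y\<in>X. ?p (x, y) * ?q (y, z))"
  proof -
    have "?p (x, y) = 0" if "x \<notin> X" for y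
      using that r_subset by (intro inc_carrierD[OF p]) auto
    moreover have "?q (y, z) = 0" if "z \<notin> X" for y
      using that r_subset by (intro inc_carrierD[OF q]) auto
    ultimately show ?thesis using fin by (cases "x \<in> X"; cases "z \<in> X") auto
  qed
  finally show ?thesis .
qed

lemma inc_mult_closed:
  assumes "p \<in> inc_carrier r" "q \<in> inc_carrier r"
  shows "inc_mult p q \<in> inc_carrier r"
proof (rule inc_carrierI)
  fix k assume k: "k \<notin> r"
  obtain x z where xz: "k = (x, z)" by force
  have "Poly_Mapping.lookup p (x, y) * Poly_Mapping.lookup q (y, z) = 0" for y
    using inc_carrierD[OF assms(1), of "(x, y)"] inc_carrierD[OF assms(2), of "(y, z)"] r_trans k xz by fastforce
  then show "Poly_Mapping.lookup (inc_mult p q) k = 0"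
    unfolding xz lookup_inc_mult[OF assms] by (intro sum.neutral) simp
qed

text \<open>By antisymmetry only the middle index \<open>y = x\<close> contributes. These
  multiplicative diagonal maps are the source of the characters obtained from an incidence
  algebra.\<close>

lemma lookup_inc_mult_diag:
  assumes "p \<in> inc_carrier r" "q \<in> inc_carrier r"
  shows "Poly_Mapping.lookup (inc_mult p q) (x, x)
    = Poly_Mapping.lookup p (x, x) * Poly_Mapping.lookup q (x, x)"
proof -
  have "Poly_Mapping.lookup (inc_mult p q) (x, x)
      = (\<Sum>y\<in>X. if y = x then Poly_Mapping.lookup p (x, x) * Poly_Mapping.lookup q (x, x) else 0)"
    unfolding lookup_inc_mult[OF assms]
  proof (rule sum.cong)
    fix y
    show "Poly_Mapping.lookup p (x, y) * Poly_Mapping.lookup q (y, x)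
      = (if y = x then Poly_Mapping.lookup p (x, x) * Poly_Mapping.lookup q (x, x) else 0)"
      using inc_carrierD[OF assms(1), of "(x, y)"] inc_carrierD[OF assms(2), of "(y, x)"] r_antisym[of x y]
      by (cases "(x, y) \<in> r"; cases "(y, x) \<in> r") auto
  qed simp
  then show ?thesis using fin inc_carrierD[OF assms(1), of "(x, x)"] r_subset by auto
qed

text \<open>The entry is chosen on an inclusion-minimal interval \<open>[x, z]\<close> among those with
  \<open>p(x, z) \<noteq> 0\<close>, so that every other summand of the convolution at \<open>(x, z)\<close> vanishes.\<close>

lemma inc_minimal_entry:
  fixes p :: "'x \<times> 'x \<Rightarrow>\<^sub>0 'f::field"
  assumes p: "p \<in> inc_carrier r" and "p \<noteq> 0"
  obtains x z where "x \<in> X" "z \<in> X" "Poly_Mapping.lookup p (x, z) \<noteq> 0"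
    "\<And>q. q \<in> inc_carrier r \<Longrightarrow>
      Poly_Mapping.lookup (inc_mult q p) (x, z) = Poly_Mapping.lookup q (x, x) * Poly_Mapping.lookup p (x, z)"
    "\<And>q. q \<in> inc_carrier r \<Longrightarrow>
      Poly_Mapping.lookup (inc_mult p q) (x, z) = Poly_Mapping.lookup p (x, z) * Poly_Mapping.lookup q (z, z)"
proof -
  define I where "I x z = {y. (x, y) \<in> r \<and> (y, z) \<in> r}" for x z
  have finI: "finite (I x z)" for x z
    using finite_subset[of "I x z" X] fin r_subset by (auto simp: I_def)
  define k where "k = arg_min_on (\<lambda>(x, z). card (I x z)) (Poly_Mapping.keys p)"
  obtain x z where xz: "k = (x, z)" by force
  have ne: "Poly_Mapping.keys p \<noteq> {}" using assms(2) by simp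
  have "k \<in> Poly_Mapping.keys p" unfolding k_def by (rule arg_min_if_finite(1)) (use ne in auto)
  then have nz: "Poly_Mapping.lookup p (x, z) \<noteq> 0" by (simp add: xz in_keys_iff)
  then have xzr: "(x, z) \<in> r" using inc_carrierD[OF p] by blast
  have min: "card (I x z) \<le> card (I x' z')" if "Poly_Mapping.lookup p (x', z') \<noteq> 0" for x' z'
    using arg_min_least[OF finite_keys ne, of "(x', z')" "\<lambda>(x, z). card (I x z)"] that
    by (simp add: xz[unfolded k_def] in_keys_iff)
  have X: "x \<in> X" "z \<in> X" using xzr r_subset by auto
  show thesis
  proof (rule that[OF X nz])
    fix q :: "'x \<times> 'x \<Rightarrow>\<^sub>0 'f" assume q: "q \<in> inc_carrier r"
    have "Poly_Mapping.lookup q (x, y) * Poly_Mapping.lookup p (y, z) = 0" if "y \<noteq> x" for y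
    proof (rule ccontr)
      assume "Poly_Mapping.lookup q (x, y) * Poly_Mapping.lookup p (y, z) \<noteq> 0"
      then have xy: "(x, y) \<in> r" and yz: "(y, z) \<in> r" and nz: "Poly_Mapping.lookup p (y, z) \<noteq> 0"
        using inc_carrierD[OF q] inc_carrierD[OF p] by force+
      have "I y z \<subseteq> I x z" using r_trans[OF xy] by (auto simp: I_def)
      moreover have "x \<in> I x z" using xzr r_refl[OF X(1)] by (simp add: I_def)
      moreover have "x \<notin> I y z" using r_antisym[OF xy] that by (auto simp: I_def)
      ultimately have "I y z \<subset> I x z" by blast
      from psubset_card_mono[OF finI this] show False using min[OF nz] by simp
    qed
    then have "Poly_Mapping.lookup (inc_mult q p) (x, z)
        = (\<Sum>y\<in>X. if y = x then Poly_Mapping.lookup q (x, x) * Poly_Mapping.lookup p (x, z) else 0)"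
      unfolding lookup_inc_mult[OF q p] by (intro sum.cong) auto
    then show "Poly_Mapping.lookup (inc_mult q p) (x, z)
        = Poly_Mapping.lookup q (x, x) * Poly_Mapping.lookup p (x, z)" using fin X by simp
  next
    fix q :: "'x \<times> 'x \<Rightarrow>\<^sub>0 'f" assume q: "q \<in> inc_carrier r"
    have "Poly_Mapping.lookup p (x, y) * Poly_Mapping.lookup q (y, z) = 0" if "y \<noteq> z" for y
    proof (rule ccontr)
      assume "Poly_Mapping.lookup p (x, y) * Poly_Mapping.lookup q (y, z) \<noteq> 0"
      then have xy: "(x, y) \<in> r" and yz: "(y, z) \<in> r" and nz: "Poly_Mapping.lookup p (x, y) \<noteq> 0"
        using inc_carrierD[OF q] inc_carrierD[OF p] by force+
      have "I x y \<subseteq> I x z" using r_trans[OF _ yz] by (auto simp: I_def)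
      moreover have "z \<in> I x z" using xzr r_refl[OF X(2)] by (simp add: I_def)
      moreover have "z \<notin> I x y" using r_antisym[OF yz] that by (auto simp: I_def)
      ultimately have "I x y \<subset> I x z" by blast
      from psubset_card_mono[OF finI this] show False using min[OF nz] by simp
    qed
    then have "Poly_Mapping.lookup (inc_mult p q) (x, z)
        = (\<Sum>y\<in>X. if y = z then Poly_Mapping.lookup p (x, z) * Poly_Mapping.lookup q (z, z) else 0)"
      unfolding lookup_inc_mult[OF p q] by (intro sum.cong) auto
    then show "Poly_Mapping.lookup (inc_mult p q) (x, z)
        = Poly_Mapping.lookup p (x, z) * Poly_Mapping.lookup q (z, z)" using fin X by simp
  qed
qed

text \<open>A commutative corner of an incidence algebra meets the kernel of the diagonal maps only in
  \<open>0\<close>: for a minimal nonzero entry \<open>(x, z)\<close> of \<open>a\<close> in the kernel, the corner element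
  \<open>f e\<^sub>x\<^sub>x f\<close> would not commute with \<open>a\<close>.\<close>

lemma commutative_corner_imp_splitting_field:
  fixes j :: "('g::ab_group_add \<Rightarrow>\<^sub>0 'f::field) \<Rightarrow> ('x \<times> 'x \<Rightarrow>\<^sub>0 'f)"
  assumes sub: "is_subgroup H" and finH: "finite H"
    and j_in: "\<And>a. a \<in> group_alg H \<Longrightarrow> j a \<in> inc_carrier r"
    and j_add: "\<And>a b. a \<in> group_alg H \<Longrightarrow> b \<in> group_alg H \<Longrightarrow> j (a + b) = j a + j b"
    and j_scale: "\<And>c a. a \<in> group_alg H \<Longrightarrow> j (pm_scale c a) = pm_scale c (j a)"
    and j_mult: "\<And>a b. a \<in> group_alg H \<Longrightarrow> b \<in> group_alg H \<Longrightarrow> j (a * b) = inc_mult (j a) (j b)"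
    and j_inj: "\<And>a. a \<in> group_alg H \<Longrightarrow> j a = 0 \<Longrightarrow> a = 0"
    and corner: "\<And>q. q \<in> inc_carrier r \<Longrightarrow>
      \<exists>a\<in>group_alg H. inc_mult (inc_mult (j 1) q) (j 1) = j a"
  shows "splitting_field TYPE('f) H"
proof (rule separating_family_imp_splitting_field[OF sub finH])
  let ?\<delta> = "\<lambda>x h. Poly_Mapping.lookup (j (Poly_Mapping.single h 1)) (x, x)"
  have sg: "Poly_Mapping.single h c \<in> group_alg H" if "h \<in> H" for h and c :: 'f using that by simp
  show "?\<delta> x (h + k) = ?\<delta> x h * ?\<delta> x k" if "h \<in> H" "k \<in> H" for x h k
    using j_mult[OF sg[OF that(1)] sg[OF that(2)], of 1 1]
      lookup_inc_mult_diag[OF j_in[OF sg[OF that(1)]] j_in[OF sg[OF that(2)]]]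
    by (simp add: mult_single)
  have j0: "j 0 = 0" using j_add[of 0 0] by simp
  have ev: "a \<in> group_alg H \<Longrightarrow> ev (?\<delta> x) a = Poly_Mapping.lookup (j a) (x, x)" for a x
  proof -
    assume "a \<in> group_alg H"
    \<comment> \<open>Membership is carried through the induction because additivity of
      \<open>j\<close> is known on \<open>group_alg H\<close> only.\<close>
    then have "a \<in> group_alg H \<and> ev (?\<delta> x) a = Poly_Mapping.lookup (j a) (x, x)"
    proof (induction rule: group_alg_induct)
      case (single h c)
      then show ?case
        using j_scale[OF sg[OF single, of 1], of c] by (simp add: pm_scale_conv mult_single)
    next
      case (add a b)
      then show ?case by (simp add: ev_add j_add lookup_add)
    qed (simp add: j0)
    then show ?thesis by blast
  qed
  have one: "1 \<in> group_alg H" by (rule group_alg_one[OF sub])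
  fix a assume a: "a \<in> group_alg H" and diag: "\<And>x. x \<in> X \<Longrightarrow> ev (?\<delta> x) a = 0"
  show "a = 0"
  proof (rule ccontr)
    assume "a \<noteq> 0"
    let ?p = "j a"
    have "?p \<noteq> 0" using j_inj[OF a] \<open>a \<noteq> 0\<close> by blast
    then obtain x z where xz: "x \<in> X" "z \<in> X" and nz: "Poly_Mapping.lookup ?p (x, z) \<noteq> 0"
      and left: "\<And>q. q \<in> inc_carrier r \<Longrightarrow>
        Poly_Mapping.lookup (inc_mult q ?p) (x, z) = Poly_Mapping.lookup q (x, x) * Poly_Mapping.lookup ?p (x, z)"
      and right: "\<And>q. q \<in> inc_carrier r \<Longrightarrow>
        Poly_Mapping.lookup (inc_mult ?p q) (x, z) = Poly_Mapping.lookup ?p (x, z) * Poly_Mapping.lookup q (z, z)"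
      using inc_minimal_entry[OF j_in[OF a]] by metis
    have "x \<noteq> z" using diag[OF xz(1)] ev[OF a] nz by auto
    \<comment> \<open>\<open>j 1\<close> is a two-sided identity for \<open>?p\<close>; reading this
      at the minimal entry gives the two diagonal values.\<close>
    have f: "Poly_Mapping.lookup (j 1) (x, x) = 1" "Poly_Mapping.lookup (j 1) (z, z) = 1"
      using left[OF j_in[OF one]] right[OF j_in[OF one]] j_mult[OF one a] j_mult[OF a one] nz by auto
    let ?s = "Poly_Mapping.single (x, x) (1::'f)"
    have s: "?s \<in> inc_carrier r" using r_refl[OF xz(1)] by (rule inc_carrier_closed(5))
    obtain b where b: "b \<in> group_alg H" "inc_mult (inc_mult (j 1) ?s) (j 1) = j b"
      using corner[OF s] by blast
    have jb: "Poly_Mapping.lookup (j b) (y, y)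
        = Poly_Mapping.lookup (j 1) (y, y) * Poly_Mapping.lookup ?s (y, y) * Poly_Mapping.lookup (j 1) (y, y)" for y
      unfolding b(2)[symmetric] using j_in[OF one] s
      by (simp add: lookup_inc_mult_diag inc_mult_closed)
    \<comment> \<open>At \<open>(x, z)\<close> the left product has the entry of \<open>?p\<close>,
      as \<open>j b\<close> is \<open>1\<close> at \<open>(x, x)\<close>, while the right product
      has \<open>0\<close>, as \<open>j b\<close> is \<open>0\<close> at
      \<open>(z, z)\<close>.\<close>
    have "inc_mult (j b) ?p = inc_mult ?p (j b)"
      using j_mult[OF a b(1)] j_mult[OF b(1) a] by (simp add: mult.commute)
    then show False
      using left[OF j_in[OF b(1)]] right[OF j_in[OF b(1)]] nz \<open>x \<noteq> z\<close> f
      by (simp add: jb lookup_single when_def)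
  qed
qed

text \<open>Compress the matrix unit at \<open>(x, x)\<close> to the corner, giving \<open>c\<close>
  times \<open>f\<close>. The diagonal entry at \<open>y \<noteq> x\<close> forces
  \<open>c = 0\<close>, the one at \<open>x\<close> forces \<open>c \<noteq> 0\<close>.\<close>

lemma rank_one_corner_diag_unique:
  fixes f :: "'x \<times> 'x \<Rightarrow>\<^sub>0 'f::field"
  assumes f: "f \<in> inc_carrier r"
    and corner: "\<And>q. q \<in> inc_carrier r \<Longrightarrow> \<exists>c. inc_mult (inc_mult f q) f = pm_scale c f"
    and x: "x \<in> X" "Poly_Mapping.lookup f (x, x) \<noteq> 0" and y: "Poly_Mapping.lookup f (y, y) \<noteq> 0"
  shows "x = y"
proof (rule ccontr)
  assume "x \<noteq> y"
  let ?s = "Poly_Mapping.single (x, x) (1::'f)"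
  have s: "?s \<in> inc_carrier r" using r_refl[OF x(1)] by (rule inc_carrier_closed(5))
  obtain c where "inc_mult (inc_mult f ?s) f = pm_scale c f" using corner[OF s] by blast
  then have eq: "Poly_Mapping.lookup (inc_mult (inc_mult f ?s) f) (w, w) = c * Poly_Mapping.lookup f (w, w)" for w
    by simp
  have "Poly_Mapping.lookup f (w, w) * Poly_Mapping.lookup ?s (w, w) * Poly_Mapping.lookup f (w, w)
      = c * Poly_Mapping.lookup f (w, w)" for w
    using eq[of w] unfolding lookup_inc_mult_diag[OF inc_mult_closed[OF f s] f] lookup_inc_mult_diag[OF f s] .
  from this[of x] this[of y] show False
    using x y \<open>x \<noteq> y\<close> by (simp add: lookup_single when_def)
qed

text \<open>A minimal entry of a nonzero element of \<open>W\<close> lies where \<open>f\<close> and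
  \<open>g\<close> have nonzero diagonal entries, and by uniqueness this is one fixed position.
  Subtracting the multiple of \<open>p0\<close> that cancels the entry there leaves zero.\<close>

lemma peirce_component_rank_one:
  fixes f g p p0 :: "'x \<times> 'x \<Rightarrow>\<^sub>0 'f::field"
  assumes f: "f \<in> inc_carrier r" and g: "g \<in> inc_carrier r"
    and fdiag: "\<And>x y. x \<in> X \<Longrightarrow> Poly_Mapping.lookup f (x, x) \<noteq> 0 \<Longrightarrow> Poly_Mapping.lookup f (y, y) \<noteq> 0 \<Longrightarrow> x = y"
    and gdiag: "\<And>x y. x \<in> X \<Longrightarrow> Poly_Mapping.lookup g (x, x) \<noteq> 0 \<Longrightarrow> Poly_Mapping.lookup g (y, y) \<noteq> 0 \<Longrightarrow> x = y"
    and W: "\<And>p q c. p \<in> W \<Longrightarrow> q \<in> W \<Longrightarrow> p - pm_scale c q \<in> W" "W \<subseteq> inc_carrier r"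
    and fg: "\<And>p. p \<in> W \<Longrightarrow> inc_mult f p = p" "\<And>p. p \<in> W \<Longrightarrow> inc_mult p g = p"
    and p0: "p0 \<in> W" "p0 \<noteq> 0" and p: "p \<in> W"
  shows "\<exists>c. p = pm_scale c p0"
proof -
  have entry: "\<exists>x z. x \<in> X \<and> z \<in> X \<and> Poly_Mapping.lookup p (x, z) \<noteq> 0
      \<and> Poly_Mapping.lookup f (x, x) \<noteq> 0 \<and> Poly_Mapping.lookup g (z, z) \<noteq> 0"
    if p: "p \<in> W" "p \<noteq> 0" for p
  proof -
    have "p \<in> inc_carrier r" using p W by blast
    from inc_minimal_entry[OF this p(2)]
    show ?thesis using f g fg[OF p(1)] by (metis mult_zero_left mult_zero_right)
  qed
  obtain x z where xz: "x \<in> X" "z \<in> X" "Poly_Mapping.lookup p0 (x, z) \<noteq> 0"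
    "Poly_Mapping.lookup f (x, x) \<noteq> 0" "Poly_Mapping.lookup g (z, z) \<noteq> 0"
    using entry[OF p0] by blast
  define c where "c = Poly_Mapping.lookup p (x, z) / Poly_Mapping.lookup p0 (x, z)"
  have "p - pm_scale c p0 = 0"
  proof (rule ccontr)
    assume "p - pm_scale c p0 \<noteq> 0"
    then obtain x' z' where "x' \<in> X" "z' \<in> X" "Poly_Mapping.lookup (p - pm_scale c p0) (x', z') \<noteq> 0"
      "Poly_Mapping.lookup f (x', x') \<noteq> 0" "Poly_Mapping.lookup g (z', z') \<noteq> 0"
      using entry[OF W(1)[OF p p0(1)]] by blast
    then have "Poly_Mapping.lookup (p - pm_scale c p0) (x, z) \<noteq> 0" using fdiag gdiag xz by metis
    then show False using xz(3) by (simp add: c_def lookup_minus)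
  qed
  then show ?thesis by auto
qed

end

section \<open>From an incidence algebra to splitting fields and components of rank one\<close>

context graded_bimodule
begin

lemma lact_scale: "0 \<in> H1 \<Longrightarrow> a \<in> group_alg H1 \<Longrightarrow> lact a (s c m) = s c (lact a m)"
  using lact_mult[of a "Poly_Mapping.single 0 c" m] lact_mult[of "Poly_Mapping.single 0 c" a m]
  by (simp add: lact_scalar mult.commute)

lemma ract_scale: "0 \<in> H1 \<Longrightarrow> b \<in> group_alg H2 \<Longrightarrow> ract (s c m) b = s c (ract m b)"
  using lact_ract[of "Poly_Mapping.single 0 c" b m] by (simp add: lact_scalar)

text \<open>The corners of the images of \<open>(1, 0, 0)\<close> and \<open>(0, 0, 1)\<close> are
  the two commutative group algebras. The corners of \<open>?f\<close> and \<open>?g\<close> are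
  lines by \<open>char_idem_mult\<close>, so \<open>peirce_component_rank_one\<close> applies to
  \<open>W\<close>, the image of the component of \<open>M\<close>.\<close>

lemma incidence_imp_split:
  fixes \<theta> :: "_ \<Rightarrow> ('x \<times> 'x \<Rightarrow>\<^sub>0 'f)"
  assumes sub1: "is_subgroup H1" and fin1: "finite H1" and sub2: "is_subgroup H2" and fin2: "finite H2"
    and fin: "finite X" and po: "partial_order_on X r"
    and iso: "graded_algebra_iso (tri_scale s) (tri_carrier H1 H2) (tri_mult lact ract) \<Gamma>
      pm_scale (inc_carrier r) inc_mult \<Gamma>' \<theta>"
  shows "splitting_field TYPE('f) H1" "splitting_field TYPE('f) H2"
    "\<chi> \<in> chars H1 \<Longrightarrow> \<eta> \<in> chars H2 \<Longrightarrow>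
      \<exists>u. \<forall>m. \<exists>c. ract (lact (char_idem H1 \<chi>) m) (char_idem H2 \<eta>) = s c u"
proof -
  let ?A = "tri_carrier H1 H2 :: (('g \<Rightarrow>\<^sub>0 'f) \<times> 'm \<times> ('g \<Rightarrow>\<^sub>0 'f)) set"
  have A [simp]: "(a, m, b) \<in> ?A \<longleftrightarrow> a \<in> group_alg H1 \<and> b \<in> group_alg H2" for a m b
    by (auto simp: tri_carrier_def)
  have bij: "bij_betw \<theta> ?A (inc_carrier r)"
    and add: "\<And>x y. x \<in> ?A \<Longrightarrow> y \<in> ?A \<Longrightarrow> \<theta> (x + y) = \<theta> x + \<theta> y"
    and scale: "\<And>c x. x \<in> ?A \<Longrightarrow> \<theta> (tri_scale s c x) = pm_scale c (\<theta> x)"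
    and mult: "\<And>x y. x \<in> ?A \<Longrightarrow> y \<in> ?A \<Longrightarrow> \<theta> (tri_mult lact ract x y) = inc_mult (\<theta> x) (\<theta> y)"
    using iso by (auto simp: graded_algebra_iso_def)
  have \<theta>_in: "x \<in> ?A \<Longrightarrow> \<theta> x \<in> inc_carrier r" for x using bij by (auto simp: bij_betw_def)
  have inj: "x \<in> ?A \<Longrightarrow> y \<in> ?A \<Longrightarrow> \<theta> x = \<theta> y \<Longrightarrow> x = y" for x y
    using bij by (auto simp: bij_betw_def inj_on_def)
  have surj: "\<exists>a m b. a \<in> group_alg H1 \<and> b \<in> group_alg H2 \<and> q = \<theta> (a, m, b)" if "q \<in> inc_carrier r" for q
  proof -
    have "q \<in> \<theta> ` ?A" using bij that by (simp add: bij_betw_def)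
    then show ?thesis by (auto simp: tri_carrier_def)
  qed
  have z: "(0, 0, 0) \<in> ?A" by simp
  have \<theta>0: "\<theta> (0, 0, 0) = 0" using add[OF z z] by simp
  have one: "(1 :: 'g \<Rightarrow>\<^sub>0 'f) \<in> group_alg H1" "(1 :: 'g \<Rightarrow>\<^sub>0 'f) \<in> group_alg H2" by (simp_all add: group_alg_one sub1 sub2)
  note gm = group_alg_mult[OF sub1] group_alg_mult[OF sub2]
  show sf1: "splitting_field TYPE('f) H1"
  proof (rule commutative_corner_imp_splitting_field[OF fin po sub1 fin1, of "\<lambda>a. \<theta> (a, 0, 0)"])
    fix a b :: "'g \<Rightarrow>\<^sub>0 'f" and c
    assume a: "a \<in> group_alg H1"
    then show "\<theta> (a, 0, 0) \<in> inc_carrier r" by (simp add: \<theta>_in)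
    show "\<theta> (pm_scale c a, 0, 0) = pm_scale c (\<theta> (a, 0, 0))"
      using scale[of "(a, 0, 0)" c] a by (simp add: pm_scale_conv)
    show "a = 0" if "\<theta> (a, 0, 0) = 0" using inj[of "(a, 0, 0)" "(0, 0, 0)"] that a \<theta>0 by simp
    assume b: "b \<in> group_alg H1"
    then show "\<theta> (a + b, 0, 0) = \<theta> (a, 0, 0) + \<theta> (b, 0, 0)"
      using add[of "(a, 0, 0)" "(b, 0, 0)"] a by simp
    show "\<theta> (a * b, 0, 0) = inc_mult (\<theta> (a, 0, 0)) (\<theta> (b, 0, 0))"
      using mult[of "(a, 0, 0)" "(b, 0, 0)"] a b by simp
  next
    fix q :: "'x \<times> 'x \<Rightarrow>\<^sub>0 'f" assume "q \<in> inc_carrier r"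
    then obtain a m b where q: "a \<in> group_alg H1" "b \<in> group_alg H2" "q = \<theta> (a, m, b)" using surj by blast
    then have "inc_mult (inc_mult (\<theta> (1, 0, 0)) q) (\<theta> (1, 0, 0)) = \<theta> (a, 0, 0)"
      using one by (simp add: mult[symmetric])
    then show "\<exists>a\<in>group_alg H1. inc_mult (inc_mult (\<theta> (1, 0, 0)) q) (\<theta> (1, 0, 0)) = \<theta> (a, 0, 0)"
      using q(1) by blast
  qed
  show sf2: "splitting_field TYPE('f) H2"
  proof (rule commutative_corner_imp_splitting_field[OF fin po sub2 fin2, of "\<lambda>a. \<theta> (0, 0, a)"])
    fix a b :: "'g \<Rightarrow>\<^sub>0 'f" and c
    assume a: "a \<in> group_alg H2"
    then show "\<theta> (0, 0, a) \<in> inc_carrier r" by (simp add: \<theta>_in)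
    show "\<theta> (0, 0, pm_scale c a) = pm_scale c (\<theta> (0, 0, a))"
      using scale[of "(0, 0, a)" c] a by (simp add: pm_scale_conv)
    show "a = 0" if "\<theta> (0, 0, a) = 0" using inj[of "(0, 0, a)" "(0, 0, 0)"] that a \<theta>0 by simp
    assume b: "b \<in> group_alg H2"
    then show "\<theta> (0, 0, a + b) = \<theta> (0, 0, a) + \<theta> (0, 0, b)"
      using add[of "(0, 0, a)" "(0, 0, b)"] a by simp
    show "\<theta> (0, 0, a * b) = inc_mult (\<theta> (0, 0, a)) (\<theta> (0, 0, b))"
      using mult[of "(0, 0, a)" "(0, 0, b)"] a b by simp
  next
    fix q :: "'x \<times> 'x \<Rightarrow>\<^sub>0 'f" assume "q \<in> inc_carrier r"
    then obtain a m b where q: "a \<in> group_alg H1" "b \<in> group_alg H2" "q = \<theta> (a, m, b)" using surj by blast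
    then have "inc_mult (inc_mult (\<theta> (0, 0, 1)) q) (\<theta> (0, 0, 1)) = \<theta> (0, 0, b)"
      using one by (simp add: mult[symmetric])
    then show "\<exists>a\<in>group_alg H2. inc_mult (inc_mult (\<theta> (0, 0, 1)) q) (\<theta> (0, 0, 1)) = \<theta> (0, 0, a)"
      using q(2) by blast
  qed
  assume \<chi>: "\<chi> \<in> chars H1" and \<eta>: "\<eta> \<in> chars H2"
  have card: "of_nat (card H1) \<noteq> (0::'f)" "of_nat (card H2) \<noteq> (0::'f)"
    using sf1 sf2 by (auto simp: splitting_field_def of_nat_eq_0_iff_char_dvd)
  let ?e = "char_idem H1 \<chi>" and ?d = "char_idem H2 \<eta>"
  let ?comp = "\<lambda>m. ract (lact ?e m) ?d"
  let ?f = "\<theta> (?e, 0, 0)" and ?g = "\<theta> (0, 0, ?d)"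
  have idem: "?e * ?e = ?e" "?d * ?d = ?d"
    using char_idem_idem[OF sub1 fin1 \<chi> card(1)] char_idem_idem[OF sub2 fin2 \<eta> card(2)] by auto
  define W where "W = (\<lambda>m. \<theta> (0, ?comp m, 0)) ` UNIV"
  have f: "?f \<in> inc_carrier r" and g: "?g \<in> inc_carrier r" by (simp_all add: \<theta>_in)
  have fq: "\<exists>c. inc_mult (inc_mult ?f q) ?f = pm_scale c ?f" if q: "q \<in> inc_carrier r" for q
  proof -
    obtain a m b where q: "a \<in> group_alg H1" "b \<in> group_alg H2" "q = \<theta> (a, m, b)" using surj[OF q] by blast
    have "inc_mult (inc_mult ?f q) ?f = \<theta> (?e * a * ?e, 0, 0)"
      using q by (simp add: mult[symmetric] gm)
    also have "?e * a * ?e = pm_scale (ev \<chi> (?e * a)) ?e"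
      using char_idem_mult[OF sub1 fin1 \<chi> gm(1)[OF char_idem_in q(1)]] by (simp add: pm_scale_conv)
    also have "\<theta> (pm_scale (ev \<chi> (?e * a)) ?e, 0, 0) = pm_scale (ev \<chi> (?e * a)) ?f"
      using scale[of "(?e, 0, 0)" "ev \<chi> (?e * a)"] by (simp add: pm_scale_conv)
    finally show ?thesis by blast
  qed
  have gq: "\<exists>c. inc_mult (inc_mult ?g q) ?g = pm_scale c ?g" if q: "q \<in> inc_carrier r" for q
  proof -
    obtain a m b where q: "a \<in> group_alg H1" "b \<in> group_alg H2" "q = \<theta> (a, m, b)" using surj[OF q] by blast
    have "inc_mult (inc_mult ?g q) ?g = \<theta> (0, 0, ?d * b * ?d)"
      using q by (simp add: mult[symmetric] gm)
    also have "?d * b * ?d = pm_scale (ev \<eta> (?d * b)) ?d"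
      using char_idem_mult[OF sub2 fin2 \<eta> gm(2)[OF char_idem_in q(2)]] by (simp add: pm_scale_conv)
    also have "\<theta> (0, 0, pm_scale (ev \<eta> (?d * b)) ?d) = pm_scale (ev \<eta> (?d * b)) ?g"
      using scale[of "(0, 0, ?d)" "ev \<eta> (?d * b)"] by (simp add: pm_scale_conv)
    finally show ?thesis by blast
  qed
  have comp_scale: "?comp (s c m) = s c (?comp m)" for c m
    by (simp add: lact_scale[OF is_subgroupD(1)[OF sub1]] ract_scale[OF is_subgroupD(1)[OF sub1]])
  have W_in: "W \<subseteq> inc_carrier r" by (auto simp: W_def \<theta>_in)
  have W_diff: "p - pm_scale c q \<in> W" if "p \<in> W" "q \<in> W" for p q c
  proof -
    obtain m n where mn: "p = \<theta> (0, ?comp m, 0)" "q = \<theta> (0, ?comp n, 0)" using \<open>p \<in> W\<close> \<open>q \<in> W\<close> by (auto simp: W_def)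
    have "\<theta> (0, ?comp (m - s c n), 0) + pm_scale c q = \<theta> (0, ?comp (m - s c n), 0) + \<theta> (0, ?comp (s c n), 0)"
      using scale[of "(0, ?comp n, 0)" c] by (simp add: mn comp_scale pm_scale_conv)
    also have "\<dots> = p"
      using add[of "(0, ?comp (m - s c n), 0)" "(0, ?comp (s c n), 0)"]
      by (simp add: mn lact_diff_right ract_diff_left)
    finally have "p - pm_scale c q = \<theta> (0, ?comp (m - s c n), 0)" by (simp add: diff_eq_eq)
    then show ?thesis by (auto simp: W_def)
  qed
  have fp: "inc_mult ?f p = p" and pg: "inc_mult p ?g = p" if "p \<in> W" for p
  proof -
    obtain m where m: "p = \<theta> (0, ?comp m, 0)" using \<open>p \<in> W\<close> by (auto simp: W_def)
    have "lact ?e (?comp m) = ?comp m"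
      using lact_mult[of ?e ?e "ract m ?d"] by (simp add: lact_ract idem)
    then show "inc_mult ?f p = p" by (simp add: m mult[symmetric])
    have "ract (?comp m) ?d = ?comp m"
      using ract_mult[of ?d ?d "lact ?e m"] by (simp add: idem)
    then show "inc_mult p ?g = p" by (simp add: m mult[symmetric])
  qed
  show "\<exists>u. \<forall>m. \<exists>c. ?comp m = s c u"
  proof (cases "\<exists>m. ?comp m \<noteq> 0")
    case True
    then obtain m0 where m0: "?comp m0 \<noteq> 0" by blast
    have "\<exists>c. ?comp m = s c (?comp m0)" for m
    proof -
      have "\<theta> (0, ?comp m0, 0) \<noteq> 0" using inj[of "(0, ?comp m0, 0)" "(0, 0, 0)"] m0 \<theta>0 by auto
      then obtain c where "\<theta> (0, ?comp m, 0) = pm_scale c (\<theta> (0, ?comp m0, 0))"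
        using peirce_component_rank_one[OF fin po f g
            rank_one_corner_diag_unique[OF fin po f fq] rank_one_corner_diag_unique[OF fin po g gq]
            W_diff W_in fp pg, of "\<theta> (0, ?comp m0, 0)" "\<theta> (0, ?comp m, 0)"]
        by (auto simp: W_def)
      also have "\<dots> = \<theta> (0, s c (?comp m0), 0)"
        using scale[of "(0, ?comp m0, 0)" c] by (simp add: pm_scale_conv)
      finally have "?comp m = s c (?comp m0)" 
        using inj[of "(0, ?comp m, 0)" "(0, s c (?comp m0), 0)"] by simp
      then show ?thesis by blast
    qed
    then show ?thesis by blast
  next
    case False
    then show ?thesis by (intro exI[of _ 0]) simp
  qed
qed

end

section \<open>Recognising and grading incidence algebras\<close>

lemma vector_space_pm_scale: "vector_space (pm_scale :: 'f::field \<Rightarrow> ('k \<Rightarrow>\<^sub>0 'f) \<Rightarrow> _)"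
  by unfold_locales (auto intro!: poly_mapping_eqI simp: lookup_add algebra_simps)

lemma lookup_map_zero: "f 0 = 0 \<Longrightarrow> Poly_Mapping.lookup (Poly_Mapping.map f p) k = f (Poly_Mapping.lookup p k)"
  by transfer (auto simp: when_def)

lemma sum_keys_superset':
  assumes "finite S" "Poly_Mapping.keys p \<subseteq> S"
  shows "(\<Sum>g\<in>Poly_Mapping.keys p. Poly_Mapping.lookup p g) = (\<Sum>g\<in>S. Poly_Mapping.lookup p g)"
  using sum_keys_superset[OF assms, of "\<lambda>_ x. x"] by simp

lemma keys_map_subset: "f 0 = 0 \<Longrightarrow> Poly_Mapping.keys (Poly_Mapping.map f p) \<subseteq> Poly_Mapping.keys p"
  by (auto simp: in_keys_iff lookup_map_zero) 

lemma sum_keys_map: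
  assumes f0: "f 0 = 0" and "finite S" "Poly_Mapping.keys p \<subseteq> S"
  shows "(\<Sum>g\<in>Poly_Mapping.keys (Poly_Mapping.map f p). Poly_Mapping.lookup (Poly_Mapping.map f p) g)
    = (\<Sum>g\<in>S. f (Poly_Mapping.lookup p g))"
  using sum_keys_superset'[of S "Poly_Mapping.map f p"] keys_map_subset[of f p] assms
  by (auto simp: lookup_map_zero)

text \<open>Decompositions correspond by applying \<open>\<theta>\<close> or its inverse to each
  component. Both maps fix \<open>0\<close>, so finite support is preserved and
  \<open>Poly_Mapping.map\<close> acts as expected.\<close>

lemma graded_space_bij:
  fixes s :: "'f::field \<Rightarrow> 'a::ab_group_add \<Rightarrow> 'a" and s' :: "'f \<Rightarrow> 'b::ab_group_add \<Rightarrow> 'b"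
  assumes vs: "vector_space s" "vector_space s'"
    and A: "0 \<in> A" "\<And>x y. x \<in> A \<Longrightarrow> y \<in> A \<Longrightarrow> x + y \<in> A"
    and B: "\<And>x y. x \<in> B \<Longrightarrow> y \<in> B \<Longrightarrow> x + y \<in> B"
    and bij: "bij_betw \<theta> A B"
    and add: "\<And>x y. x \<in> A \<Longrightarrow> y \<in> A \<Longrightarrow> \<theta> (x + y) = \<theta> x + \<theta> y"
    and scale: "\<And>c x. x \<in> A \<Longrightarrow> \<theta> (s c x) = s' c (\<theta> x)"
    and gr: "graded_space s A \<Gamma>"
  shows "graded_space s' B (\<lambda>g. \<theta> ` \<Gamma> g)"
proof -
  interpret V: vector_space s by fact
  interpret V': vector_space s' by fact
  have \<theta>0: "\<theta> 0 = 0" using add[OF A(1) A(1)] by simp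
  define \<kappa> where "\<kappa> = inv_into A \<theta>"
  have \<kappa>: "\<And>x. x \<in> A \<Longrightarrow> \<kappa> (\<theta> x) = x" "\<And>y. y \<in> B \<Longrightarrow> \<theta> (\<kappa> y) = y" "\<And>y. y \<in> B \<Longrightarrow> \<kappa> y \<in> A"
    using bij unfolding \<kappa>_def by (auto simp: bij_betw_def inv_into_f_f f_inv_into_f inv_into_into)
  have sub: "V.subspace (\<Gamma> g)" "\<Gamma> g \<subseteq> A" for g using gr by (auto simp: graded_space_def)
  have sum: "\<theta> (\<Sum>g\<in>S. f g) = (\<Sum>g\<in>S. \<theta> (f g)) \<and> (\<Sum>g\<in>S. f g) \<in> A" if "\<And>g. f g \<in> A" for S and f :: "'c \<Rightarrow> 'a"
    by (induction S rule: infinite_finite_induct) (auto simp: add that \<theta>0 A)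
  have \<kappa>0: "\<kappa> 0 = 0" using \<kappa>(1)[OF A(1)] \<theta>0 by simp
  show ?thesis
    unfolding graded_space_def
  proof (intro conjI allI ballI)
    fix g
    show "V'.subspace (\<theta> ` \<Gamma> g)"
    proof (rule V'.subspaceI)
      show "0 \<in> \<theta> ` \<Gamma> g" using \<theta>0 V.subspace_0[OF sub(1)] by (metis imageI)
      show "x + y \<in> \<theta> ` \<Gamma> g" if "x \<in> \<theta> ` \<Gamma> g" "y \<in> \<theta> ` \<Gamma> g" for x y
        using that add sub(2) V.subspace_add[OF sub(1)] by (auto simp: subset_iff) (metis image_eqI)
      show "s' c x \<in> \<theta> ` \<Gamma> g" if "x \<in> \<theta> ` \<Gamma> g" for c x
        using that scale sub(2) V.subspace_scale[OF sub(1)] by (auto simp: subset_iff) (metis image_eqI)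
    qed
    show "\<theta> ` \<Gamma> g \<subseteq> B" using sub(2) bij by (auto simp: bij_betw_def)
  next
    fix y assume y: "y \<in> B"
    have "\<kappa> y \<in> A" by (rule \<kappa>(3)[OF y])
    then have ex1: "\<exists>!p :: 'c \<Rightarrow>\<^sub>0 'a. (\<forall>g. Poly_Mapping.lookup p g \<in> \<Gamma> g) \<and>
        \<kappa> y = (\<Sum>g\<in>Poly_Mapping.keys p. Poly_Mapping.lookup p g)"
      using gr by (auto simp: graded_space_def)
    then obtain p :: "'c \<Rightarrow>\<^sub>0 'a" where p: "\<And>g. Poly_Mapping.lookup p g \<in> \<Gamma> g"
      "\<kappa> y = (\<Sum>g\<in>Poly_Mapping.keys p. Poly_Mapping.lookup p g)" by blast
    show "\<exists>!p :: 'c \<Rightarrow>\<^sub>0 'b. (\<forall>g. Poly_Mapping.lookup p g \<in> \<theta> ` \<Gamma> g) \<and>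
        y = (\<Sum>g\<in>Poly_Mapping.keys p. Poly_Mapping.lookup p g)"
    proof (rule ex1I[of _ "Poly_Mapping.map \<theta> p"])
      have "y = \<theta> (\<Sum>g\<in>Poly_Mapping.keys p. Poly_Mapping.lookup p g)" using \<kappa>(2)[OF y] p(2) by simp
      also have "\<dots> = (\<Sum>g\<in>Poly_Mapping.keys p. \<theta> (Poly_Mapping.lookup p g))"
        using sum[of "Poly_Mapping.lookup p"] p(1) sub(2) by blast
      also have "\<dots> = (\<Sum>g\<in>Poly_Mapping.keys (Poly_Mapping.map \<theta> p). Poly_Mapping.lookup (Poly_Mapping.map \<theta> p) g)"
        by (rule sum_keys_map[of \<theta>, OF \<theta>0 _ order_refl, symmetric]) simp
      finally show "(\<forall>g. Poly_Mapping.lookup (Poly_Mapping.map \<theta> p) g \<in> \<theta> ` \<Gamma> g) \<and>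
        y = (\<Sum>g\<in>Poly_Mapping.keys (Poly_Mapping.map \<theta> p). Poly_Mapping.lookup (Poly_Mapping.map \<theta> p) g)"
        using p(1) by (auto simp: lookup_map_zero[of \<theta>, OF \<theta>0])
    next
      fix q :: "'c \<Rightarrow>\<^sub>0 'b"
      assume q: "(\<forall>g. Poly_Mapping.lookup q g \<in> \<theta> ` \<Gamma> g) \<and>
        y = (\<Sum>g\<in>Poly_Mapping.keys q. Poly_Mapping.lookup q g)"
      let ?q = "Poly_Mapping.map \<kappa> q"
      have q\<Gamma>: "\<kappa> (Poly_Mapping.lookup q g) \<in> \<Gamma> g" for g
        using q sub(2) \<kappa>(1) by (metis imageE subsetD)
      have \<theta>\<kappa>: "\<theta> (\<kappa> (Poly_Mapping.lookup q g)) = Poly_Mapping.lookup q g" for g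
        using q sub(2) \<kappa>(1) by (metis imageE subsetD)
      have "y = (\<Sum>g\<in>Poly_Mapping.keys q. \<theta> (\<kappa> (Poly_Mapping.lookup q g)))" using q \<theta>\<kappa> by simp
      also have "\<dots> = \<theta> (\<Sum>g\<in>Poly_Mapping.keys q. \<kappa> (Poly_Mapping.lookup q g))"
        using sum[of "\<lambda>g. \<kappa> (Poly_Mapping.lookup q g)"] q\<Gamma> sub(2) by (metis subsetD)
      finally have "\<kappa> y = (\<Sum>g\<in>Poly_Mapping.keys q. \<kappa> (Poly_Mapping.lookup q g))"
        using \<kappa>(1) sum[of "\<lambda>g. \<kappa> (Poly_Mapping.lookup q g)"] q\<Gamma> sub(2) by (metis subsetD)
      then have "?q = p"
        using ex1 p q\<Gamma> sum_keys_map[of \<kappa> _ q, OF \<kappa>0 finite_keys order_refl]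
        by (metis (no_types, lifting) \<kappa>0 lookup_map_zero)
      then show "q = Poly_Mapping.map \<theta> p"
        using \<theta>\<kappa> by (intro poly_mapping_eqI) (auto simp: lookup_map_zero \<theta>0 \<kappa>0)
    qed
  qed
qed

text \<open>Elements of degree \<open>g\<close> are monomials at \<open>g\<close>, so the component
  of degree \<open>g\<close> of a decomposition must be the monomial of \<open>a\<close> at
  \<open>g\<close>.\<close>

lemma graded_space_group_alg:
  "graded_space (pm_scale :: 'f::field \<Rightarrow> _) (group_alg H :: ('g \<Rightarrow>\<^sub>0 'f) set) (group_alg_comp H)"
proof -
  interpret V: vector_space "pm_scale :: 'f \<Rightarrow> ('g \<Rightarrow>\<^sub>0 'f) \<Rightarrow> _" by (rule vector_space_pm_scale)
  have comp: "a \<in> group_alg_comp H g \<longleftrightarrow> a = Poly_Mapping.single g (Poly_Mapping.lookup a g)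
      \<and> (g \<notin> H \<longrightarrow> Poly_Mapping.lookup a g = 0)" for g and a :: "'g \<Rightarrow>\<^sub>0 'f"
  proof
    assume "a \<in> group_alg_comp H g"
    then show "a = Poly_Mapping.single g (Poly_Mapping.lookup a g) \<and> (g \<notin> H \<longrightarrow> Poly_Mapping.lookup a g = 0)"
      by (auto simp: group_alg_comp_def group_alg_def lookup_single when_def in_keys_iff
          intro!: poly_mapping_eqI)
  next
    assume "a = Poly_Mapping.single g (Poly_Mapping.lookup a g) \<and> (g \<notin> H \<longrightarrow> Poly_Mapping.lookup a g = 0)"
    moreover have "Poly_Mapping.keys (Poly_Mapping.single g c) \<subseteq> (if c = 0 then {} else {g})" for c :: 'f by simp
    ultimately show "a \<in> group_alg_comp H g"
      unfolding group_alg_comp_def group_alg_def by (smt (verit) empty_subsetI insert_subset mem_Collect_eq order_trans)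
  qed
  show ?thesis
    unfolding graded_space_def
  proof (intro conjI allI ballI)
    fix g
    show "V.subspace (group_alg_comp H g)"
      by (rule V.subspaceI) (auto simp: group_alg_comp_def group_alg_def in_keys_iff lookup_add dest!: subsetD[OF keys_add])
    show "group_alg_comp H g \<subseteq> group_alg H" by (auto simp: group_alg_comp_def)
  next
    fix a :: "'g \<Rightarrow>\<^sub>0 'f" assume a: "a \<in> group_alg H"
    define q where "q = Abs_poly_mapping (\<lambda>g. Poly_Mapping.single g (Poly_Mapping.lookup a g))"
    have q: "Poly_Mapping.lookup q g = Poly_Mapping.single g (Poly_Mapping.lookup a g)" for g
    proof -
      have "{g. Poly_Mapping.single g (Poly_Mapping.lookup a g) \<noteq> 0} \<subseteq> Poly_Mapping.keys a"
        by (auto simp: in_keys_iff)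
      then show ?thesis unfolding q_def by (subst lookup_Abs_poly_mapping) (auto intro: finite_subset)
    qed
    show "\<exists>!p. (\<forall>g. Poly_Mapping.lookup p g \<in> group_alg_comp H g) \<and>
        a = (\<Sum>g\<in>Poly_Mapping.keys p. Poly_Mapping.lookup p g)"
    proof (rule ex1I[of _ q])
      have "Poly_Mapping.keys q \<subseteq> Poly_Mapping.keys a" by (auto simp: in_keys_iff q)
      then have "(\<Sum>g\<in>Poly_Mapping.keys q. Poly_Mapping.lookup q g) = a"
        by (subst sum_keys_superset'[of "Poly_Mapping.keys a"]) (simp_all add: q poly_mapping_sum_single)
      then show "(\<forall>g. Poly_Mapping.lookup q g \<in> group_alg_comp H g) \<and>
        a = (\<Sum>g\<in>Poly_Mapping.keys q. Poly_Mapping.lookup q g)"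
        using a by (auto simp: comp q group_alg_def in_keys_iff)
    next
      fix p :: "'g \<Rightarrow>\<^sub>0 'g \<Rightarrow>\<^sub>0 'f"
      assume p: "(\<forall>g. Poly_Mapping.lookup p g \<in> group_alg_comp H g) \<and>
        a = (\<Sum>g\<in>Poly_Mapping.keys p. Poly_Mapping.lookup p g)"
      define c where "c g = Poly_Mapping.lookup (Poly_Mapping.lookup p g) g" for g
      have pc: "Poly_Mapping.lookup p g = Poly_Mapping.single g (c g)" for g
        using p by (simp add: comp c_def)
      have "Poly_Mapping.lookup a h = c h" for h
      proof -
        have "Poly_Mapping.lookup a h = (\<Sum>g\<in>Poly_Mapping.keys p. Poly_Mapping.lookup (Poly_Mapping.lookup p g) h)"
          using p by (simp add: lookup_sum)
        also have "\<dots> = (\<Sum>g\<in>Poly_Mapping.keys p. if g = h then c h else 0)"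
          by (rule sum.cong) (auto simp: pc lookup_single when_def)
        also have "\<dots> = c h" 
          by (auto simp: in_keys_iff pc) (metis lookup_single_eq lookup_zero)
        finally show ?thesis .
      qed
      then show "p = q" by (intro poly_mapping_eqI) (simp add: pc q)
    qed
  qed
qed

text \<open>A decomposition of a pair is a pair of decompositions, merged over the union of their
  supports; projections reduce uniqueness to the factors. Two applications grade the triples of the
  triangular algebra.\<close>

lemma graded_space_times:
  fixes s1 :: "'f::field \<Rightarrow> 'a::ab_group_add \<Rightarrow> 'a" and s2 :: "'f \<Rightarrow> 'b::ab_group_add \<Rightarrow> 'b"
  assumes "vector_space s1" "vector_space s2" "vector_space s"
    and s: "\<And>c x y. s c (x, y) = (s1 c x, s2 c y)"
    and A: "graded_space s1 A \<Gamma>" and B: "graded_space s2 B \<Delta>"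
  shows "graded_space s (A \<times> B) (\<lambda>g. \<Gamma> g \<times> \<Delta> g)"
proof -
  interpret V1: vector_space s1 by fact
  interpret V2: vector_space s2 by fact
  interpret V: vector_space s by fact
  show ?thesis
    unfolding graded_space_def
  proof (intro conjI allI ballI)
    fix g
    have "V1.subspace (\<Gamma> g)" "V2.subspace (\<Delta> g)" using A B by (auto simp: graded_space_def)
    then show "V.subspace (\<Gamma> g \<times> \<Delta> g)"
      by (intro V.subspaceI)
        (auto simp: s V1.subspace_0 V2.subspace_0 V1.subspace_add V2.subspace_add
          V1.subspace_scale V2.subspace_scale zero_prod_def)
    show "\<Gamma> g \<times> \<Delta> g \<subseteq> A \<times> B" using A B by (auto simp: graded_space_def)
  next
    fix x assume x: "x \<in> A \<times> B"
    have ex1: "\<exists>!p. (\<forall>g. Poly_Mapping.lookup p g \<in> \<Gamma> g) \<and>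
        fst x = (\<Sum>g\<in>Poly_Mapping.keys p. Poly_Mapping.lookup p g)"
      "\<exists>!p. (\<forall>g. Poly_Mapping.lookup p g \<in> \<Delta> g) \<and>
        snd x = (\<Sum>g\<in>Poly_Mapping.keys p. Poly_Mapping.lookup p g)"
    proof -
      have "fst x \<in> A" "snd x \<in> B" using x by auto
      then show "\<exists>!p. (\<forall>g. Poly_Mapping.lookup p g \<in> \<Gamma> g) \<and>
        fst x = (\<Sum>g\<in>Poly_Mapping.keys p. Poly_Mapping.lookup p g)"
        "\<exists>!p. (\<forall>g. Poly_Mapping.lookup p g \<in> \<Delta> g) \<and>
        snd x = (\<Sum>g\<in>Poly_Mapping.keys p. Poly_Mapping.lookup p g)"
        using A B unfolding graded_space_def by blast+
    qed
    then obtain p q where p: "\<And>g. Poly_Mapping.lookup p g \<in> \<Gamma> g"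
        "fst x = (\<Sum>g\<in>Poly_Mapping.keys p. Poly_Mapping.lookup p g)"
      and q: "\<And>g. Poly_Mapping.lookup q g \<in> \<Delta> g"
        "snd x = (\<Sum>g\<in>Poly_Mapping.keys q. Poly_Mapping.lookup q g)" by metis
    let ?S = "Poly_Mapping.keys p \<union> Poly_Mapping.keys q"
    define t where "t = Abs_poly_mapping (\<lambda>g. (Poly_Mapping.lookup p g, Poly_Mapping.lookup q g))"
    have t: "Poly_Mapping.lookup t g = (Poly_Mapping.lookup p g, Poly_Mapping.lookup q g)" for g
    proof -
      have "{g. (Poly_Mapping.lookup p g, Poly_Mapping.lookup q g) \<noteq> 0} \<subseteq> ?S"
        by (auto simp: in_keys_iff zero_prod_def)
      moreover have "finite ?S" by simp
      ultimately show ?thesis unfolding t_def by (subst lookup_Abs_poly_mapping) (auto intro: finite_subset)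
    qed
    show "\<exists>!t. (\<forall>g. Poly_Mapping.lookup t g \<in> \<Gamma> g \<times> \<Delta> g) \<and>
        x = (\<Sum>g\<in>Poly_Mapping.keys t. Poly_Mapping.lookup t g)"
    proof (rule ex1I[of _ t])
      have "Poly_Mapping.keys t \<subseteq> ?S" by (auto simp: in_keys_iff t zero_prod_def)
      then have "(\<Sum>g\<in>Poly_Mapping.keys t. Poly_Mapping.lookup t g)
          = (\<Sum>g\<in>?S. (Poly_Mapping.lookup p g, Poly_Mapping.lookup q g))"
        by (subst sum_keys_superset'[of ?S]) (simp_all add: t)
      also have "\<dots> = (\<Sum>g\<in>?S. Poly_Mapping.lookup p g, \<Sum>g\<in>?S. Poly_Mapping.lookup q g)"
        by (simp add: prod_eq_iff fst_sum snd_sum)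
      also have "\<dots> = x"
        using p(2) q(2) sum_keys_superset'[of ?S p] sum_keys_superset'[of ?S q]
        by (simp add: prod_eq_iff)
      finally show "(\<forall>g. Poly_Mapping.lookup t g \<in> \<Gamma> g \<times> \<Delta> g) \<and>
          x = (\<Sum>g\<in>Poly_Mapping.keys t. Poly_Mapping.lookup t g)"
        using p(1) q(1) by (simp add: t)
    next
      fix t'
      assume t': "(\<forall>g. Poly_Mapping.lookup t' g \<in> \<Gamma> g \<times> \<Delta> g) \<and>
          x = (\<Sum>g\<in>Poly_Mapping.keys t'. Poly_Mapping.lookup t' g)"
      have z: "fst (0 :: 'a \<times> 'b) = 0" "snd (0 :: 'a \<times> 'b) = 0" by simp_all
      have l: "Poly_Mapping.lookup (Poly_Mapping.map fst t') g = fst (Poly_Mapping.lookup t' g)"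
        "Poly_Mapping.lookup (Poly_Mapping.map snd t') g = snd (Poly_Mapping.lookup t' g)" for g
        by (simp_all add: lookup_map_zero)
      have "fst x = (\<Sum>g\<in>Poly_Mapping.keys (Poly_Mapping.map fst t'). Poly_Mapping.lookup (Poly_Mapping.map fst t') g)"
        "snd x = (\<Sum>g\<in>Poly_Mapping.keys (Poly_Mapping.map snd t'). Poly_Mapping.lookup (Poly_Mapping.map snd t') g)"
        using t' sum_keys_map[of fst _ t', OF z(1) finite_keys order_refl]
          sum_keys_map[of snd _ t', OF z(2) finite_keys order_refl]
        by (simp_all add: fst_sum snd_sum)
      moreover have "Poly_Mapping.lookup (Poly_Mapping.map fst t') g \<in> \<Gamma> g"
        "Poly_Mapping.lookup (Poly_Mapping.map snd t') g \<in> \<Delta> g" for g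
        using t' by (auto simp: l mem_Times_iff)
      ultimately have "Poly_Mapping.map fst t' = p" "Poly_Mapping.map snd t' = q"
        using ex1 p q by blast+
      then show "t' = t" by (intro poly_mapping_eqI) (simp add: t prod_eq_iff flip: l)
    qed
  qed
qed

lemma vector_space_times:
  fixes s1 :: "'f::field \<Rightarrow> 'a::ab_group_add \<Rightarrow> 'a" and s2 :: "'f \<Rightarrow> 'b::ab_group_add \<Rightarrow> 'b"
  assumes "vector_space s1" "vector_space s2" and s: "\<And>c x y. s c (x, y) = (s1 c x, s2 c y)"
  shows "vector_space s"
proof -
  interpret V1: vector_space s1 by fact
  interpret V2: vector_space s2 by fact
  show ?thesis
    by unfold_locales
      (auto simp: s V1.scale_right_distrib V2.scale_right_distrib V1.scale_left_distrib V2.scale_left_distrib)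
qed

text \<open>The product rule alone makes a spanning family of nonzero elements linearly independent,
  since \<open>B\<^sub>x\<^sub>x\<close> and \<open>B\<^sub>y\<^sub>y\<close> cut out the coefficient of \<open>B\<^sub>x\<^sub>y\<close>.\<close>

lemma incidence_algebra_of_matrix_units:
  fixes s :: "'f::field \<Rightarrow> 'a::ab_group_add \<Rightarrow> 'a" and B :: "'x \<times> 'x \<Rightarrow> 'a"
  assumes vs: "vector_space s"
    and fin: "finite X" and po: "partial_order_on X r"
    and A: "0 \<in> A" "\<And>x y. x \<in> A \<Longrightarrow> y \<in> A \<Longrightarrow> x + y \<in> A" "\<And>c x. x \<in> A \<Longrightarrow> s c x \<in> A"
    and mul_add: "\<And>x y z. x \<in> A \<Longrightarrow> y \<in> A \<Longrightarrow> z \<in> A \<Longrightarrow> mul (x + y) z = mul x z + mul y z"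
      "\<And>x y z. x \<in> A \<Longrightarrow> y \<in> A \<Longrightarrow> z \<in> A \<Longrightarrow> mul x (y + z) = mul x y + mul x z"
    and mul_scale: "\<And>c x y. x \<in> A \<Longrightarrow> y \<in> A \<Longrightarrow> mul (s c x) y = s c (mul x y)"
      "\<And>c x y. x \<in> A \<Longrightarrow> y \<in> A \<Longrightarrow> mul x (s c y) = s c (mul x y)"
    and B: "\<And>k. k \<in> r \<Longrightarrow> B k \<in> A" "\<And>k. k \<in> r \<Longrightarrow> B k \<noteq> 0"
    and B_mult: "\<And>x y w z. (x, y) \<in> r \<Longrightarrow> (w, z) \<in> r \<Longrightarrow>
      mul (B (x, y)) (B (w, z)) = (if y = w then B (x, z) else 0)"
    and span: "\<And>a. a \<in> A \<Longrightarrow> \<exists>c. a = (\<Sum>k\<in>r. s (c k) (B k))"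
  obtains \<theta> where "bij_betw \<theta> A (inc_carrier r)"
    "\<And>x y. x \<in> A \<Longrightarrow> y \<in> A \<Longrightarrow> \<theta> (x + y) = \<theta> x + \<theta> y"
    "\<And>c x. x \<in> A \<Longrightarrow> \<theta> (s c x) = pm_scale c (\<theta> x)"
    "\<And>x y. x \<in> A \<Longrightarrow> y \<in> A \<Longrightarrow> \<theta> (mul x y) = inc_mult (\<theta> x) (\<theta> y)"
proof -
  interpret vector_space s by fact
  have finr: "finite r" using r_subset[OF fin po] fin finite_subset by blast
  \<comment> \<open>The linear map sending the matrix unit at \<open>k\<close> to
    \<open>B k\<close>; its inverse is the required isomorphism.\<close>
  define L where "L p = (\<Sum>k\<in>r. s (Poly_Mapping.lookup p k) (B k))" for p :: "'x \<times> 'x \<Rightarrow>\<^sub>0 'f"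
  have sum_in: "(\<Sum>k\<in>S. f k) \<in> A" if "\<And>k. k \<in> S \<Longrightarrow> f k \<in> A" for S and f :: "'k \<Rightarrow> 'a"
    using that by (induction S rule: infinite_finite_induct) (auto simp: A)
  have L_in: "L p \<in> A" for p unfolding L_def by (rule sum_in) (auto simp: A B)
  have L_add: "L (p + q) = L p + L q" for p q
    by (simp add: L_def lookup_add scale_left_distrib sum.distrib)
  have L_scale: "L (pm_scale c p) = s c (L p)" for c p
    by (simp add: L_def scale_sum_right)
  have mul_0: "mul 0 z = 0" "mul z 0 = 0" if "z \<in> A" for z
    using mul_add(1)[OF A(1) A(1) that] mul_add(2)[OF that A(1) A(1)] by auto
  have mul_sum_left: "mul (\<Sum>k\<in>S. f k) z = (\<Sum>k\<in>S. mul (f k) z)"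
    if "\<And>k. k \<in> S \<Longrightarrow> f k \<in> A" "z \<in> A" for S z and f :: "'x \<times> 'x \<Rightarrow> 'a"
    using that(1)
    by (induction S rule: infinite_finite_induct) (auto simp: mul_add that(2) mul_0 sum_in)
  have mul_sum_right: "mul z (\<Sum>k\<in>S. f k) = (\<Sum>k\<in>S. mul z (f k))"
    if "\<And>k. k \<in> S \<Longrightarrow> f k \<in> A" "z \<in> A" for S z and f :: "'x \<times> 'x \<Rightarrow> 'a"
    using that(1)
    by (induction S rule: infinite_finite_induct) (auto simp: mul_add that(2) mul_0 sum_in)
  have L_mult: "L (inc_mult p q) = mul (L p) (L q)"
    if p: "p \<in> inc_carrier r" and q: "q \<in> inc_carrier r" for p q
  proof -
    let ?p = "Poly_Mapping.lookup p" and ?q = "Poly_Mapping.lookup q"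
    \<comment> \<open>Coefficients vanish outside \<open>r\<close>, so sums over \<open>r\<close>
      may run over the full square and be matched with the matrix product.\<close>
    have ext: "(\<Sum>k\<in>r. f k) = (\<Sum>x\<in>X. \<Sum>y\<in>X. f (x, y))" if "\<And>k. k \<notin> r \<Longrightarrow> f k = 0" for f :: "_ \<Rightarrow> 'a"
    proof -
      have "(\<Sum>k\<in>r. f k) = (\<Sum>k\<in>X \<times> X. f k)"
        by (rule sum.mono_neutral_left) (use fin r_subset[OF fin po] that in auto)
      then show ?thesis by (simp add: sum.cartesian_product')
    qed
    have "mul (L p) (L q) = (\<Sum>k\<in>r. s (?p k) (mul (B k) (L q)))"
      unfolding L_def[of p] by (simp add: mul_sum_left A B L_in mul_scale)
    also have "\<dots> = (\<Sum>k\<in>r. \<Sum>l\<in>r. s (?p k) (s (?q l) (mul (B k) (B l))))"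
      unfolding L_def[of q] by (intro sum.cong refl) (simp add: mul_sum_right A B mul_scale scale_sum_right)
    also have "\<dots> = (\<Sum>k\<in>r. \<Sum>l\<in>r. s (?p k) (s (?q l) (if snd k = fst l then B (fst k, snd l) else 0)))"
      using B_mult by (intro sum.cong refl) (auto simp: split: prod.splits)
    also have "\<dots> = (\<Sum>x\<in>X. \<Sum>y\<in>X. \<Sum>w\<in>X. \<Sum>z\<in>X. s (?p (x, y)) (s (?q (w, z)) (if y = w then B (x, z) else 0)))"
      by (simp add: ext inc_carrierD[OF p] inc_carrierD[OF q] cong: if_cong)
    also have "\<dots> = (\<Sum>x\<in>X. \<Sum>y\<in>X. \<Sum>z\<in>X. s (?p (x, y) * ?q (y, z)) (B (x, z)))"
    proof (rule sum.cong[OF refl], rule sum.cong[OF refl])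
      fix x y assume "y \<in> X"
      have "(\<Sum>w\<in>X. \<Sum>z\<in>X. s (?p (x, y)) (s (?q (w, z)) (if y = w then B (x, z) else 0)))
          = (\<Sum>w\<in>X. if w = y then \<Sum>z\<in>X. s (?p (x, y) * ?q (y, z)) (B (x, z)) else 0)"
        by (intro sum.cong refl) auto
      then show "(\<Sum>w\<in>X. \<Sum>z\<in>X. s (?p (x, y)) (s (?q (w, z)) (if y = w then B (x, z) else 0)))
          = (\<Sum>z\<in>X. s (?p (x, y) * ?q (y, z)) (B (x, z)))" using fin \<open>y \<in> X\<close> by simp
    qed
    also have "\<dots> = (\<Sum>x\<in>X. \<Sum>z\<in>X. s (\<Sum>y\<in>X. ?p (x, y) * ?q (y, z)) (B (x, z)))"
      by (rule sum.cong[OF refl], subst sum.swap) (simp add: scale_sum_left)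
    also have "\<dots> = (\<Sum>k\<in>r. s (Poly_Mapping.lookup (inc_mult p q) k) (B k))"
      using inc_carrierD[OF inc_mult_closed[OF fin po p q]]
      by (subst ext) (simp_all add: lookup_inc_mult[OF fin po p q])
    finally show ?thesis by (simp add: L_def)
  qed
  have coeff: "mul (B (x, x)) (mul (L p) (B (y, y))) = s (Poly_Mapping.lookup p (x, y)) (B (x, y))"
    if xy: "(x, y) \<in> r" for p x y
  proof -
    have xx: "(x, x) \<in> r" and yy: "(y, y) \<in> r" using xy r_subset[OF fin po] r_refl[OF fin po] by auto
    have in_A: "s c (if b then B k else 0) \<in> A" if "k \<in> r" for c b k using that A B by simp
    have "mul (L p) (B (y, y)) = (\<Sum>k\<in>r. s (Poly_Mapping.lookup p k) (mul (B k) (B (y, y))))"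
      unfolding L_def using yy by (simp add: mul_sum_left A B mul_scale)
    also have "\<dots> = (\<Sum>k\<in>r. s (Poly_Mapping.lookup p k) (if snd k = y then B k else 0))"
      using B_mult yy by (intro sum.cong refl) (auto split: prod.splits)
    finally have "mul (B (x, x)) (mul (L p) (B (y, y)))
        = (\<Sum>k\<in>r. mul (B (x, x)) (s (Poly_Mapping.lookup p k) (if snd k = y then B k else 0)))"
      using xx by (simp add: mul_sum_right in_A B)
    also have "\<dots> = (\<Sum>k\<in>r. if k = (x, y) then s (Poly_Mapping.lookup p (x, y)) (B (x, y)) else 0)"
    proof (intro sum.cong refl)
      fix k assume k: "k \<in> r"
      obtain a b where ab: "k = (a, b)" by force
      show "mul (B (x, x)) (s (Poly_Mapping.lookup p k) (if snd k = y then B k else 0))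
        = (if k = (x, y) then s (Poly_Mapping.lookup p (x, y)) (B (x, y)) else 0)"
        using k xx B_mult[OF xx, of a b] by (auto simp: ab mul_scale B mul_0 A)
    qed
    finally show ?thesis using xy finr by simp
  qed
  have L0: "p = 0" if p: "p \<in> inc_carrier r" and "L p = 0" for p
  proof (rule poly_mapping_eqI)
    fix k :: "'x \<times> 'x"
    obtain x y where k: "k = (x, y)" by force
    show "Poly_Mapping.lookup p k = Poly_Mapping.lookup 0 k"
    proof (cases "k \<in> r")
      case True
      then have "(x, x) \<in> r" "(y, y) \<in> r" using k r_subset[OF fin po] r_refl[OF fin po] by auto
      then have "s (Poly_Mapping.lookup p (x, y)) (B (x, y)) = 0"
        using coeff[of x y p] True k that(2) by (simp add: mul_0 B)
      then show ?thesis using B(2)[OF True] k by simp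
    qed (simp add: inc_carrierD[OF p])
  qed
  have bij: "bij_betw L (inc_carrier r) A"
    unfolding bij_betw_def
  proof
    show "inj_on L (inc_carrier r)"
    proof (rule inj_onI)
      fix p q assume pq: "p \<in> inc_carrier r" "q \<in> inc_carrier r" "L p = L q"
      have "L (p - q) = 0" using L_add[of "p - q" q] pq(3) by simp
      then show "p = q" using L0[OF inc_carrier_closed(3)[OF pq(1,2)]] by simp
    qed
    have "a \<in> L ` inc_carrier r" if "a \<in> A" for a
    proof -
      obtain c where c: "a = (\<Sum>k\<in>r. s (c k) (B k))" using span[OF \<open>a \<in> A\<close>] by blast
      define p where "p = (\<Sum>k\<in>r. Poly_Mapping.single k (c k))"
      have p: "Poly_Mapping.lookup p k = (if k \<in> r then c k else 0)" for k
      proof -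
        have "Poly_Mapping.lookup p k = (\<Sum>l\<in>r. if l = k then c k else 0)"
          unfolding p_def lookup_sum by (rule sum.cong) (auto simp: lookup_single when_def)
        then show ?thesis using finr by simp
      qed
      have "p \<in> inc_carrier r" by (rule inc_carrierI) (simp add: p)
      moreover have "L p = a" by (simp add: L_def p c)
      ultimately show ?thesis by blast
    qed
    then show "L ` inc_carrier r = A" using L_in by blast
  qed
  define \<theta> where "\<theta> = inv_into (inc_carrier r) L"
  have \<theta>: "bij_betw \<theta> A (inc_carrier r)" unfolding \<theta>_def by (rule bij_betw_inv_into[OF bij])
  have \<theta>_in: "\<theta> a \<in> inc_carrier r" and L\<theta>: "L (\<theta> a) = a" if "a \<in> A" for a
    using \<theta> bij that by (auto simp: bij_betw_def \<theta>_def f_inv_into_f)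
  have \<theta>L: "\<theta> (L p) = p" if "p \<in> inc_carrier r" for p
    using bij that by (simp add: bij_betw_def \<theta>_def)
  show thesis
  proof (rule that[OF \<theta>])
    fix x y c assume x: "x \<in> A"
    show "\<theta> (s c x) = pm_scale c (\<theta> x)"
      using \<theta>L[OF inc_carrier_closed(4)[OF \<theta>_in[OF x]], of c] x by (simp add: L_scale L\<theta>)
    assume y: "y \<in> A"
    show "\<theta> (x + y) = \<theta> x + \<theta> y"
      using \<theta>L[OF inc_carrier_closed(2)[OF \<theta>_in[OF x] \<theta>_in[OF y]]] x y by (simp add: L_add L\<theta>)
    show "\<theta> (mul x y) = inc_mult (\<theta> x) (\<theta> y)"
      using \<theta>L[OF inc_mult_closed[OF fin po \<theta>_in[OF x] \<theta>_in[OF y]]] x y by (simp add: L_mult \<theta>_in L\<theta>)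
  qed
qed

lemma group_alg_comp_mult:
  fixes a b :: "'g::ab_group_add \<Rightarrow>\<^sub>0 'f::field"
  assumes "is_subgroup H" "a \<in> group_alg_comp H g" "b \<in> group_alg_comp H h"
  shows "a * b \<in> group_alg_comp H (g + h)"
  using assms group_alg_mult[OF assms(1), of a b] keys_mult[of a b]
  by (fastforce simp: group_alg_comp_def)

section \<open>The triangular algebra as a graded algebra and as an incidence algebra\<close>

context graded_bimodule
begin

lemma graded_algebra_tri:
  assumes sub1: "is_subgroup H1" and sub2: "is_subgroup H2"
  shows "graded_algebra (tri_scale s) (tri_carrier H1 H2) (tri_mult lact ract) (tri_comp H1 H2 M)"
    and "vector_space (tri_scale s :: _ \<Rightarrow> ('g \<Rightarrow>\<^sub>0 'f) \<times> 'm \<times> ('g \<Rightarrow>\<^sub>0 'f) \<Rightarrow> _)"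
proof -
  let ?s2 = "\<lambda>c (m, b). (s c m, pm_scale c b :: 'g \<Rightarrow>\<^sub>0 'f)"
  have vs2: "vector_space ?s2"
    by (rule vector_space_times[OF vector_space vector_space_pm_scale]) simp
  have ts: "tri_scale s c (a, y) = (pm_scale c a, ?s2 c y)" for c a and y :: "'m \<times> ('g \<Rightarrow>\<^sub>0 'f)"
    by (cases y) simp
  show vs: "vector_space (tri_scale s :: _ \<Rightarrow> ('g \<Rightarrow>\<^sub>0 'f) \<times> 'm \<times> ('g \<Rightarrow>\<^sub>0 'f) \<Rightarrow> _)"
    by (rule vector_space_times[OF vector_space_pm_scale vs2 ts])
  have "graded_space ?s2 (UNIV \<times> group_alg H2) (\<lambda>g. M g \<times> group_alg_comp H2 g)"
    by (rule graded_space_times[OF vector_space vector_space_pm_scale vs2 _ graded graded_space_group_alg]) simp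
  then have gs: "graded_space (tri_scale s) (tri_carrier H1 H2) (tri_comp H1 H2 M)"
    unfolding tri_carrier_def tri_comp_def
    by (rule graded_space_times[OF vector_space_pm_scale vs2 vs ts graded_space_group_alg])
  have sub: "MS.subspace (M g)" for g using graded by (auto simp: graded_space_def)
  \<comment> \<open>The grading axiom is two-sided; inserting the unit, of degree \<open>0\<close>,
    on the other side yields the one-sided statements.\<close>
  have one: "(1 :: 'g \<Rightarrow>\<^sub>0 'f) \<in> group_alg_comp H1 0" "(1 :: 'g \<Rightarrow>\<^sub>0 'f) \<in> group_alg_comp H2 0"
    using group_alg_one sub1 sub2 by (auto simp: group_alg_comp_def)
  have "tri_mult lact ract x y \<in> tri_comp H1 H2 M (g + h)"
    if xy: "x \<in> tri_comp H1 H2 M g" "y \<in> tri_comp H1 H2 M h" for x y g h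
  proof -
    obtain a m b a' m' b' where eq: "x = (a, m, b)" "y = (a', m', b')" by (metis prod_cases3)
    then have mem: "a \<in> group_alg_comp H1 g" "m \<in> M g" "b \<in> group_alg_comp H2 g"
      "a' \<in> group_alg_comp H1 h" "m' \<in> M h" "b' \<in> group_alg_comp H2 h"
      using xy by (auto simp: tri_comp_def)
    have "lact a m' \<in> M (g + h)" using graded_act[OF mem(1,5) one(2)] by simp
    moreover have "ract m b' \<in> M (g + h)" using graded_act[OF one(1) mem(2,6)] by simp
    ultimately show ?thesis
      using mem MS.subspace_add[OF sub]
      by (simp add: eq tri_comp_def group_alg_comp_mult[OF sub1] group_alg_comp_mult[OF sub2])
  qed
  then show "graded_algebra (tri_scale s) (tri_carrier H1 H2) (tri_mult lact ract) (tri_comp H1 H2 M)"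
    using gs by (simp add: graded_algebra_def)
qed

lemma rank_one_imp_incidence:
  assumes sub1: "is_subgroup H1" and fin1: "finite H1" and sub2: "is_subgroup H2" and fin2: "finite H2"
    and s1: "splits TYPE('f) H1" and s2: "splits TYPE('f) H2"
    and rank: "\<And>\<chi> \<eta>. \<chi> \<in> chars H1 \<Longrightarrow> \<eta> \<in> chars H2 \<Longrightarrow>
      \<exists>u. \<forall>m. \<exists>c. ract (lact (char_idem H1 \<chi>) m) (char_idem H2 \<eta>) = s c u"
  shows "\<exists>(X :: nat set) r (\<Gamma> :: 'g \<Rightarrow> (nat \<times> nat \<Rightarrow>\<^sub>0 'f) set) \<theta>.
            finite X \<and> partial_order_on X r \<and>
            graded_algebra pm_scale (inc_carrier r) inc_mult \<Gamma> \<and>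
            graded_algebra_iso
              (tri_scale s) (tri_carrier H1 H2) (tri_mult lact ract) (tri_comp H1 H2 M)
              pm_scale (inc_carrier r) inc_mult \<Gamma> \<theta>"
proof -
  note card = splits_card[OF s1] splits_card[OF s2]
  let ?e = "char_idem H1 :: ('g \<Rightarrow> 'f) \<Rightarrow> _" and ?d = "char_idem H2 :: ('g \<Rightarrow> 'f) \<Rightarrow> _"
  let ?comp = "\<lambda>\<chi> \<eta> m. ract (lact (?e \<chi>) m) (?d \<eta>)"
  have zero: "0 \<in> H1" "0 \<in> H2" using is_subgroupD(1) sub1 sub2 by auto
  have fc1: "finite (chars H1 :: ('g \<Rightarrow> 'f) set)" and fc2: "finite (chars H2 :: ('g \<Rightarrow> 'f) set)"
    by (rule finite_chars sub1 fin1 sub2 fin2)+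
  \<comment> \<open>The spanning vector is taken inside the component, so that the idempotents on
    either side fix it or annihilate it.\<close>
  have "\<exists>u. (\<exists>m. u = ?comp \<chi> \<eta> m) \<and> (\<forall>m. \<exists>c. ?comp \<chi> \<eta> m = s c u)"
    if ce: "\<chi> \<in> chars H1" "\<eta> \<in> chars H2" for \<chi> \<eta> :: "'g \<Rightarrow> 'f"
  proof (cases "\<exists>m. ?comp \<chi> \<eta> m \<noteq> 0")
    case True
    then obtain m0 where m0: "?comp \<chi> \<eta> m0 \<noteq> 0" by blast
    obtain u where u: "\<And>m. \<exists>c. ?comp \<chi> \<eta> m = s c u" using rank[OF ce] by blast
    obtain c0 where c0: "?comp \<chi> \<eta> m0 = s c0 u" using u by blast
    then have "c0 \<noteq> 0" using m0 by auto
    have "\<exists>c. ?comp \<chi> \<eta> m = s c (?comp \<chi> \<eta> m0)" for m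
    proof -
      obtain c where "?comp \<chi> \<eta> m = s c u" using u by blast
      then have "?comp \<chi> \<eta> m = s (c / c0) (?comp \<chi> \<eta> m0)" using \<open>c0 \<noteq> 0\<close> by (simp add: c0)
      then show ?thesis by blast
    qed
    then show ?thesis by blast
  next
    case False
    then show ?thesis by (intro exI[of _ 0]) auto
  qed
  then obtain u where u_comp: "\<And>\<chi> \<eta>. \<chi> \<in> chars H1 \<Longrightarrow> \<eta> \<in> chars H2 \<Longrightarrow> \<exists>m. u \<chi> \<eta> = ?comp \<chi> \<eta> m"
    and u_span: "\<And>\<chi> \<eta> m. \<chi> \<in> chars H1 \<Longrightarrow> \<eta> \<in> chars H2 \<Longrightarrow> \<exists>c. ?comp \<chi> \<eta> m = s c (u \<chi> \<eta>)"
    by metis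
  \<comment> \<open>The poset is sought on natural numbers: characters of \<open>H1\<close> are
    numbered below \<open>n1\<close>, those of \<open>H2\<close> from \<open>n1\<close> up to
    \<open>n\<close>.\<close>
  define n1 where "n1 = card (chars H1 :: ('g \<Rightarrow> 'f) set)"
  define n where "n = n1 + card (chars H2 :: ('g \<Rightarrow> 'f) set)"
  obtain c1 :: "nat \<Rightarrow> 'g \<Rightarrow> 'f" where c1: "bij_betw c1 {0..<n1} (chars H1)"
    unfolding n1_def using ex_bij_betw_nat_finite[OF fc1] by blast
  obtain c2' :: "nat \<Rightarrow> 'g \<Rightarrow> 'f" where c2': "bij_betw c2' {0..<n - n1} (chars H2)"
    unfolding n_def using ex_bij_betw_nat_finite[OF fc2] by auto
  define c2 where "c2 y = c2' (y - n1)" for y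
  have c2: "bij_betw c2 {n1..<n} (chars H2)"
  proof -
    have "bij_betw (\<lambda>y. y - n1) {n1..<n} {0..<n - n1}"
      by (rule bij_betwI[of _ _ _ "\<lambda>y. y + n1"]) auto
    then show ?thesis using bij_betw_trans[OF _ c2'] by (simp add: c2_def[abs_def] o_def)
  qed
  have c1_in: "c1 x \<in> chars H1" if "x < n1" for x using c1 that by (auto simp: bij_betw_def)
  have c2_in: "c2 y \<in> chars H2" if "n1 \<le> y" "y < n" for y using c2 that by (auto simp: bij_betw_def)
  have c1_inj: "c1 x = c1 y \<longleftrightarrow> x = y" if "x < n1" "y < n1" for x y
    using c1 that by (auto simp: bij_betw_def inj_on_def)
  have c2_inj: "c2 x = c2 y \<longleftrightarrow> x = y" if "n1 \<le> x" "x < n" "n1 \<le> y" "y < n" for x y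
    using c2 that by (auto simp: bij_betw_def inj_on_def)
  define R where "R = {(x, y). x < n1 \<and> n1 \<le> y \<and> y < n \<and> u (c1 x) (c2 y) \<noteq> 0}"
  define r where "r = Id_on {0..<n} \<union> R"
  have n1n: "n1 \<le> n" by (simp add: n_def)
  \<comment> \<open>Strict pairs lead from numbers below \<open>n1\<close> to numbers from
    \<open>n1\<close> on, so transitivity and antisymmetry have no case with two strict
    pairs.\<close>
  have po: "partial_order_on {0..<n} r"
    using n1n unfolding partial_order_on_def preorder_on_def r_def R_def
    by (auto simp: refl_on_def trans_def antisym_def)
  have finr: "finite r" using r_subset[OF _ po] by (meson finite_SigmaI finite_atLeastLessThan finite_subset)
  then have finr': "finite (Id_on {0..<n})" "finite R" by (simp_all add: r_def)
  define B where "B = (\<lambda>(x, y). if x = y then (if x < n1 then (?e (c1 x), 0, 0) else (0, 0, ?d (c2 x)))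
     else (0 :: 'g \<Rightarrow>\<^sub>0 'f, u (c1 x) (c2 y), 0 :: 'g \<Rightarrow>\<^sub>0 'f))"
  have B_simps: "x < n1 \<Longrightarrow> B (x, x) = (?e (c1 x), 0, 0)" "n1 \<le> x \<Longrightarrow> B (x, x) = (0, 0, ?d (c2 x))"
    "x < n1 \<Longrightarrow> n1 \<le> y \<Longrightarrow> B (x, y) = (0, u (c1 x) (c2 y), 0)" for x y
    by (auto simp: B_def)
  let ?A = "tri_carrier H1 H2 :: (('g \<Rightarrow>\<^sub>0 'f) \<times> 'm \<times> ('g \<Rightarrow>\<^sub>0 'f)) set"
  have A [simp]: "(a, m, b) \<in> ?A \<longleftrightarrow> a \<in> group_alg H1 \<and> b \<in> group_alg H2" for a m b
    by (auto simp: tri_carrier_def)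
  have ee: "?e (c1 x) * ?e (c1 y) = (if x = y then ?e (c1 x) else 0)" if "x < n1" "y < n1" for x y
    using c1_in[OF that(1)] c1_in[OF that(2)] c1_inj[OF that]
    by (auto simp: char_idem_idem[OF sub1 fin1 _ card(1)] char_idem_orthogonal[OF sub1 fin1])
  have dd: "?d (c2 x) * ?d (c2 y) = (if x = y then ?d (c2 x) else 0)" if "n1 \<le> x" "x < n" "n1 \<le> y" "y < n" for x y
    using c2_in[OF that(1,2)] c2_in[OF that(3,4)] c2_inj[OF that]
    by (auto simp: char_idem_idem[OF sub2 fin2 _ card(2)] char_idem_orthogonal[OF sub2 fin2])
  have lu: "lact (?e (c1 w)) (u (c1 x) (c2 y)) = (if w = x then u (c1 x) (c2 y) else 0)"
    if wxy: "w < n1" "x < n1" "n1 \<le> y" "y < n" for w x y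
  proof -
    obtain m where m: "u (c1 x) (c2 y) = ?comp (c1 x) (c2 y) m" 
      using u_comp[OF c1_in[OF wxy(2)] c2_in[OF wxy(3,4)]] by blast
    have "lact (?e (c1 w)) (u (c1 x) (c2 y)) = ract (lact (?e (c1 w) * ?e (c1 x)) m) (?d (c2 y))"
      by (simp add: m lact_ract lact_mult)
    then show ?thesis using ee[OF wxy(1,2)] by (simp add: m)
  qed
  have ru: "ract (u (c1 x) (c2 y)) (?d (c2 w)) = (if w = y then u (c1 x) (c2 y) else 0)"
    if wxy: "n1 \<le> w" "w < n" "x < n1" "n1 \<le> y" "y < n" for w x y
  proof -
    obtain m where m: "u (c1 x) (c2 y) = ?comp (c1 x) (c2 y) m" 
      using u_comp[OF c1_in[OF wxy(3)] c2_in[OF wxy(4,5)]] by blast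
    have "ract (u (c1 x) (c2 y)) (?d (c2 w)) = ract (lact (?e (c1 x)) m) (?d (c2 y) * ?d (c2 w))"
      by (simp add: m ract_mult)
    then show ?thesis using dd[OF wxy(4,5,1,2)] by (auto simp: m)
  qed
  obtain \<theta> where \<theta>: "bij_betw \<theta> ?A (inc_carrier r)"
    "\<And>x y. x \<in> ?A \<Longrightarrow> y \<in> ?A \<Longrightarrow> \<theta> (x + y) = \<theta> x + \<theta> y"
    "\<And>c x. x \<in> ?A \<Longrightarrow> \<theta> (tri_scale s c x) = pm_scale c (\<theta> x)"
    "\<And>x y. x \<in> ?A \<Longrightarrow> y \<in> ?A \<Longrightarrow> \<theta> (tri_mult lact ract x y) = inc_mult (\<theta> x) (\<theta> y)"
  proof (rule incidence_algebra_of_matrix_units[OF graded_algebra_tri(2)[OF sub1 sub2] finite_atLeastLessThan po,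
        of ?A "tri_mult lact ract" B])
    show "0 \<in> ?A" by (simp add: zero_prod_def)
    fix x y z assume x: "x \<in> ?A"
    obtain a m b where xe: "x = (a, m, b)" by (metis prod_cases3)
    have a: "a \<in> group_alg H1" "b \<in> group_alg H2" using x by (auto simp: xe)
    have sc: "pm_scale c a \<in> group_alg H1" if "a \<in> group_alg H1" for H1 c and a :: "'g \<Rightarrow>\<^sub>0 'f"
      using that by (auto simp: group_alg_def in_keys_iff)
    show "tri_scale s c x \<in> ?A" for c using a by (simp add: xe sc)
    assume y: "y \<in> ?A"
    obtain a' m' b' where ye: "y = (a', m', b')" by (metis prod_cases3)
    have a': "a' \<in> group_alg H1" "b' \<in> group_alg H2" using y by (auto simp: ye)
    show "x + y \<in> ?A" using a a' by (simp add: xe ye)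
    show "tri_mult lact ract (tri_scale s c x) y = tri_scale s c (tri_mult lact ract x y)" for c
      using a a' zero by (simp add: xe ye pm_scale_conv mult.assoc lact_mult lact_scalar ract_scale
          MS.scale_right_distrib)
    show "tri_mult lact ract x (tri_scale s c y) = tri_scale s c (tri_mult lact ract x y)" for c
      using a a' zero by (simp add: xe ye pm_scale_conv mult.left_commute lact_scale ract_mult ract_scalar ract_scale
          MS.scale_right_distrib)
    assume z: "z \<in> ?A"
    obtain a'' m'' b'' where ze: "z = (a'', m'', b'')" by (metis prod_cases3)
    have a'': "a'' \<in> group_alg H1" "b'' \<in> group_alg H2" using z by (auto simp: ze)
    show "tri_mult lact ract (x + y) z = tri_mult lact ract x z + tri_mult lact ract y z"
      using a a' a'' by (simp add: xe ye ze lact_add_left ract_add_left distrib_right)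
    show "tri_mult lact ract x (y + z) = tri_mult lact ract x y + tri_mult lact ract x z"
      using a a' a'' by (simp add: xe ye ze lact_add_right ract_add_right distrib_left)
  next
    fix k assume k: "k \<in> r"
    then show "B k \<in> ?A" by (auto simp: r_def R_def B_def)
    show "B k \<noteq> 0"
      using k c1_in c2_in char_idem_nonzero[OF sub1 fin1 _ card(1)] char_idem_nonzero[OF sub2 fin2 _ card(2)]
      by (auto simp: r_def R_def B_def zero_prod_def split: if_splits)
  next
    fix x y w z assume xy: "(x, y) \<in> r" and wz: "(w, z) \<in> r"
    \<comment> \<open>Each pair is diagonal in the first block, diagonal in the second, or strict,
      which leaves nine products to compare.\<close>
    from xy consider "x = y" "x < n1" | "x = y" "n1 \<le> x" "x < n" | "x < n1" "n1 \<le> y" "y < n"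
      by (cases "x < n1") (auto simp: r_def R_def)
    note cxy = this
    from wz consider "w = z" "w < n1" | "w = z" "n1 \<le> w" "w < n" | "w < n1" "n1 \<le> z" "z < n"
      by (cases "w < n1") (auto simp: r_def R_def)
    note cwz = this
    show "tri_mult lact ract (B (x, y)) (B (w, z)) = (if y = w then B (x, z) else 0)"
      by (cases rule: cxy; cases rule: cwz) (auto simp: B_simps ee dd lu ru zero_prod_def)
  next
    fix x assume x: "x \<in> ?A"
    obtain a m b where xe: "x = (a, m, b)" by (metis prod_cases3)
    have a: "a \<in> group_alg H1" "b \<in> group_alg H2" using x by (auto simp: xe)
    have one1: "(\<Sum>x\<in>{0..<n1}. ?e (c1 x)) = 1"
      using s1 sum.reindex_bij_betw[OF c1, of ?e] by (simp add: splits_def)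
    have one2: "(\<Sum>y\<in>{n1..<n}. ?d (c2 y)) = 1"
      using s2 sum.reindex_bij_betw[OF c2, of ?d] by (simp add: splits_def)
    have "a = (\<Sum>x\<in>{0..<n1}. a * ?e (c1 x))" by (simp add: one1 flip: sum_distrib_left)
    then have sa: "a = (\<Sum>x\<in>{0..<n1}. pm_scale (ev (c1 x) a) (?e (c1 x)))"
      using char_idem_mult[OF sub1 fin1 c1_in a(1)] by (simp add: pm_scale_conv)
    have "b = (\<Sum>y\<in>{n1..<n}. b * ?d (c2 y))" by (simp add: one2 flip: sum_distrib_left)
    then have sb: "b = (\<Sum>y\<in>{n1..<n}. pm_scale (ev (c2 y) b) (?d (c2 y)))"
      using char_idem_mult[OF sub2 fin2 c2_in a(2)] by (simp add: pm_scale_conv)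
    have lact_sum: "lact (sum f S) m = (\<Sum>x\<in>S. lact (f x) m)" if "\<And>x. f x \<in> group_alg H1" for f S m
      by (induction S rule: infinite_finite_induct) (auto simp: lact_add_left that group_alg_sum)
    have ract_sum: "ract m (sum f S) = (\<Sum>x\<in>S. ract m (f x))" if "\<And>x. f x \<in> group_alg H2" for f S m
      by (induction S rule: infinite_finite_induct) (auto simp: ract_add_right that group_alg_sum)
    \<comment> \<open>Both units are expanded into idempotents, which splits \<open>m\<close> into
      its components.\<close>
    have "m = ract (lact (\<Sum>x\<in>{0..<n1}. ?e (c1 x)) m) (\<Sum>y\<in>{n1..<n}. ?d (c2 y))"
      by (simp add: one1 one2)
    also have "\<dots> = (\<Sum>x\<in>{0..<n1}. \<Sum>y\<in>{n1..<n}. ?comp (c1 x) (c2 y) m)"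
    proof -
      have ract_suml: "ract (sum f S) b = (\<Sum>x\<in>S. ract (f x) b)" if "b \<in> group_alg H2" for f S b
        by (induction S rule: infinite_finite_induct) (auto simp: ract_add_left that)
      show ?thesis by (simp add: lact_sum ract_sum ract_suml) (rule sum.swap)
    qed
    finally have sm: "m = (\<Sum>x\<in>{0..<n1}. \<Sum>y\<in>{n1..<n}. ?comp (c1 x) (c2 y) m)" .
    define d where "d x y = (SOME c. ?comp (c1 x) (c2 y) m = s c (u (c1 x) (c2 y)))" for x y
    have d: "?comp (c1 x) (c2 y) m = s (d x y) (u (c1 x) (c2 y))" if "x < n1" "n1 \<le> y" "y < n" for x y
      unfolding d_def by (rule someI_ex[OF u_span[OF c1_in[OF that(1)] c2_in[OF that(2,3)]]])
    define c where "c = (\<lambda>(x, y). if x = y then (if x < n1 then ev (c1 x) a else ev (c2 x) b) else d x y)"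
    let ?t = "\<lambda>k. tri_scale s (c k) (B k)"
    have "(\<Sum>k\<in>r. ?t k) = (\<Sum>k\<in>Id_on {0..<n}. ?t k) + (\<Sum>k\<in>R. ?t k)"
      unfolding r_def by (rule sum.union_disjoint[OF finr']) (auto simp: R_def)
    also have "(\<Sum>k\<in>Id_on {0..<n}. ?t k) = (\<Sum>x\<in>{0..<n}. ?t (x, x))"
      by (rule sum.reindex_bij_witness[of _ "\<lambda>x. (x, x)" fst]) auto
    also have "{0..<n} = {0..<n1} \<union> {n1..<n}" using n1n by auto
    also have "(\<Sum>x\<in>\<dots>. ?t (x, x)) = (\<Sum>x\<in>{0..<n1}. ?t (x, x)) + (\<Sum>x\<in>{n1..<n}. ?t (x, x))"
      by (rule sum.union_disjoint) auto
    also have "(\<Sum>x\<in>{0..<n1}. ?t (x, x)) = (a, 0, 0)"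
      by (subst sa) (simp add: B_def c_def prod_eq_iff fst_sum snd_sum pm_scale_conv)
    also have "(\<Sum>x\<in>{n1..<n}. ?t (x, x)) = (0, 0, b)"
      by (subst sb) (simp add: B_def c_def prod_eq_iff fst_sum snd_sum pm_scale_conv)
    \<comment> \<open>Pairs outside \<open>R\<close> have spanning vector \<open>0\<close>, so
      whatever coefficient was chosen for them contributes nothing.\<close>
    also have "(\<Sum>k\<in>R. ?t k) = (\<Sum>k\<in>{0..<n1} \<times> {n1..<n}. ?t k)"
      by (rule sum.mono_neutral_left) (auto simp: R_def B_def zero_prod_def pm_scale_conv)
    also have "\<dots> = (0, m, 0)"
      unfolding sum.cartesian_product'
      by (subst sm) (simp add: B_def c_def d prod_eq_iff fst_sum snd_sum pm_scale_conv)
    finally have "x = (\<Sum>k\<in>r. ?t k)" by (simp add: xe)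
    then show "\<exists>c. x = (\<Sum>k\<in>r. tri_scale s (c k) (B k))" by blast
  qed (rule that; assumption)
  define \<Gamma> where "\<Gamma> = (\<lambda>g. \<theta> ` tri_comp H1 H2 M g)"
  have gr: "graded_algebra (tri_scale s) ?A (tri_mult lact ract) (tri_comp H1 H2 M)"
    by (rule graded_algebra_tri(1)[OF sub1 sub2])
  have sub: "tri_comp H1 H2 M g \<subseteq> ?A" for g
    using gr by (simp add: graded_algebra_def graded_space_def)
  have "graded_space pm_scale (inc_carrier r) \<Gamma>"
    unfolding \<Gamma>_def
  proof (rule graded_space_bij[where \<theta> = \<theta> and A = ?A and \<Gamma> = "tri_comp H1 H2 M" and B = "inc_carrier r"])
    show "vector_space (tri_scale s :: _ \<Rightarrow> ('g \<Rightarrow>\<^sub>0 'f) \<times> 'm \<times> ('g \<Rightarrow>\<^sub>0 'f) \<Rightarrow> _)"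
      by (rule graded_algebra_tri(2)[OF sub1 sub2])
    show "vector_space (pm_scale :: 'f \<Rightarrow> (nat \<times> nat \<Rightarrow>\<^sub>0 'f) \<Rightarrow> _)" by (rule vector_space_pm_scale)
    show "bij_betw \<theta> ?A (inc_carrier r)" by (rule \<theta>(1))
    show "0 \<in> ?A" by (simp add: zero_prod_def)
    show "x + y \<in> ?A" if "x \<in> ?A" "y \<in> ?A" for x y
      using that by (cases x; cases y) auto
    show "graded_space (tri_scale s) ?A (tri_comp H1 H2 M)" using gr by (simp add: graded_algebra_def)
  qed (rule \<theta> inc_carrier_closed; assumption)+
  moreover have "inc_mult x y \<in> \<Gamma> (g + h)" if xg: "x \<in> \<Gamma> g" and yh: "y \<in> \<Gamma> h" for x y g h
  proof -
    obtain x' y' where xy: "x' \<in> tri_comp H1 H2 M g" "y' \<in> tri_comp H1 H2 M h" "x = \<theta> x'" "y = \<theta> y'"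
      using xg yh unfolding \<Gamma>_def by blast
    then have "inc_mult x y = \<theta> (tri_mult lact ract x' y')" using \<theta>(4) sub by (metis subsetD)
    moreover have "tri_mult lact ract x' y' \<in> tri_comp H1 H2 M (g + h)"
      using gr xy by (auto simp: graded_algebra_def)
    ultimately show ?thesis by (simp add: \<Gamma>_def)
  qed
  ultimately have "graded_algebra pm_scale (inc_carrier r) inc_mult \<Gamma>" by (simp add: graded_algebra_def)
  moreover have "graded_algebra_iso (tri_scale s) ?A (tri_mult lact ract) (tri_comp H1 H2 M)
      pm_scale (inc_carrier r) inc_mult \<Gamma> \<theta>"
    using \<theta> by (simp add: graded_algebra_iso_def \<Gamma>_def)
  ultimately show ?thesis using po finite_atLeastLessThan by blast
qed

end

theorem proposition4p2:
  fixes H1 H2 :: "'g::ab_group_add set"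
    and sM :: "'f::field \<Rightarrow> 'm::ab_group_add \<Rightarrow> 'm"
    and lact :: "('g \<Rightarrow>\<^sub>0 'f) \<Rightarrow> 'm \<Rightarrow> 'm"
    and ract :: "'m \<Rightarrow> ('g \<Rightarrow>\<^sub>0 'f) \<Rightarrow> 'm"
    and M :: "'g \<Rightarrow> 'm set"
    and sV :: "'f \<Rightarrow> 'v::ab_group_add \<Rightarrow> 'v"
    and \<rho> :: "'g \<Rightarrow> 'v \<Rightarrow> 'v"
    and V :: "'g \<Rightarrow> 'v set"
  assumes "is_subgroup H1" and "finite H1"
    and "is_subgroup H2" and "finite H2"
    and "graded_bimodule H1 H2 sM lact ract M"
    and "yetter_drinfeld (H1 \<inter> H2) sV \<rho> V"
    and "\<exists>\<phi>. graded_iso_ind H1 H2 lact ract M sV \<rho> V \<phi>"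
  shows "(\<exists>(X :: nat set) r (\<Gamma> :: 'g \<Rightarrow> (nat \<times> nat \<Rightarrow>\<^sub>0 'f) set) \<theta>.
            finite X \<and> partial_order_on X r \<and>
            graded_algebra pm_scale (inc_carrier r) inc_mult \<Gamma> \<and>
            graded_algebra_iso
              (tri_scale sM) (tri_carrier H1 H2) (tri_mult lact ract) (tri_comp H1 H2 M)
              pm_scale (inc_carrier r) inc_mult \<Gamma> \<theta>)
         \<longleftrightarrow>
         (\<exists>N \<psi>. regular_submodule (H1 \<inter> H2) N \<and> module_iso_regular (H1 \<inter> H2) sV \<rho> N \<psi>) \<and>
         splitting_field TYPE('f) H1 \<and> splitting_field TYPE('f) H2"
    (is "?inc \<longleftrightarrow> ?reg \<and> ?s1 \<and> ?s2")
proof -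
  obtain \<phi> where \<phi>: "graded_iso_ind H1 H2 lact ract M sV \<rho> V \<phi>" using assms(7) by blast
  interpret induced_bimodule H1 H2 sM lact ract M sV \<rho> V \<phi>
    by (intro induced_bimodule.intro induced_bimodule_axioms.intro assms \<phi>)
  \<comment> \<open>The rank condition links the two sides. It is comparable with
    \<open>?reg\<close> only over splitting fields, so the incidence side has to deliver
    \<open>?s1\<close> and \<open>?s2\<close> together with it.\<close>
  let ?M = "\<forall>\<chi>\<in>chars H1. \<forall>\<eta>\<in>chars H2. \<exists>u. \<forall>m. \<exists>c.
    ract (lact (char_idem H1 \<chi>) m) (char_idem H2 \<eta>) = sM c u"
  have "?reg \<longleftrightarrow> ?M" if s: ?s1 ?s2
  proof -
    note sp = splitting_field_imp_splits[OF sub1 fin1 s(1)] splitting_field_imp_splits[OF sub2 fin2 s(2)]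
    have "splits TYPE('f) (H1 \<inter> H2)" by (rule splits_subgroup(1)[OF sub1 fin1 sub12 _ sp(1)]) simp
    then show ?thesis
      unfolding components_rank_iff[OF sp]
      using Y.regular_submodule_imp_rank[OF sub12 fin12] Y.rank_imp_regular_submodule[OF sub12 fin12]
      by blast
  qed
  moreover have "?M \<and> ?s1 \<and> ?s2" if inc: ?inc
  proof -
    from inc obtain X :: "nat set" and r \<theta> and \<Gamma> :: "'g \<Rightarrow> (nat \<times> nat \<Rightarrow>\<^sub>0 'f) set" where
      fin: "finite X" and po: "partial_order_on X r" and
      iso: "graded_algebra_iso (tri_scale sM) (tri_carrier H1 H2) (tri_mult lact ract) (tri_comp H1 H2 M)
         pm_scale (inc_carrier r) inc_mult \<Gamma> \<theta>"
      by (elim exE conjE) (rule that; assumption)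
    show ?thesis
      by (intro conjI ballI B.incidence_imp_split[OF sub1 fin1 sub2 fin2 fin po iso])
  qed
  moreover have ?inc if ?M ?s1 ?s2
    by (rule B.rank_one_imp_incidence[OF sub1 fin1 sub2 fin2
          splitting_field_imp_splits[OF sub1 fin1 that(2)] splitting_field_imp_splits[OF sub2 fin2 that(3)]])
      (use that(1) in blast)
  ultimately show ?thesis by blast
qed

end
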